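(* Let $(X,d,\mu)$, $p$, $\underline{Q}_\mu$ be as in the context. Let $\theta_2\in(0,\min\{p,\underline{Q}_\mu\})$, $\theta\in[\theta_2,p)$, let $S^1\in\mathcal{ADR}_0(X)$ and $S^2\in\mathcal{ADR}_{\theta_2}(X)$ be closed sets, $S:=S^1\cup S^2$, and $\mathfrak m_k:=2^{k\theta}\mu\lfloor_{S^1}+2^{k(\theta-\theta_2)}\mathcal H_{\theta_2}\lfloor_{S^2}$, $k\in\mathbb N_0$. Then for each $c\ge1$ there is a constant $C>0$ such that for every $f\in L_p(\mathcal H_0\lfloor_{S^1})\cap L_p(\mathcal H_{\theta_2}\lfloor_{S^2})$, $$\mathcal{BSN}_{p,\{\mathfrak m_k\},c}(f)\le C\Big(\|f^\sharp_{\mu\lfloor_{S^1}}|L_p(S^1,\mu)\|+\|f|L_p(S^1,\mu)\|+\|f|\mathrm B^{1-\theta_2/p}_p(S^2)\|+\mathcal{GL}^{(3)}_p(f)\Big).$$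
   Context: Standing setting: $(X,d)$ complete separable metric space, $\mu$ a Borel regular locally finite outer measure, $\operatorname{supp}\mu=X$, uniformly locally doubling (for every $R>0$, $\sup_{r\in(0,R]}\sup_x\mu(B_{2r}(x))/\mu(B_r(x))<\infty$). Balls are closed, $B_r(x)=\{y:d(x,y)\le r\}$, $cB_r(x)=B_{cr}(x)$, $B_k(x)=B_{2^{-k}}(x)$. A fixed $p\in(1,\infty)$; $X$ supports a weak local $(1,p)$-Poincaré inequality (for every $R>0$ there are $C,\lambda\ge1$ with $\inf_c\frac{1}{\mu(B_r(x))}\int_{B_r(x)}|f-c|d\mu\le Cr(\frac{1}{\mu(B_{\lambda r}(x))}\int_{B_{\lambda r}(x)}(\operatorname{lip}f)^pd\mu)^{1/p}$ for Lipschitz $f$, $x\in X$, $r\in(0,R]$). $\underline{Q}_\mu$ is the infimum of $Q>0$ such that for every $R>0$ there is $C$ with $(r_{B'}/r_B)^Q\le C\mu(B')/\mu(B)$ for balls $B'\subset B$, $0<r_{B'}\le r_B\le R$. Notation: $\mathrm{Av}_{G,\mathfrak m}(g)=\mathfrak m(G)^{-1}\int_Gg\,d\mathfrak m$ if $\mathfrak m(G)>0$, else $0$; $\mathcal E_{\mathfrak m}(g,G):=\inf_c\mathrm{Av}_{G,\mathfrak m}(|g-c|)$; $\mathfrak m\lfloor_S(E)=\mathfrak m(E\cap S)$. $\mathcal H_{\vartheta,\delta}(E):=\inf\{\sum\mu(B_{r_i}(x_i))r_i^{-\vartheta}:E\subset\bigcup B_{r_i}(x_i),0<r_i<\delta\}$,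 $\mathcal H_\vartheta=\lim_{\delta\to0}\mathcal H_{\vartheta,\delta}$. $\mathcal{ADR}_\vartheta(X)$: closed $S'$ with $\varkappa_1\mu(B_r(x))r^{-\vartheta}\le\mathcal H_\vartheta(B_r(x)\cap S')\le\varkappa_2\mu(B_r(x))r^{-\vartheta}$ for $x\in S'$, $r\in(0,1]$. Besov norm: $\|f|\mathrm B^s_p(S')\|:=\|f|L_p(\mathcal H_\vartheta\lfloor_{S'})\|+(\sum_{k\ge1}2^{ksp}\int_{S'}(\mathcal E_{\mathcal H_\vartheta\lfloor_{S'}}(f,B_k(x)))^pd\mathcal H_\vartheta(x))^{1/p}$ for $S'\in\mathcal{ADR}_\vartheta(X)$. Brudnyi–Shvartsman functional: for $c\ge1$, a finite family of closed balls $\{B_{r_i}(x_i)\}_{i=1}^M$ is $(S,c)$-nice if the balls are pairwise disjoint, $\max_ir_i\le1$, and $B_{cr_i}(x_i)\cap S\ne\emptyset$ for all $i$. For $r>0$, $k(r)$ is the integer with $r\in(2^{-k(r)-1},2^{-k(r)}]$; $\widetilde{\mathcal E}_{\mathfrak m_k}(f,B_r(x)):=\mathcal E_{\mathfrak m_k}(f,B_{2r}(x))$ if $B_r(x)\cap S\ne\emptyset$, else $0$. $\mathcal{BSN}_{p,\{\mathfrak m_k\},c}(f):=\sup\big(\sum_i\frac{\mu(B_{r_i}(x_i))}{r_i^p}(\widetilde{\mathcal E}_{\mathfrak m_{k(r_i)}}(f,B_{cr_i}(x_i)))^p\big)^{1/p}$, sup over all $(S,c)$-nice families. Maximal function: $f^\sharp_{\mu\lfloor_{S^1}}(x):=\sup_{r\in(0,2]}\frac1r\mathcal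 E_{\mu\lfloor_{S^1}}(f,B_r(x))$, $x\in S$. Gluing functional (with $\theta_1:=0$): $\Sigma^{i,j}_k:=\{(y,z)\in S^i\times S^j:d(y,z)\le2^{-k}\}$, $\operatorname{w}_k(y,z):=(\mu(B_k(y))\mu(B_k(z)))^{-1/2}$, $A^{i,j}_k(f)(y,z):=\mathrm{Av}_{B_k(y)\cap S^i,\mathcal H_{\theta_i}}\mathrm{Av}_{B_k(z)\cap S^j,\mathcal H_{\theta_j}}|f(y')-f(z')|$, and $\mathcal{GL}^{(3)}_p(f):=\big(\sum_{i\ne j}\sum_{k\ge1}2^{k(p-\theta_i-\theta_j)}\iint_{\Sigma^{i,j}_k}\operatorname{w}_k(y,z)(A^{i,j}_k(f)(y,z))^pd\mathcal H_{\theta_i}(y)d\mathcal H_{\theta_j}(z)\big)^{1/p}$ over $(i,j)\in\{(1,2),(2,1)\}$. *)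

theory Defs
  imports "HOL-Analysis.Analysis"
begin

text \<open>Real power of an extended nonnegative real (used only with positive exponents).\<close>
definition enn_rpow :: "ennreal \<Rightarrow> real \<Rightarrow> ennreal" where
  "enn_rpow x a = (if x = top then top else ennreal (enn2real x powr a))"

definition Av :: "'a measure \<Rightarrow> 'a set \<Rightarrow> ('a \<Rightarrow> ennreal) \<Rightarrow> ennreal" where
  "Av m G g = (if emeasure m G = 0 then 0
               else (\<integral>\<^sup>+x\<in>G. g x \<partial>m) / emeasure m G)"

definition Osc :: "'a measure \<Rightarrow> ('a \<Rightarrow> real) \<Rightarrow> 'a set \<Rightarrow> ennreal" where
  "Osc m g G = (INF c::real. Av m G (\<lambda>y. ennreal \<bar>g y - c\<bar>))"

definition Lpnorm :: "'a measure \<Rightarrow> real \<Rightarrow> ('a \<Rightarrow> real) \<Rightarrow> ennreal" where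
  "Lpnorm m p f = enn_rpow (\<integral>\<^sup>+x. enn_rpow (ennreal \<bar>f x\<bar>) p \<partial>m) (1/p)"

definition restr :: "'a measure \<Rightarrow> 'a set \<Rightarrow> 'a measure" where
  "restr m S = density m (\<lambda>x. indicator S x)"

text \<open>pointwise (upper) Lipschitz constant lip f(x) = limsup_{y\<rightarrow>x} |f y - f x| / d(y,x),
  and 0 at isolated points\<close>
definition lip :: "('a::metric_space \<Rightarrow> real) \<Rightarrow> 'a \<Rightarrow> ennreal" where
  "lip f x = e2ennreal (Limsup (at x) (\<lambda>y. ereal (\<bar>f y - f x\<bar> / dist y x)))"

definition unif_loc_doubling :: "'a::metric_space measure \<Rightarrow> bool" where
  "unif_loc_doubling \<mu> \<longleftrightarrow> (\<forall>R>0. \<exists>C::real. \<forall>r\<in>{0<..R}. \<forall>x.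
      emeasure \<mu> (cball x (2*r)) \<le> ennreal C * emeasure \<mu> (cball x r))"

definition weak_local_poincare :: "'a::metric_space measure \<Rightarrow> real \<Rightarrow> bool" where
  "weak_local_poincare \<mu> p \<longleftrightarrow> (\<forall>R>0. \<exists>C::real. \<exists>lam::real. C \<ge> 1 \<and> lam \<ge> 1 \<and>
      (\<forall>f::'a \<Rightarrow> real. (\<exists>L. L-lipschitz_on UNIV f) \<longrightarrow>
        (\<forall>x. \<forall>r\<in>{0<..R}.
          Osc \<mu> f (cball x r) \<le> ennreal (C * r) *
             enn_rpow (Av \<mu> (cball x (lam*r)) (\<lambda>y. enn_rpow (lip f y) p)) (1/p))))"

definition lower_mass_exp :: "'a::metric_space measure \<Rightarrow> real \<Rightarrow> bool" where
  "lower_mass_exp \<mu> Q \<longleftrightarrow> (\<forall>R>0. \<exists>C::real. \<forall>x r x' r'.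
      cball x' r' \<subseteq> cball x r \<and> 0 < r' \<and> r' \<le> r \<and> r \<le> R \<longrightarrow>
      ennreal ((r'/r) powr Q) * emeasure \<mu> (cball x r) \<le> ennreal C * emeasure \<mu> (cball x' r'))"

definition Qlow :: "'a::metric_space measure \<Rightarrow> ereal" where
  "Qlow \<mu> = (INF Q\<in>{Q. 0 < Q \<and> lower_mass_exp \<mu> Q}. ereal Q)"

definition Hcont :: "'a::metric_space measure \<Rightarrow> real \<Rightarrow> real \<Rightarrow> 'a set \<Rightarrow> ennreal" where
  "Hcont \<mu> \<theta> \<delta> E = (INF (I,x,r)\<in>{(I::nat set, x::nat\<Rightarrow>'a, r::nat\<Rightarrow>real).
        E \<subseteq> (\<Union>i\<in>I. cball (x i) (r i)) \<and> (\<forall>i\<in>I. 0 < r i \<and> r i < \<delta>)}.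
      (\<Sum>i. if i \<in> I then emeasure \<mu> (cball (x i) (r i)) * ennreal (r i powr (-\<theta>)) else 0))"

definition Hcod :: "'a::metric_space measure \<Rightarrow> real \<Rightarrow> 'a set \<Rightarrow> ennreal" where
  "Hcod \<mu> \<theta> E = (SUP \<delta>\<in>{0<..}. Hcont \<mu> \<theta> \<delta> E)"

definition Hm :: "'a::metric_space measure \<Rightarrow> real \<Rightarrow> 'a set \<Rightarrow> 'a measure" where
  "Hm \<mu> \<theta> S = measure_of UNIV (sets borel) (\<lambda>E. Hcod \<mu> \<theta> (E \<inter> S))"

definition ADR :: "'a::metric_space measure \<Rightarrow> real \<Rightarrow> 'a set \<Rightarrow> bool" where
  "ADR \<mu> \<theta> S \<longleftrightarrow> closed S \<and> (\<exists>\<kappa>1 \<kappa>2. 0 < \<kappa>1 \<and> 0 < \<kappa>2 \<and>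
     (\<forall>x\<in>S. \<forall>r\<in>{0<..1}.
        ennreal \<kappa>1 * emeasure \<mu> (cball x r) * ennreal (r powr (-\<theta>)) \<le> Hcod \<mu> \<theta> (cball x r \<inter> S) \<and>
        Hcod \<mu> \<theta> (cball x r \<inter> S) \<le> ennreal \<kappa>2 * emeasure \<mu> (cball x r) * ennreal (r powr (-\<theta>))))"

definition besov_norm :: "'a::metric_space measure \<Rightarrow> real \<Rightarrow> real \<Rightarrow> real \<Rightarrow> 'a set \<Rightarrow> ('a \<Rightarrow> real) \<Rightarrow> ennreal" where
  "besov_norm \<mu> \<theta> s p S f = Lpnorm (Hm \<mu> \<theta> S) p f +
     enn_rpow (\<Sum>k. ennreal (2 powr (real (Suc k) * s * p)) *
        (\<integral>\<^sup>+x. enn_rpow (Osc (Hm \<mu> \<theta> S) f (cball x (2 powr (- real (Suc k))))) p \<partial>(Hm \<mu> \<theta> S))) (1/p)"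

definition nice_family :: "'a::metric_space set \<Rightarrow> real \<Rightarrow> nat \<Rightarrow> (nat \<Rightarrow> 'a) \<Rightarrow> (nat \<Rightarrow> real) \<Rightarrow> bool" where
  "nice_family S c M x r \<longleftrightarrow>
     (\<forall>i<M. \<forall>j<M. i \<noteq> j \<longrightarrow> cball (x i) (r i) \<inter> cball (x j) (r j) = {}) \<and>
     (\<forall>i<M. 0 < r i \<and> r i \<le> 1 \<and> cball (x i) (c * r i) \<inter> S \<noteq> {})"

text \<open>k(r): the integer k with r in (2^{-k-1}, 2^{-k}] (nonnegative for r \<le> 1)\<close>
definition kidx :: "real \<Rightarrow> nat" where
  "kidx r = nat \<lfloor>- log 2 r\<rfloor>"

definition Osc_tilde :: "'a::metric_space measure \<Rightarrow> 'a set \<Rightarrow> ('a \<Rightarrow> real) \<Rightarrow> 'a \<Rightarrow> real \<Rightarrow> ennreal" where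
  "Osc_tilde m S f x \<rho> = (if cball x \<rho> \<inter> S \<noteq> {} then Osc m f (cball x (2*\<rho>)) else 0)"

definition BSN :: "'a::metric_space measure \<Rightarrow> real \<Rightarrow> (nat \<Rightarrow> 'a measure) \<Rightarrow> 'a set \<Rightarrow> real \<Rightarrow> ('a \<Rightarrow> real) \<Rightarrow> ennreal" where
  "BSN \<mu> p m S c f = (SUP (M,x,r)\<in>{(M,x,r). nice_family S c M x r}.
     enn_rpow (\<Sum>i<M. emeasure \<mu> (cball (x i) (r i)) * ennreal (r i powr (-p)) *
        enn_rpow (Osc_tilde (m (kidx (r i))) S f (x i) (c * r i)) p) (1/p))"

definition mseq :: "'a::metric_space measure \<Rightarrow> real \<Rightarrow> real \<Rightarrow> 'a set \<Rightarrow> 'a set \<Rightarrow> nat \<Rightarrow> 'a measure" where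
  "mseq \<mu> \<theta> \<theta>2 S1 S2 k = measure_of UNIV (sets borel)
     (\<lambda>E. ennreal (2 powr (real k * \<theta>)) * emeasure \<mu> (E \<inter> S1)
        + ennreal (2 powr (real k * (\<theta> - \<theta>2))) * Hcod \<mu> \<theta>2 (E \<inter> S2))"

definition sharp :: "'a::metric_space measure \<Rightarrow> 'a set \<Rightarrow> ('a \<Rightarrow> real) \<Rightarrow> 'a \<Rightarrow> ennreal" where
  "sharp \<mu> S1 f x = (SUP r\<in>{0<..2}. ennreal (1/r) * Osc (restr \<mu> S1) f (cball x r))"

definition GLterm :: "'a::metric_space measure \<Rightarrow> real \<Rightarrow> 'a set \<Rightarrow> real \<Rightarrow> 'a set \<Rightarrow> real \<Rightarrow> ('a \<Rightarrow> real) \<Rightarrow> ennreal" where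
  "GLterm \<mu> p Si \<theta>i Sj \<theta>j f = (\<Sum>k'. let k = Suc k'; \<rho> = 2 powr (- real k) in
     ennreal (2 powr (real k * (p - \<theta>i - \<theta>j))) *
     (\<integral>\<^sup>+z. \<integral>\<^sup>+y. indicator {(y,z). y \<in> Si \<and> z \<in> Sj \<and> dist y z \<le> \<rho>} (y,z) *
         ennreal (1 / sqrt (measure \<mu> (cball y \<rho>) * measure \<mu> (cball z \<rho>))) *
         enn_rpow (Av (Hm \<mu> \<theta>i UNIV) (cball y \<rho> \<inter> Si)
                     (\<lambda>y'. Av (Hm \<mu> \<theta>j UNIV) (cball z \<rho> \<inter> Sj) (\<lambda>z'. ennreal \<bar>f y' - f z'\<bar>))) p
       \<partial>(Hm \<mu> \<theta>i Si) \<partial>(Hm \<mu> \<theta>j Sj)))"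

definition GL3 :: "'a::metric_space measure \<Rightarrow> real \<Rightarrow> 'a set \<Rightarrow> 'a set \<Rightarrow> real \<Rightarrow> ('a \<Rightarrow> real) \<Rightarrow> ennreal" where
  "GL3 \<mu> p S1 S2 \<theta>2 f = enn_rpow (GLterm \<mu> p S1 0 S2 \<theta>2 f + GLterm \<mu> p S2 \<theta>2 S1 0 f) (1/p)"

end

theory Submission
  imports Defs
begin

text \<open>
  Write \<open>B\<close> for a ball of a nice family and \<open>G\<close> for its \<open>2c\<close>-fold enlargement. Regularity of
  \<open>S1\<close> and \<open>S2\<close> bounds the oscillation of \<open>f\<close> over \<open>G\<close> with respect to \<open>m\<^sub>k\<close> by
  \<open>inf\<^sub>b (\<integral>\<^bsub>G \<inter> S1\<^esub> |f - b| d\<mu> + 2\<^bsup>-k\<theta>2\<^esup> \<integral>\<^bsub>G \<inter> S2\<^esub> |f - b| dH) / \<mu>(B)\<close>, up to a constant.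
  If \<open>G\<close> misses \<open>S2\<close> this is controlled by the sharp maximal function on \<open>S1\<close>; if it misses \<open>S1\<close>,
  by the oscillation that enters the Besov norm; if it meets both, some value \<open>b = f(y)\<close> with
  \<open>y \<in> S1\<close> is simultaneously good on both sets, and the gluing average alone controls the
  quantity. Balls of radius comparable to 1 overlap boundedly and are absorbed by the two \<open>L\<^sub>p\<close> norms.
  In each of the first three cases the bound holds at every point of a set \<open>E\<close> near \<open>B\<close> whose mass is
  comparable to that of \<open>B\<close>. A finite Vitali selection, applied to every subfamily, and a discrete
  layer-cake argument then turn the sum over the family into an integral, so neither the maximal
  theorem nor measurability of the majorants is needed.
\<close>

section \<open>Metric outer measures\<close>

text \<open>\<open>Hm\<close> and \<open>mseq\<close> are built with \<open>measure_of\<close>,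
  which yields the zero measure when the given set function is not countably additive. Every
  integral against them therefore rests on \<open>Hcod\<close> being a Borel measure, and
  Caratheodory's criterion comes before any estimate.

  One integer \<open>s\<close> ties the scales together. For k = \<open>kidx r\<close>, the ball of
  radius 2^(s-k) about any point within (2c+1)r of the centre of B contains G. When k > s this
  radius is at most 1/2: the regularity bounds apply to it, and k - s is an admissible level of the
  Besov and gluing series. The remaining balls, k \<le> s, are those of radius comparable to 1.

  On S1 two measures occur: \<open>\<mu>\<close> in \<open>mseq\<close> and \<open>sharp\<close>,
  \<open>Hcod \<mu> 0\<close> in the regularity condition and the gluing functional. Coverings show
  that \<open>\<mu>\<close> is the smaller one; the converse, up to a doubling constant and for
  closed bounded sets, comes from nets and turns the regularity of S1 into a lower bound for
  \<open>\<mu>\<close>.\<close>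

lemma measure_space_borel_of_metric_outer_measure:
  fixes \<nu> :: "'a::metric_space set \<Rightarrow> ennreal"
  assumes outer: "outer_measure_space UNIV \<nu>"
    and sep: "\<And>A B \<delta>. 0 < \<delta> \<Longrightarrow> (\<And>a b. a \<in> A \<Longrightarrow> b \<in> B \<Longrightarrow> \<delta> \<le> dist a b) \<Longrightarrow>
                 \<nu> A + \<nu> B \<le> \<nu> (A \<union> B)"
  shows "measure_space UNIV (sets borel) \<nu>"
proof -
  interpret sigma_algebra UNIV "UNIV :: 'a set set"
    using sigma_algebra_Pow[of "UNIV :: 'a set"] by simp
  have empty: "\<nu> {} = 0" and mono: "\<And>A B. A \<subseteq> B \<Longrightarrow> \<nu> A \<le> \<nu> B"
    and csub: "countably_subadditive UNIV \<nu>"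
    using outer by (auto simp: outer_measure_space_def positive_def increasing_def)
  have sub: "\<nu> (A \<union> B) \<le> \<nu> A + \<nu> B" for A B
  proof -
    have "\<nu> (A \<union> (B - A)) \<le> \<nu> A + \<nu> (B - A)"
      using countably_subadditive_subadditive[OF _ csub] empty
      unfolding positive_def subadditive_def by blast
    also have "\<dots> \<le> \<nu> A + \<nu> B" by (intro add_left_mono mono) auto
    finally show ?thesis by simp
  qed
  have csub': "\<nu> (\<Union>n. A n) \<le> (\<Sum>n. \<nu> (A n))" for A :: "nat \<Rightarrow> 'a set"
  proof -
    have "\<nu> (\<Union>n. A n) = \<nu> (\<Union>n. disjointed A n)" by (simp add: UN_disjointed_eq)
    also have "\<dots> \<le> (\<Sum>n. \<nu> (disjointed A n))"
      using csub disjoint_family_disjointed[of A] by (auto simp: countably_subadditive_def)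
    also have "\<dots> \<le> (\<Sum>n. \<nu> (A n))"
      by (intro suminf_le mono disjointed_subset) auto
    finally show ?thesis .
  qed
  \<comment> \<open>The part of \<open>X\<close> off \<open>C\<close> is cut into shells by distance
    to \<open>C\<close>. Shells that are not adjacent lie at positive distance, so the odd ones and
    the even ones each have total mass at most that of \<open>X\<close>. Hence the series of shells
    converges, and its tails, the only loss in approximating X - C by \<open>A n\<close>,
    vanish.\<close>
  have closed_lambda: "C \<in> lambda_system UNIV UNIV \<nu>" if C: "closed C" for C :: "'a set"
  proof (cases "C = {}")
    case True
    then show ?thesis by (simp add: lambda_system_def empty)
  next
    case False
    have "\<nu> (X \<inter> C) + \<nu> (X - C) \<le> \<nu> X" for X
    proof (cases "\<nu> X = top")
      case fin: False
      define A where "A n = {x \<in> X. 1 / real (Suc n) \<le> infdist x C}" for n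
      define R where "R n = A (Suc n) - A n" for n
      have Amono: "A m \<subseteq> A n" if "m \<le> n" for m n
      proof -
        have "1 / real (Suc n) \<le> 1 / real (Suc m)" using that by (simp add: field_simps)
        then show ?thesis by (auto simp: A_def)
      qed
      have far: "\<exists>\<delta>>0. \<forall>a\<in>A n. \<forall>b\<in>B. \<delta> \<le> dist a b"
        if "\<And>b. b \<in> B \<Longrightarrow> infdist b C < t" "t < 1 / real (Suc n)" for n B t
      proof (intro exI conjI ballI)
        show "0 < 1 / real (Suc n) - t" using that by simp
        fix a b assume "a \<in> A n" "b \<in> B"
        then have "1 / real (Suc n) \<le> infdist a C" "infdist b C < t" using that by (auto simp: A_def)
        then show "1 / real (Suc n) - t \<le> dist a b"
          using infdist_triangle[of a C b] by simp
      qed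
      have R_sub: "infdist b C < 1 / real (Suc n)" if "b \<in> R n" for b n
        using that by (auto simp: R_def A_def)
      \<comment> \<open>Between \<open>A n\<close> and \<open>R (Suc n)\<close> lies the omitted
        shell \<open>R n\<close>, which supplies the gap 1/(n+1) - 1/(n+2). Adjacent shells may
        touch, hence the separate sums over odd and even indices.\<close>
      have step: "\<nu> (A n) + \<nu> (R (Suc n)) \<le> \<nu> (A (Suc (Suc n)))" for n
      proof -
        obtain \<delta> where "\<delta> > 0" "\<forall>a\<in>A n. \<forall>b\<in>R (Suc n). \<delta> \<le> dist a b"
          using far[of "R (Suc n)" "1 / real (Suc (Suc n))" n] R_sub[of _ "Suc n"]
          by (auto simp: divide_simps)
        then have "\<nu> (A n) + \<nu> (R (Suc n)) \<le> \<nu> (A n \<union> R (Suc n))" by (intro sep) auto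
        also have "\<dots> \<le> \<nu> (A (Suc (Suc n)))"
          using Amono[of n "Suc (Suc n)"] by (intro mono) (auto simp: R_def)
        finally show ?thesis .
      qed
      have odd: "(\<Sum>i<n. \<nu> (R (2 * i + 1))) \<le> \<nu> (A (2 * n))" for n
      proof (induction n)
        case (Suc n)
        have "(\<Sum>i<Suc n. \<nu> (R (2 * i + 1))) \<le> \<nu> (A (2 * n)) + \<nu> (R (2 * n + 1))"
          using Suc by (simp add: add_right_mono)
        also have "\<dots> \<le> \<nu> (A (2 * Suc n))" using step[of "2 * n"] by simp
        finally show ?case .
      qed simp
      have even: "(\<Sum>i<n. \<nu> (R (2 * i + 2))) \<le> \<nu> (A (2 * n + 1))" for n
      proof (induction n)
        case (Suc n)
        have "(\<Sum>i<Suc n. \<nu> (R (2 * i + 2))) \<le> \<nu> (A (2 * n + 1)) + \<nu> (R (2 * n + 2))"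
          using Suc by (simp add: add_right_mono)
        also have "\<dots> \<le> \<nu> (A (2 * Suc n + 1))" using step[of "2 * n + 1"] by simp
        finally show ?case .
      qed simp
      have AX: "\<nu> (A n) \<le> \<nu> X" for n by (intro mono) (auto simp: A_def)
      have bound: "(\<Sum>i<n. \<nu> (R i)) \<le> \<nu> (R 0) + (\<nu> X + \<nu> X)" for n
      proof -
        have "{..<n} \<subseteq> insert 0 ((\<lambda>i. 2 * i + 1) ` {..<n} \<union> (\<lambda>i. 2 * i + 2) ` {..<n})"
        proof
          fix i assume i: "i \<in> {..<n}"
          show "i \<in> insert 0 ((\<lambda>i. 2 * i + 1) ` {..<n} \<union> (\<lambda>i. 2 * i + 2) ` {..<n})"
          proof (cases "i = 0")
            case False
            then have "i = 2 * ((i - 1) div 2) + 1 \<or> i = 2 * ((i - 1) div 2) + 2" "(i - 1) div 2 < n"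
              using i by auto
            then show ?thesis by blast
          qed simp
        qed
        then have "(\<Sum>i<n. \<nu> (R i)) \<le>
            (\<Sum>i\<in>insert 0 ((\<lambda>i. 2 * i + 1) ` {..<n} \<union> (\<lambda>i. 2 * i + 2) ` {..<n}). \<nu> (R i))"
          by (intro sum_mono2) auto
        also have "\<dots> = \<nu> (R 0) + (\<Sum>i\<in>(\<lambda>i. 2 * i + 1) ` {..<n} \<union> (\<lambda>i. 2 * i + 2) ` {..<n}. \<nu> (R i))"
          by (subst sum.insert) auto
        also have "(\<Sum>i\<in>(\<lambda>i. 2 * i + 1) ` {..<n} \<union> (\<lambda>i. 2 * i + 2) ` {..<n}. \<nu> (R i)) =
            (\<Sum>i\<in>(\<lambda>i. 2 * i + 1) ` {..<n}. \<nu> (R i)) + (\<Sum>i\<in>(\<lambda>i. 2 * i + 2) ` {..<n}. \<nu> (R i))"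
          by (rule sum.union_disjoint) (auto, presburger)
        also have "\<dots> = (\<Sum>i<n. \<nu> (R (2 * i + 1))) + (\<Sum>i<n. \<nu> (R (2 * i + 2)))"
          by (simp add: sum.reindex inj_on_def)
        also have "\<dots> \<le> \<nu> X + \<nu> X"
          using odd[of n] even[of n] AX by (intro add_mono) (meson order_trans)+
        finally show ?thesis by (simp add: add_left_mono)
      qed
      have "(\<Sum>i. \<nu> (R i)) \<le> \<nu> (R 0) + (\<nu> X + \<nu> X)"
        by (intro suminf_le_const bound) auto
      moreover have "\<nu> (R 0) \<le> \<nu> X" by (intro mono) (auto simp: R_def A_def)
      moreover have "\<nu> X < top" using fin by (simp add: less_top)
      ultimately have Rfin: "(\<Sum>i. \<nu> (R i)) < top"
        by (intro le_less_trans[OF \<open>(\<Sum>i. \<nu> (R i)) \<le> \<nu> (R 0) + (\<nu> X + \<nu> X)\<close>])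
          (simp add: le_less_trans[of "\<nu> (R 0)" "\<nu> X"])
      have tail: "(\<lambda>n. \<Sum>i. \<nu> (R (i + n))) \<longlonglongrightarrow> 0"
      proof -
        have eq: "(\<Sum>i. \<nu> (R (i + n))) = (\<Sum>i. \<nu> (R i)) - (\<Sum>i<n. \<nu> (R i))" for n
        proof -
          have "(\<Sum>i<n. \<nu> (R i)) \<noteq> top"
            using sum_le_suminf[of "\<lambda>i. \<nu> (R i)" "{..<n}"] Rfin
            by (metis finite_lessThan leD summableI zero_le)
          then show ?thesis using suminf_offset[of "\<lambda>i. \<nu> (R i)" n] by simp
        qed
        have "(\<lambda>n. (\<Sum>i. \<nu> (R i)) - (\<Sum>i<n. \<nu> (R i))) \<longlonglongrightarrow> (\<Sum>i. \<nu> (R i)) - (\<Sum>i. \<nu> (R i))"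
          using Rfin by (intro tendsto_diff_ennreal tendsto_const summable_LIMSEQ) auto
        then show ?thesis using Rfin by (simp add: eq)
      qed
      have "\<nu> (X \<inter> C) + \<nu> (X - C) \<le> \<nu> X + (\<Sum>i. \<nu> (R (i + n)))" for n
      proof -
        obtain \<delta> where "\<delta> > 0" "\<forall>a\<in>A n. \<forall>b\<in>X \<inter> C. \<delta> \<le> dist a b"
          using far[of "X \<inter> C" "1 / real (Suc (Suc n))" n] by (auto simp: field_simps)
        then have "\<nu> (A n) + \<nu> (X \<inter> C) \<le> \<nu> (A n \<union> (X \<inter> C))" by (intro sep) auto
        also have "\<dots> \<le> \<nu> X" by (intro mono) (auto simp: A_def)
        finally have 1: "\<nu> (X \<inter> C) + \<nu> (A n) \<le> \<nu> X" by (simp add: add.commute)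
        have "X - C \<subseteq> A n \<union> (\<Union>i. R (i + n))"
        proof
          fix x assume x: "x \<in> X - C"
          then have "infdist x C > 0" using C False infdist_pos_not_in_closed by auto
          then obtain m where "inverse (real (Suc m)) < infdist x C" using reals_Archimedean by blast
          then have "x \<in> A m" using x by (auto simp: A_def field_simps)
          define l where "l = (LEAST l. x \<in> A l)"
          have l: "x \<in> A l" "\<And>j. j < l \<Longrightarrow> x \<notin> A j"
            using LeastI[of "\<lambda>l. x \<in> A l", OF \<open>x \<in> A m\<close>] not_less_Least unfolding l_def by auto
          show "x \<in> A n \<union> (\<Union>i. R (i + n))"
          proof (cases "l \<le> n")
            case True
            then show ?thesis using l Amono by blast
          next
            case False
            then obtain i where "l = Suc (i + n)"
              by (metis add.commute less_imp_Suc_add not_le)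
            then have "x \<in> R (i + n)" using l by (auto simp: R_def)
            then show ?thesis by blast
          qed
        qed
        then have "\<nu> (X - C) \<le> \<nu> (A n) + \<nu> (\<Union>i. R (i + n))" by (meson mono sub order_trans)
        also have "\<dots> \<le> \<nu> (A n) + (\<Sum>i. \<nu> (R (i + n)))" by (intro add_left_mono csub')
        finally have "\<nu> (X \<inter> C) + \<nu> (X - C) \<le> (\<nu> (X \<inter> C) + \<nu> (A n)) + (\<Sum>i. \<nu> (R (i + n)))"
          by (simp add: add.assoc add_left_mono)
        also have "\<dots> \<le> \<nu> X + (\<Sum>i. \<nu> (R (i + n)))" by (intro add_right_mono 1)
        finally show ?thesis .
      qed
      moreover have "(\<lambda>n. \<nu> X + (\<Sum>i. \<nu> (R (i + n)))) \<longlonglongrightarrow> \<nu> X + 0"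
        by (intro tendsto_add tendsto_const tail)
      ultimately show ?thesis
        using LIMSEQ_le_const[of "\<lambda>n. \<nu> X + (\<Sum>i. \<nu> (R (i + n)))" "\<nu> X + 0"] by auto
    qed simp
    moreover have "\<nu> X \<le> \<nu> (X \<inter> C) + \<nu> (X - C)" for X
      using sub[of "X \<inter> C" "X - C"] by (simp add: Int_Diff_Un)
    ultimately show ?thesis by (auto simp: lambda_system_eq intro!: antisym)
  qed
  have ms: "measure_space UNIV (lambda_system UNIV UNIV \<nu>) \<nu>"
    using caratheodory_lemma[OF outer] .
  have "sets borel \<subseteq> lambda_system UNIV UNIV \<nu>"
  proof -
    have "sigma_algebra UNIV (lambda_system UNIV UNIV \<nu>)" using ms by (simp add: measure_space_def)
    then have "sigma_sets UNIV (Collect closed) \<subseteq> lambda_system UNIV UNIV \<nu>"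
      using closed_lambda by (intro sigma_algebra.sigma_sets_subset) auto
    then show ?thesis by (simp add: borel_eq_closed)
  qed
  then show ?thesis
    using measure_down[OF ms] by (metis sets.sigma_algebra_axioms space_borel)
qed

section \<open>Codimensional Hausdorff measures\<close>

lemma Hcont_le:
  assumes "E \<subseteq> (\<Union>i\<in>I. cball (x i) (r i))" "\<And>i. i \<in> I \<Longrightarrow> 0 < r i \<and> r i < \<delta>"
  shows "Hcont \<mu> \<theta> \<delta> E \<le>
    (\<Sum>i. if i \<in> I then emeasure \<mu> (cball (x i) (r i)) * ennreal (r i powr (-\<theta>)) else 0)"
  unfolding Hcont_def
  by (rule INF_lower2[of "(I, x, r)"]) (use assms in auto)

lemma Hcont_greatest:
  assumes "\<And>I x r. E \<subseteq> (\<Union>i\<in>I. cball (x i) (r i)) \<Longrightarrow> (\<And>i. i \<in> I \<Longrightarrow> 0 < r i \<and> r i < \<delta>) \<Longrightarrow>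
    a \<le> (\<Sum>i. if i \<in> I then emeasure \<mu> (cball (x i) (r i)) * ennreal (r i powr (-\<theta>)) else 0)"
  shows "a \<le> Hcont \<mu> \<theta> \<delta> E"
  unfolding Hcont_def by (rule INF_greatest) (use assms in auto)

lemma Hcont_less_cover:
  assumes "Hcont \<mu> \<theta> \<delta> E < b"
  obtains I x r where "E \<subseteq> (\<Union>i\<in>I. cball (x i) (r i))" "\<And>i. i \<in> I \<Longrightarrow> 0 < r i \<and> r i < \<delta>"
    "(\<Sum>i. if i \<in> I then emeasure \<mu> (cball (x i) (r i)) * ennreal (r i powr (-\<theta>)) else 0) < b"
  using assms unfolding Hcont_def INF_less_iff by auto

lemma Hcont_mono: "A \<subseteq> B \<Longrightarrow> \<delta>' \<le> \<delta> \<Longrightarrow> Hcont \<mu> \<theta> \<delta> A \<le> Hcont \<mu> \<theta> \<delta>' B"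
  by (rule Hcont_greatest, rule Hcont_le) (blast, meson less_le_trans)

lemma Hcont_countable_subadditive:
  "Hcont \<mu> \<theta> \<delta> (\<Union>n. A n) \<le> (\<Sum>n. Hcont \<mu> \<theta> \<delta> (A n))"
proof (rule ennreal_le_epsilon)
  fix e :: real assume e: "0 < e" and fin: "(\<Sum>n. Hcont \<mu> \<theta> \<delta> (A n)) < top"
  define w where "w I x r i =
    (if i \<in> I then emeasure \<mu> (cball (x i) (r i)) * ennreal (r i powr (-\<theta>)) else 0)"
    for I :: "nat set" and x :: "nat \<Rightarrow> 'a" and r i
  have close: "Hcont \<mu> \<theta> \<delta> (A n) < Hcont \<mu> \<theta> \<delta> (A n) + ennreal (e * (1/2) ^ Suc n)" for n
    using e fin by (auto simp: less_top dest!: ennreal_suminf_lessD)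
  define P where "P n = (\<lambda>(I, x, r). A n \<subseteq> (\<Union>i\<in>I. cball (x i) (r i)) \<and> (\<forall>i\<in>I. 0 < r i \<and> r i < \<delta>) \<and>
      (\<Sum>i. w I x r i) \<le> Hcont \<mu> \<theta> \<delta> (A n) + ennreal (e * (1/2) ^ Suc n))" for n
  have "\<exists>t. P n t" for n
  proof (rule Hcont_less_cover[OF close[of n]])
    fix I x r
    assume "A n \<subseteq> (\<Union>i\<in>I. cball (x i) (r i))" "\<And>i. i \<in> I \<Longrightarrow> 0 < r i \<and> r i < \<delta>"
      "(\<Sum>i. if i \<in> I then emeasure \<mu> (cball (x i) (r i)) * ennreal (r i powr (-\<theta>)) else 0)
        < Hcont \<mu> \<theta> \<delta> (A n) + ennreal (e * (1/2) ^ Suc n)"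
    then have "P n (I, x, r)" unfolding P_def w_def by (simp add: less_imp_le)
    then show ?thesis ..
  qed
  then obtain t where t: "\<And>n. P n (t n)" by metis
  define I where "I n = fst (t n)" for n
  define x where "x n = fst (snd (t n))" for n
  define r where "r n = snd (snd (t n))" for n
  have "P n (I n, x n, r n)" for n using t by (simp add: I_def x_def r_def)
  then have cov: "\<And>n. A n \<subseteq> (\<Union>i\<in>I n. cball (x n i) (r n i))"
    and rad: "\<And>n i. i \<in> I n \<Longrightarrow> 0 < r n i \<and> r n i < \<delta>"
    and wt: "\<And>n. (\<Sum>i. w (I n) (x n) (r n) i) \<le> Hcont \<mu> \<theta> \<delta> (A n) + ennreal (e * (1/2) ^ Suc n)"
    by (auto simp: P_def)
  \<comment> \<open>The countably many covers are merged into one indexed by \<open>nat\<close>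
    through the pairing bijection; the index sets \<open>I n\<close> let individual covers be finite
    or empty.\<close>
  define x' where "x' = (\<lambda>j. case prod_decode j of (n, i) \<Rightarrow> x n i)"
  define r' where "r' = (\<lambda>j. case prod_decode j of (n, i) \<Rightarrow> r n i)"
  define I' where "I' = {j. case prod_decode j of (n, i) \<Rightarrow> i \<in> I n}"
  have "(\<Union>n. A n) \<subseteq> (\<Union>j\<in>I'. cball (x' j) (r' j))"
  proof
    fix a assume "a \<in> (\<Union>n. A n)"
    then obtain n i where "i \<in> I n" "a \<in> cball (x n i) (r n i)" using cov by blast
    then show "a \<in> (\<Union>j\<in>I'. cball (x' j) (r' j))"
      by (intro UN_I[of "prod_encode (n, i)"]) (auto simp: I'_def x'_def r'_def)
  qed
  moreover have "0 < r' j \<and> r' j < \<delta>" if "j \<in> I'" for j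
    using that rad by (auto simp: I'_def r'_def split: prod.splits)
  ultimately have 1: "Hcont \<mu> \<theta> \<delta> (\<Union>n. A n) \<le> (\<Sum>j. w I' x' r' j)"
    unfolding w_def by (rule Hcont_le)
  have "w I' x' r' = (\<lambda>j. (\<lambda>(n, i). w (I n) (x n) (r n) i) (prod_decode j))"
    by (rule ext) (auto simp: w_def I'_def x'_def r'_def split: prod.splits)
  then have 2: "(\<Sum>j. w I' x' r' j) = (\<Sum>n. \<Sum>i. w (I n) (x n) (r n) i)"
    by (simp only:) (rule suminf_ennreal_2dimen[where f = "\<lambda>(n, i). w (I n) (x n) (r n) i"], simp)
  have 3: "(\<Sum>n. \<Sum>i. w (I n) (x n) (r n) i) \<le> (\<Sum>n. Hcont \<mu> \<theta> \<delta> (A n) + ennreal (e * (1/2) ^ Suc n))"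
    by (rule suminf_le[OF wt]) auto
  have 4: "(\<Sum>n. ennreal (e * (1/2) ^ Suc n)) = ennreal e"
    using e sums_mult[OF power_half_series, of e] by (subst suminf_ennreal_eq[of _ e]) auto
  have 5: "(\<Sum>n. Hcont \<mu> \<theta> \<delta> (A n) + ennreal (e * (1/2) ^ Suc n)) = (\<Sum>n. Hcont \<mu> \<theta> \<delta> (A n)) + ennreal e"
    unfolding 4[symmetric] by (rule suminf_add[symmetric]) auto
  show "Hcont \<mu> \<theta> \<delta> (\<Union>n. A n) \<le> (\<Sum>n. Hcont \<mu> \<theta> \<delta> (A n)) + ennreal e"
    using 1 3 unfolding 2 5 by (rule order_trans)
qed

text \<open>A ball of radius below \<delta> has diameter below 2\<delta>, so it cannot meet both
  sets, and a cover of the union splits into disjoint subfamilies covering \<open>A\<close> and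
  \<open>B\<close>.\<close>

lemma Hcont_separated:
  assumes "\<And>a b. a \<in> A \<Longrightarrow> b \<in> B \<Longrightarrow> 2 * \<delta> \<le> dist a b"
  shows "Hcont \<mu> \<theta> \<delta> A + Hcont \<mu> \<theta> \<delta> B \<le> Hcont \<mu> \<theta> \<delta> (A \<union> B)"
proof (rule Hcont_greatest)
  fix I :: "nat set" and x :: "nat \<Rightarrow> 'a" and r
  assume cov: "A \<union> B \<subseteq> (\<Union>i\<in>I. cball (x i) (r i))" and rad: "\<And>i. i \<in> I \<Longrightarrow> 0 < r i \<and> r i < \<delta>"
  define J where "J E = {i \<in> I. cball (x i) (r i) \<inter> E \<noteq> {}}" for E
  define w where "w L i = (if i \<in> L then emeasure \<mu> (cball (x i) (r i)) * ennreal (r i powr (-\<theta>)) else 0)"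
    for L i
  have disj: "J A \<inter> J B = {}"
  proof (rule ccontr)
    assume "J A \<inter> J B \<noteq> {}"
    then obtain i a b where "i \<in> I" "a \<in> A" "b \<in> B" "dist (x i) a \<le> r i" "dist (x i) b \<le> r i"
      by (auto simp: J_def)
    then show False
      using assms[of a b] rad[of i] dist_triangle3[of a b "x i"] by auto
  qed
  have "Hcont \<mu> \<theta> \<delta> E \<le> (\<Sum>i. w (J E) i)" if "E \<subseteq> A \<union> B" for E
    unfolding w_def
  proof (rule Hcont_le)
    show "E \<subseteq> (\<Union>i\<in>J E. cball (x i) (r i))" using cov that by (force simp: J_def)
  qed (use rad J_def in auto)
  then have "Hcont \<mu> \<theta> \<delta> A + Hcont \<mu> \<theta> \<delta> B \<le> (\<Sum>i. w (J A) i) + (\<Sum>i. w (J B) i)"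
    by (intro add_mono) auto
  also have "\<dots> = (\<Sum>i. w (J A) i + w (J B) i)" by (simp add: suminf_add)
  also have "\<dots> \<le> (\<Sum>i. w I i)"
    using disj by (intro suminf_le) (auto simp: w_def J_def)
  finally show "Hcont \<mu> \<theta> \<delta> A + Hcont \<mu> \<theta> \<delta> B \<le>
      (\<Sum>i. if i \<in> I then emeasure \<mu> (cball (x i) (r i)) * ennreal (r i powr (-\<theta>)) else 0)"
    by (simp add: w_def)
qed

lemma Hcont_le_Hcod: "0 < \<delta> \<Longrightarrow> Hcont \<mu> \<theta> \<delta> E \<le> Hcod \<mu> \<theta> E"
  unfolding Hcod_def by (rule SUP_upper) simp

lemma Hcod_mono: "A \<subseteq> B \<Longrightarrow> Hcod \<mu> \<theta> A \<le> Hcod \<mu> \<theta> B"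
  unfolding Hcod_def by (intro SUP_mono) (auto intro: Hcont_mono)

lemma Hcod_empty [simp]: "Hcod \<mu> \<theta> {} = 0"
proof -
  have "Hcont \<mu> \<theta> \<delta> {} \<le> 0" for \<delta>
    using Hcont_le[where E = "{}" and I = "{}"] by simp
  then show ?thesis by (auto simp: Hcod_def)
qed

lemma Hcod_separated:
  assumes "0 < \<delta>" "\<And>a b. a \<in> A \<Longrightarrow> b \<in> B \<Longrightarrow> \<delta> \<le> dist a b"
  shows "Hcod \<mu> \<theta> A + Hcod \<mu> \<theta> B \<le> Hcod \<mu> \<theta> (A \<union> B)"
proof -
  have "Hcont \<mu> \<theta> s A + Hcont \<mu> \<theta> t B \<le> Hcod \<mu> \<theta> (A \<union> B)" if "0 < s" "0 < t" for s t
  proof -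
    \<comment> \<open>One scale below both \<open>s\<close> and \<open>t\<close>, since the contents
      grow as the scale shrinks, with 2u \<le> \<delta> so that separation applies at that scale.
      The two suprema in \<open>Hcod\<close> are then taken one after the other.\<close>
    define u where "u = min (\<delta> / 2) (min s t)"
    have u: "0 < u" "u \<le> s" "u \<le> t" "2 * u \<le> \<delta>" using that assms by (auto simp: u_def)
    have "Hcont \<mu> \<theta> s A + Hcont \<mu> \<theta> t B \<le> Hcont \<mu> \<theta> u A + Hcont \<mu> \<theta> u B"
      using u by (intro add_mono Hcont_mono) auto
    also have "\<dots> \<le> Hcont \<mu> \<theta> u (A \<union> B)"
      using u assms(2) by (intro Hcont_separated) force
    also have "\<dots> \<le> Hcod \<mu> \<theta> (A \<union> B)" using u by (intro Hcont_le_Hcod)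
    finally show ?thesis .
  qed
  note pair = this
  have ne: "{0::real<..} \<noteq> {}" by (rule greaterThan_non_empty)
  have "Hcont \<mu> \<theta> s A + Hcod \<mu> \<theta> B \<le> Hcod \<mu> \<theta> (A \<union> B)" if "0 < s" for s
    unfolding Hcod_def[of _ _ B] ennreal_SUP_add_right[OF ne]
    by (rule SUP_least) (use pair that in auto)
  then show ?thesis
    unfolding Hcod_def[of _ _ A] ennreal_SUP_add_left[OF ne, symmetric]
    by (intro SUP_least) auto
qed

lemma measure_space_Hcod: "measure_space UNIV (sets borel) (Hcod \<mu> \<theta>)"
proof (rule measure_space_borel_of_metric_outer_measure)
  have "Hcod \<mu> \<theta> (\<Union>n. A n) \<le> (\<Sum>n. Hcod \<mu> \<theta> (A n))" for A :: "nat \<Rightarrow> 'a set"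
    unfolding Hcod_def[of _ _ "\<Union>n. A n"]
  proof (rule SUP_least)
    fix \<delta> :: real assume "\<delta> \<in> {0<..}"
    then have "(\<Sum>n. Hcont \<mu> \<theta> \<delta> (A n)) \<le> (\<Sum>n. Hcod \<mu> \<theta> (A n))"
      by (intro suminf_le Hcont_le_Hcod) auto
    then show "Hcont \<mu> \<theta> \<delta> (\<Union>n. A n) \<le> (\<Sum>n. Hcod \<mu> \<theta> (A n))"
      using Hcont_countable_subadditive order_trans by blast
  qed
  then show "outer_measure_space UNIV (Hcod \<mu> \<theta>)"
    by (auto simp: outer_measure_space_def positive_def increasing_def countably_subadditive_def
        intro: Hcod_mono)
qed (rule Hcod_separated)

lemma countably_additive_Int:
  assumes "countably_additive (sets borel) \<nu>" "S \<in> sets borel"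
  shows "countably_additive (sets borel) (\<lambda>E. \<nu> (E \<inter> S))"
proof (rule countably_additiveI)
  fix A :: "nat \<Rightarrow> 'a set"
  assume "range A \<subseteq> sets borel" "disjoint_family A" "(\<Union>i. A i) \<in> sets borel"
  then have "range (\<lambda>i. A i \<inter> S) \<subseteq> sets borel" "disjoint_family (\<lambda>i. A i \<inter> S)" "(\<Union>i. A i \<inter> S) \<in> sets borel"
    using assms(2) by (auto simp: disjoint_family_on_def)
  then have "(\<Sum>i. \<nu> (A i \<inter> S)) = \<nu> (\<Union>i. A i \<inter> S)"
    using assms(1) unfolding countably_additive_def by blast
  then show "(\<Sum>i. \<nu> (A i \<inter> S)) = \<nu> ((\<Union>i. A i) \<inter> S)" by (simp add: Int_UN_distrib2)
qed

lemma countably_additive_linear_combination: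
  fixes f g :: "'a set \<Rightarrow> ennreal"
  assumes "countably_additive M f" "countably_additive M g"
  shows "countably_additive M (\<lambda>E. a * f E + b * g E)"
  unfolding countably_additive_def
proof (intro allI impI)
  fix A :: "nat \<Rightarrow> 'a set"
  assume A: "range A \<subseteq> M" "disjoint_family A" "(\<Union>i. A i) \<in> M"
  have "(\<Sum>i. f (A i)) = f (\<Union>i. A i)" "(\<Sum>i. g (A i)) = g (\<Union>i. A i)"
    using assms A unfolding countably_additive_def by blast+
  then show "(\<Sum>i. a * f (A i) + b * g (A i)) = a * f (\<Union>i. A i) + b * g (\<Union>i. A i)"
    by (simp add: suminf_add[symmetric])
qed

lemma sets_Hm [simp, measurable_cong]: "sets (Hm \<mu> \<theta> S) = sets borel"
  unfolding Hm_def by (rule sets.sets_measure_of_eq[where M = borel, unfolded space_borel])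

lemma space_Hm [simp]: "space (Hm \<mu> \<theta> S) = UNIV"
  unfolding Hm_def by (simp add: space_measure_of_conv)

lemma emeasure_Hm:
  assumes "S \<in> sets borel" "E \<in> sets borel"
  shows "emeasure (Hm \<mu> \<theta> S) E = Hcod \<mu> \<theta> (E \<inter> S)"
  unfolding Hm_def
proof (rule emeasure_measure_of_sigma)
  show "sigma_algebra UNIV (sets borel)" by (metis sets.sigma_algebra_axioms space_borel)
  show "countably_additive (sets borel) (\<lambda>E. Hcod \<mu> \<theta> (E \<inter> S))"
    using measure_space_Hcod[of \<mu> \<theta>] assms by (intro countably_additive_Int) (auto simp: measure_space_def)
qed (use assms in \<open>auto simp: positive_def\<close>)

text \<open>The Besov norm and the outer integrals of the gluing functional use
  \<open>Hm \<mu> \<theta> S\<close>, whereas its averages use \<open>Hm \<mu> \<theta> UNIV\<close>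
  over subsets of S; this passes between the two.\<close>

lemma nn_integral_Hm:
  assumes [measurable]: "S \<in> sets borel" "g \<in> borel_measurable borel"
  shows "(\<integral>\<^sup>+x. g x \<partial>Hm \<mu> \<theta> S) = (\<integral>\<^sup>+x\<in>S. g x \<partial>Hm \<mu> \<theta> UNIV)"
proof -
  have "Hm \<mu> \<theta> S = density (Hm \<mu> \<theta> UNIV) (indicator S)"
  proof (rule measure_eqI)
    fix A assume "A \<in> sets (Hm \<mu> \<theta> S)"
    then have [measurable]: "A \<in> sets borel" by simp
    have "emeasure (density (Hm \<mu> \<theta> UNIV) (indicator S)) A = (\<integral>\<^sup>+x. indicator (A \<inter> S) x \<partial>Hm \<mu> \<theta> UNIV)"
      by (simp add: emeasure_density indicator_inter_arith mult.commute)
    then show "emeasure (Hm \<mu> \<theta> S) A = emeasure (density (Hm \<mu> \<theta> UNIV) (indicator S)) A"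
      by (simp add: emeasure_Hm)
  qed simp
  then show ?thesis by (simp add: nn_integral_density mult.commute)
qed

text \<open>\<open>mseq\<close> is known only through its values on sets, so linearity of the
  integral in the measure is obtained by induction over measurable functions; in the supremum step
  both sequences of integrals increase, so the suprema add.\<close>

lemma nn_integral_linear_combination_measure:
  assumes sets: "sets M1 = sets M" "sets M2 = sets M"
    and em: "\<And>E. E \<in> sets M \<Longrightarrow> emeasure M E = a * emeasure M1 E + b * emeasure M2 E"
    and g: "g \<in> borel_measurable M"
  shows "(\<integral>\<^sup>+x. g x \<partial>M) = a * (\<integral>\<^sup>+x. g x \<partial>M1) + b * (\<integral>\<^sup>+x. g x \<partial>M2)"
proof -
  note [measurable_cong] = sets
  note sp = sets_eq_imp_space_eq[OF sets(1)] sets_eq_imp_space_eq[OF sets(2)]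
  show ?thesis
    using g
  proof (induction rule: borel_measurable_induct)
    case (cong f g)
    then have "(\<integral>\<^sup>+x. f x \<partial>N) = (\<integral>\<^sup>+x. g x \<partial>N)" if "space N = space M" for N
      using that by (intro nn_integral_cong) auto
    then show ?case using cong sp by simp
  next
    case (set A)
    then show ?case using em sets by simp
  next
    case (mult u c)
    note [measurable] = mult.hyps(2)
    show ?case using mult.IH by (simp add: nn_integral_cmult distrib_left mult.left_commute)
  next
    case (add u v)
    note [measurable] = add.hyps(1,3)
    show ?case using add.IH by (simp add: nn_integral_add distrib_left add_ac)
  next
    case (seq U)
    note [measurable] = seq.hyps(1)
    have inc: "incseq (\<lambda>i. c * (\<integral>\<^sup>+x. U i x \<partial>N))" for N c
      using seq.hyps(3) by (auto simp: incseq_def le_fun_def intro!: nn_integral_mono mult_left_mono)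
    have "(\<integral>\<^sup>+x. (SUP i. U i) x \<partial>N) = (SUP i. \<integral>\<^sup>+x. U i x \<partial>N)" if "sets N = sets M" for N
    proof -
      note [measurable_cong] = that
      have "(\<integral>\<^sup>+x. (SUP i. U i x) \<partial>N) = (SUP i. \<integral>\<^sup>+x. U i x \<partial>N)"
        using seq.hyps(3) by (intro nn_integral_monotone_convergence_SUP) auto
      then show ?thesis by (simp add: image_comp)
    qed
    note SUP_eq = this
    have "a * (SUP i. \<integral>\<^sup>+x. U i x \<partial>M1) + b * (SUP i. \<integral>\<^sup>+x. U i x \<partial>M2) =
        (SUP i. a * (\<integral>\<^sup>+x. U i x \<partial>M1) + b * (\<integral>\<^sup>+x. U i x \<partial>M2))"
      using inc by (subst ennreal_SUP_add) (simp_all add: SUP_mult_left_ennreal)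
    then show ?case by (simp only: SUP_eq[OF refl] SUP_eq[OF sets(1)] SUP_eq[OF sets(2)] seq.IH)
  qed
qed

lemma sets_restr [simp, measurable_cong]: "sets (restr \<mu> S) = sets \<mu>"
  by (simp add: restr_def)

lemma nn_integral_restr:
  assumes "S \<in> sets \<mu>" "g \<in> borel_measurable \<mu>"
  shows "(\<integral>\<^sup>+x. g x \<partial>restr \<mu> S) = (\<integral>\<^sup>+x\<in>S. g x \<partial>\<mu>)"
  unfolding restr_def using assms by (simp add: nn_integral_density mult.commute)

lemma emeasure_restr: "S \<in> sets \<mu> \<Longrightarrow> E \<in> sets \<mu> \<Longrightarrow> emeasure (restr \<mu> S) E = emeasure \<mu> (E \<inter> S)"
proof -
  assume "S \<in> sets \<mu>" "E \<in> sets \<mu>"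
  moreover from this have "emeasure (restr \<mu> S) E = (\<integral>\<^sup>+x. indicator (E \<inter> S) x \<partial>\<mu>)"
    by (simp add: restr_def emeasure_density indicator_inter_arith mult.commute)
  ultimately show ?thesis by simp
qed

section \<open>The weighted measures of the two sets as linear combinations\<close>

context
  fixes \<mu> :: "'a::metric_space measure" and S1 S2 :: "'a set"
  assumes sets_mu: "sets \<mu> = sets borel" and S1: "S1 \<in> sets borel" and S2: "S2 \<in> sets borel"
begin

lemma sets_mseq: "sets (mseq \<mu> \<theta> \<theta>2 S1 S2 k) = sets borel"
  unfolding mseq_def by (rule sets.sets_measure_of_eq[where M = borel, unfolded space_borel])

lemma emeasure_mseq:
  assumes E: "E \<in> sets borel"
  shows "emeasure (mseq \<mu> \<theta> \<theta>2 S1 S2 k) E =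
    ennreal (2 powr (real k * \<theta>)) * emeasure (restr \<mu> S1) E +
    ennreal (2 powr (real k * (\<theta> - \<theta>2))) * emeasure (Hm \<mu> \<theta>2 S2) E"
proof -
  define F where "F = (\<lambda>E. ennreal (2 powr (real k * \<theta>)) * emeasure \<mu> (E \<inter> S1) +
    ennreal (2 powr (real k * (\<theta> - \<theta>2))) * Hcod \<mu> \<theta>2 (E \<inter> S2))"
  have 1: "countably_additive (sets borel) (\<lambda>E. Hcod \<mu> \<theta>2 (E \<inter> S2))"
    using measure_space_Hcod[of \<mu> \<theta>2] S2 by (intro countably_additive_Int) (auto simp: measure_space_def)
  have 2: "countably_additive (sets borel) (\<lambda>E. emeasure \<mu> (E \<inter> S1))"
    using emeasure_countably_additive[of \<mu>] S1 sets_mu by (intro countably_additive_Int) auto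
  have "countably_additive (sets borel) F"
    unfolding F_def using countably_additive_linear_combination[OF 2 1] by blast
  moreover have "sigma_algebra UNIV (sets (borel :: 'a measure))"
    by (metis sets.sigma_algebra_axioms space_borel)
  moreover have "positive (sets borel) F" by (simp add: positive_def F_def)
  ultimately have "emeasure (measure_of UNIV (sets borel) F) E = F E"
    using E by (intro emeasure_measure_of_sigma)
  then show ?thesis using E S1 S2 sets_mu by (simp add: emeasure_restr emeasure_Hm mseq_def F_def)
qed

lemma nn_integral_mseq:
  assumes "g \<in> borel_measurable borel"
  shows "(\<integral>\<^sup>+x. g x \<partial>mseq \<mu> \<theta> \<theta>2 S1 S2 k) =
    ennreal (2 powr (real k * \<theta>)) * (\<integral>\<^sup>+x. g x \<partial>restr \<mu> S1) +
    ennreal (2 powr (real k * (\<theta> - \<theta>2))) * (\<integral>\<^sup>+x. g x \<partial>Hm \<mu> \<theta>2 S2)"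
proof (rule nn_integral_linear_combination_measure)
  show "g \<in> borel_measurable (mseq \<mu> \<theta> \<theta>2 S1 S2 k)"
    using assms by (simp add: sets_mseq cong: measurable_cong_sets)
qed (simp_all add: sets_mseq sets_mu emeasure_mseq)

end

section \<open>Averages and finite families of balls\<close>

lemma enn_rpow_mono: "0 \<le> a \<Longrightarrow> x \<le> y \<Longrightarrow> enn_rpow x a \<le> enn_rpow y a"
  by (auto simp: enn_rpow_def top_unique less_top intro!: ennreal_leI powr_mono2 enn2real_mono)

lemma enn_rpow_ennreal [simp]: "0 \<le> t \<Longrightarrow> enn_rpow (ennreal t) a = ennreal (t powr a)"
  by (simp add: enn_rpow_def)

lemma enn_rpow_mult:
  assumes "0 < a"
  shows "enn_rpow (x * y) a = enn_rpow x a * enn_rpow y a"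
proof (cases x; cases y)
  fix r s assume "0 \<le> r" "x = ennreal r" "0 \<le> s" "y = ennreal s"
  then show ?thesis by (simp add: powr_mult flip: ennreal_mult)
next
  fix r assume "0 \<le> r" "x = ennreal r" "y = top"
  then show ?thesis by (cases "r = 0") (auto simp: enn_rpow_def ennreal_mult_top)
next
  fix r assume "0 \<le> r" "y = ennreal r" "x = top"
  then show ?thesis by (cases "r = 0") (auto simp: enn_rpow_def ennreal_top_mult)
qed (simp_all add: enn_rpow_def)

lemma enn_rpow_rpow:
  assumes "0 < a" "0 < b"
  shows "enn_rpow (enn_rpow x a) b = enn_rpow x (a * b)"
  by (cases x) (auto simp: powr_powr enn_rpow_def)

lemma enn_rpow_one [simp]: "enn_rpow x 1 = x"
  by (cases x) (auto simp: enn_rpow_def)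

lemma borel_measurable_enn_rpow [measurable]:
  assumes [measurable]: "g \<in> borel_measurable M"
  shows "(\<lambda>x. enn_rpow (g x) a) \<in> borel_measurable M"
  unfolding enn_rpow_def by measurable

lemma Av_mono: "(\<And>x. x \<in> G \<Longrightarrow> g x \<le> h x) \<Longrightarrow> Av m G g \<le> Av m G h"
  unfolding Av_def by (auto intro!: divide_right_mono_ennreal nn_integral_mono split: split_indicator)

text \<open>Only an inequality: the average is 0 on a null set, and on a set of infinite mass the
  constant \<open>c\<close> is averaged to 0 because division by \<open>top\<close> gives 0.\<close>

lemma Av_affine_le:
  assumes [measurable]: "G \<in> sets m" "h \<in> borel_measurable m"
  shows "Av m G (\<lambda>x. c + d * h x) \<le> c + d * Av m G h"
proof (cases "emeasure m G = 0")
  case False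
  have "(\<integral>\<^sup>+x\<in>G. (c + d * h x) \<partial>m) = (\<integral>\<^sup>+x. c * indicator G x + d * (h x * indicator G x) \<partial>m)"
    by (intro nn_integral_cong) (simp split: split_indicator)
  also have "\<dots> = c * emeasure m G + d * (\<integral>\<^sup>+x\<in>G. h x \<partial>m)"
    by (simp add: nn_integral_add nn_integral_cmult)
  finally have "Av m G (\<lambda>x. c + d * h x) = c * emeasure m G / emeasure m G + d * (Av m G h)"
    using False by (simp add: Av_def add_divide_distrib_ennreal ennreal_times_divide)
  moreover have "c * emeasure m G / emeasure m G \<le> c"
    using False by (cases "emeasure m G = top") (auto simp: ennreal_mult_divide_eq ennreal_divide_top)
  ultimately show ?thesis by (simp add: add_right_mono)
qed (simp add: Av_def)

lemma set_nn_integral_eq_Av: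
  assumes "G \<in> sets m" "emeasure m G < top"
  shows "(\<integral>\<^sup>+x\<in>G. g x \<partial>m) = Av m G g * emeasure m G"
proof (cases "emeasure m G = 0")
  case True
  then have "G \<in> null_sets m" using assms by auto
  then show ?thesis using True by (simp add: nn_integral_null_set Av_def)
next
  case False
  then show ?thesis using assms by (simp add: Av_def ennreal_divide_times ennreal_mult_divide_eq)
qed

lemma Av_const_le:
  assumes "G \<in> sets m" "0 < emeasure m G" "emeasure m G < top" "\<And>x. x \<in> G \<Longrightarrow> c \<le> g x"
  shows "c \<le> Av m G g"
proof -
  have "c * emeasure m G = (\<integral>\<^sup>+x\<in>G. c \<partial>m)"
    using assms(1) by (simp add: nn_integral_cmult_indicator)
  also have "\<dots> \<le> (\<integral>\<^sup>+x\<in>G. g x \<partial>m)" using assms by (intro nn_integral_mono) (auto split: split_indicator)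
  finally have "c * emeasure m G / emeasure m G \<le> Av m G g"
    using assms by (auto simp: Av_def intro!: divide_right_mono_ennreal)
  then show ?thesis using assms by (simp add: ennreal_mult_divide_eq)
qed

text \<open>Jensen's inequality up to the factor 2^p. For every b > 0 the bound |f| \<le> b +
  b^(1-p) |f|^p holds pointwise; it is averaged and then \<open>b\<close> is chosen with b^p equal
  to the mean of |f|^p. The argument also covers null sets and sets of infinite mass, where averages
  degenerate.\<close>

lemma enn_rpow_Av_le:
  fixes f :: "'a \<Rightarrow> real"
  assumes [measurable]: "G \<in> sets m" "f \<in> borel_measurable m" and p: "1 < p"
  shows "enn_rpow (Av m G (\<lambda>x. ennreal \<bar>f x\<bar>)) p \<le>
    ennreal (2 powr p) * Av m G (\<lambda>x. enn_rpow (ennreal \<bar>f x\<bar>) p)"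
proof -
  define P where "P = Av m G (\<lambda>x. enn_rpow (ennreal \<bar>f x\<bar>) p)"
  have le: "Av m G (\<lambda>x. ennreal \<bar>f x\<bar>) \<le> ennreal b + ennreal (b powr (1 - p)) * P" if b: "0 < b" for b
  proof -
    have "t \<le> b + b powr (1 - p) * t powr p" if "0 \<le> t" for t
    proof (cases "t \<le> b")
      case False
      then have "t = t powr (1 - p) * t powr p" using b by (simp flip: powr_add)
      also have "\<dots> \<le> b powr (1 - p) * t powr p"
        using b False p by (intro mult_right_mono powr_mono2') auto
      finally show ?thesis using b by simp
    qed (use that in \<open>simp add: add_increasing2\<close>)
    then have "Av m G (\<lambda>x. ennreal \<bar>f x\<bar>) \<le>
        Av m G (\<lambda>x. ennreal b + ennreal (b powr (1 - p)) * enn_rpow (ennreal \<bar>f x\<bar>) p)"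
      using b by (intro Av_mono) (simp flip: ennreal_mult ennreal_plus)
    also have "\<dots> \<le> ennreal b + ennreal (b powr (1 - p)) * P"
      unfolding P_def by (intro Av_affine_le) measurable
    finally show ?thesis .
  qed
  have "enn_rpow (Av m G (\<lambda>x. ennreal \<bar>f x\<bar>)) p \<le> ennreal (2 powr p) * P"
  proof (cases P)
    case (real q)
    show ?thesis
    proof (cases "q = 0")
      case True
      \<comment> \<open>With vanishing p-th mean there is no positive \<open>b\<close> to balance
        the terms; the bound for all small \<open>b\<close> forces the mean of |f| to
        vanish.\<close>
      then have "Av m G (\<lambda>x. ennreal \<bar>f x\<bar>) \<le> 0 + ennreal b" if "0 < b" for b
        using le[OF that] real by simp
      then have "Av m G (\<lambda>x. ennreal \<bar>f x\<bar>) \<le> 0" by (rule ennreal_le_epsilon)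
      then show ?thesis using enn_rpow_ennreal[of 0 p] by simp
    next
      case False
      \<comment> \<open>This value balances the two terms of \<open>le\<close>: both become
        \<open>b\<close>.\<close>
      define b where "b = q powr (1 / p)"
      have b: "0 < b" using False by (simp add: b_def)
      have "b powr (1 - p) * q = b"
      proof -
        have "q = b powr p" using False p real by (simp add: b_def powr_powr)
        then have "b powr (1 - p) * q = b powr (1 - p) * b powr p" by simp
        also have "\<dots> = b" using b by (simp flip: powr_add)
        finally show ?thesis .
      qed
      then have "Av m G (\<lambda>x. ennreal \<bar>f x\<bar>) \<le> ennreal (2 * b)"
        using le[OF b] real b by (simp flip: ennreal_mult ennreal_plus)
      then have "enn_rpow (Av m G (\<lambda>x. ennreal \<bar>f x\<bar>)) p \<le> enn_rpow (ennreal (2 * b)) p"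
        using p by (intro enn_rpow_mono) auto
      also have "\<dots> = ennreal (2 powr p) * P"
        using b real False p by (simp add: powr_mult b_def powr_powr flip: ennreal_mult)
      finally show ?thesis .
    qed
  qed (simp add: ennreal_mult_top)
  then show ?thesis by (simp add: P_def)
qed

lemma ennreal_le_add_diff: "x \<le> a + (x - a)" for x a :: ennreal
proof (cases "a \<le> x")
  case True
  then show ?thesis by (simp add: add.commute[of a] diff_add_cancel_ennreal)
next
  case False
  then have "x \<le> a" by simp
  then show ?thesis by (rule order_trans) simp
qed

text \<open>The constant is a value c = f(y) at a point of G1 where the inner average is at most
  \<open>a\<close>; such a point exists because the average over G1 is below \<open>a\<close>. It is
  good on G2 at once, and on G1 after a point of G2 is inserted into |f(w) - f(y)| and averaged
  over.\<close>

lemma Av_double_common_constant: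
  fixes f :: "'a \<Rightarrow> real"
  assumes [measurable]: "G1 \<in> sets m1" "G2 \<in> sets m2" "f \<in> borel_measurable m1" "f \<in> borel_measurable m2"
    and pos: "0 < emeasure m1 G1" "emeasure m1 G1 < top" "0 < emeasure m2 G2" "emeasure m2 G2 < top"
    and less: "Av m1 G1 (\<lambda>y. Av m2 G2 (\<lambda>z. ennreal \<bar>f y - f z\<bar>)) < a"
  obtains c where "Av m1 G1 (\<lambda>y. ennreal \<bar>f y - c\<bar>) \<le> a + a" "Av m2 G2 (\<lambda>z. ennreal \<bar>f z - c\<bar>) \<le> a"
proof -
  define \<psi> where "\<psi> y = Av m2 G2 (\<lambda>z. ennreal \<bar>f y - f z\<bar>)" for y
  obtain y where y: "y \<in> G1" "\<psi> y \<le> a"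
  proof (rule ccontr)
    assume "\<not> thesis"
    then have "a \<le> \<psi> y" if "y \<in> G1" for y using that \<open>\<And>y. y \<in> G1 \<Longrightarrow> \<psi> y \<le> a \<Longrightarrow> thesis\<close> by (meson linear)
    then have "a \<le> Av m1 G1 \<psi>" using pos by (intro Av_const_le) auto
    then show False using less by (simp add: \<psi>_def[abs_def] not_less[symmetric])
  qed
  define c where "c = f y"
  have 2: "Av m2 G2 (\<lambda>z. ennreal \<bar>f z - c\<bar>) \<le> a"
    using y(2) unfolding \<psi>_def c_def by (simp add: abs_minus_commute)
  have pw: "ennreal \<bar>f w - c\<bar> \<le> a + \<psi> w" for w
  proof -
    define h where "h z = ennreal \<bar>f w - f z\<bar>" for z
    define l where "l z = ennreal \<bar>f z - c\<bar>" for z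
    have hl: "Av m2 G2 (\<lambda>z. h z + l z) = Av m2 G2 h + Av m2 G2 l"
    proof -
      have "(\<integral>\<^sup>+z\<in>G2. (h z + l z) \<partial>m2) = (\<integral>\<^sup>+z\<in>G2. h z \<partial>m2) + (\<integral>\<^sup>+z\<in>G2. l z \<partial>m2)"
        unfolding h_def l_def by (simp add: distrib_right nn_integral_add)
      then show ?thesis using pos by (simp add: Av_def add_divide_distrib_ennreal)
    qed
    have "ennreal \<bar>f w - c\<bar> \<le> Av m2 G2 (\<lambda>z. h z + l z)"
      using pos by (intro Av_const_le) (auto simp: h_def l_def simp flip: ennreal_plus intro!: ennreal_leI)
    also have "\<dots> \<le> \<psi> w + a" unfolding hl using 2 by (simp add: h_def[abs_def] l_def[abs_def] \<psi>_def add_left_mono)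
    finally show ?thesis by (simp add: add.commute)
  qed
  \<comment> \<open>Measurability of \<open>\<psi>\<close> is not established, so the average of a +
    \<open>\<psi>\<close> cannot be split. Subtracting \<open>a\<close> first leaves a measurable
    function below \<open>\<psi>\<close>, to which only monotonicity is applied.\<close>
  have "Av m1 G1 (\<lambda>y. ennreal \<bar>f y - c\<bar>) \<le> Av m1 G1 (\<lambda>y. a + 1 * (ennreal \<bar>f y - c\<bar> - a))"
    by (intro Av_mono) (simp add: ennreal_le_add_diff)
  also have "\<dots> \<le> a + 1 * Av m1 G1 (\<lambda>y. ennreal \<bar>f y - c\<bar> - a)"
    by (intro Av_affine_le) measurable
  also have "\<dots> \<le> a + Av m1 G1 \<psi>"
  proof -
    have "Av m1 G1 (\<lambda>y. ennreal \<bar>f y - c\<bar> - a) \<le> Av m1 G1 \<psi>"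
      using pw less by (intro Av_mono) (auto simp: ennreal_minus_le_iff)
    then show ?thesis by (simp add: add_left_mono)
  qed
  also have "\<dots> \<le> a + a" using less by (auto simp: \<psi>_def[abs_def] intro!: add_left_mono)
  finally show ?thesis using 2 that by blast
qed

text \<open>Layer cake by induction: the smallest value \<open>m\<close> is subtracted from all
  \<open>a i\<close>, and \<open>m\<close> times the indicator of the union from \<open>g\<close>.
  The removed layer is paid for by \<open>sub\<close> applied to the whole family, however much the
  \<open>E i\<close> overlap. In the remainder the index attaining the minimum has dropped out, and
  \<open>sub\<close> still holds for the smaller subfamilies.\<close>

lemma sum_le_nn_integral_of_subsets:
  fixes a b :: "'i \<Rightarrow> ennreal"
  assumes "finite I" and E: "\<And>i. i \<in> I \<Longrightarrow> E i \<in> sets \<nu>"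
    and g: "g \<in> borel_measurable \<nu>" and le: "\<And>i y. i \<in> I \<Longrightarrow> y \<in> E i \<Longrightarrow> a i \<le> g y"
    and sub: "\<And>J. J \<subseteq> I \<Longrightarrow> (\<Sum>i\<in>J. b i) \<le> C * emeasure \<nu> (\<Union>i\<in>J. E i)"
  shows "(\<Sum>i\<in>I. a i * b i) \<le> C * (\<integral>\<^sup>+y. g y \<partial>\<nu>)"
  using assms
proof (induction I arbitrary: a g rule: finite_psubset_induct)
  case (psubset I)
  note [measurable] = psubset.prems(2)
  show ?case
  proof (cases "I = {}")
    case False
    define m where "m = Min (a ` I)"
    have "m \<in> a ` I" unfolding m_def using psubset.hyps(1) False by (intro Min_in) auto
    then obtain i0 where i0: "i0 \<in> I" "m = a i0" by blast
    have m_le: "m \<le> a i" if "i \<in> I" for i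
      unfolding m_def using that psubset.hyps(1) by (intro Min_le) auto
    define U where "U = (\<Union>i\<in>I. E i)"
    have U [measurable]: "U \<in> sets \<nu>" unfolding U_def using psubset.prems(1) psubset.hyps by auto
    have g_ge: "m * indicator U y \<le> g y" for y
    proof (cases "y \<in> U")
      case True
      then obtain i where "i \<in> I" "y \<in> E i" by (auto simp: U_def)
      then show ?thesis using m_le[of i] psubset.prems(3)[of i y] True by (simp add: order_trans)
    qed simp
    have mU: "m * (\<Sum>i\<in>I. b i) \<le> C * (\<integral>\<^sup>+y. m * indicator U y \<partial>\<nu>)"
      using mult_left_mono[OF psubset.prems(4)[of I], of m] by (simp add: U_def[symmetric] nn_integral_cmult mult.left_commute)
    \<comment> \<open>In \<open>ennreal\<close>, top - top is top, so an infinite minimum cannot be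
      subtracted; in that case all \<open>a i\<close> are infinite and a single layer
      suffices.\<close>
    show ?thesis
    proof (cases "m = top")
      case True
      then have "a i = m" if "i \<in> I" for i using m_le[OF that] by (simp add: top_unique)
      then have "(\<Sum>i\<in>I. a i * b i) = m * (\<Sum>i\<in>I. b i)" by (simp add: sum_distrib_left)
      also note mU
      also have "C * (\<integral>\<^sup>+y. m * indicator U y \<partial>\<nu>) \<le> C * (\<integral>\<^sup>+y. g y \<partial>\<nu>)"
        by (intro mult_left_mono nn_integral_mono g_ge) simp
      finally show ?thesis .
    next
      case False
      define a' where "a' i = a i - m" for i
      define g' where "g' y = g y - m * indicator U y" for y
      have [measurable]: "g' \<in> borel_measurable \<nu>" unfolding g'_def by measurable
      have "(\<Sum>i\<in>I - {i0}. a' i * b i) \<le> C * (\<integral>\<^sup>+y. g' y \<partial>\<nu>)"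
      proof (rule psubset.IH)
        show "a' i \<le> g' y" if "i \<in> I - {i0}" "y \<in> E i" for i y
          using that psubset.prems(3)[of i y] by (auto simp: a'_def g'_def U_def split: split_indicator intro: ennreal_minus_mono)
        show "(\<Sum>i\<in>J. b i) \<le> C * emeasure \<nu> (\<Union>i\<in>J. E i)" if "J \<subseteq> I - {i0}" for J
          using that by (intro psubset.prems(4)) blast
      qed (use i0 psubset.prems(1) in auto)
      moreover have "(\<Sum>i\<in>I. a' i * b i) = (\<Sum>i\<in>I - {i0}. a' i * b i)"
        using i0 psubset.hyps False by (subst sum.remove[of I i0]) (auto simp: a'_def)
      moreover have "(\<Sum>i\<in>I. a i * b i) = (\<Sum>i\<in>I. a' i * b i) + m * (\<Sum>i\<in>I. b i)"
        unfolding sum_distrib_left sum.distrib[symmetric] distrib_right[symmetric]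
        using m_le by (intro sum.cong) (simp_all add: a'_def diff_add_cancel_ennreal)
      ultimately have "(\<Sum>i\<in>I. a i * b i) \<le> C * (\<integral>\<^sup>+y. g' y \<partial>\<nu>) + C * (\<integral>\<^sup>+y. m * indicator U y \<partial>\<nu>)"
        using add_mono[OF _ mU] by simp
      also have "\<dots> = C * (\<integral>\<^sup>+y. g' y + m * indicator U y \<partial>\<nu>)"
        by (simp add: nn_integral_add distrib_left)
      also have "\<dots> = C * (\<integral>\<^sup>+y. g y \<partial>\<nu>)"
        using g_ge by (simp add: g'_def diff_add_cancel_ennreal)
      finally show ?thesis .
    qed
  qed simp
qed

text \<open>Greedy selection: a ball of largest radius is kept and the balls meeting it are
  discarded, all of which lie in its threefold enlargement. The maximum is attained because the
  family is finite, hence the factor 3.\<close>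

lemma finite_vitali_cballs:
  fixes x :: "'i \<Rightarrow> 'a::metric_space"
  assumes "finite I" "\<And>i. i \<in> I \<Longrightarrow> 0 \<le> R i"
  shows "\<exists>J\<subseteq>I. (\<forall>i\<in>J. \<forall>j\<in>J. i \<noteq> j \<longrightarrow> cball (x i) (R i) \<inter> cball (x j) (R j) = {}) \<and>
    (\<Union>i\<in>I. cball (x i) (R i)) \<subseteq> (\<Union>j\<in>J. cball (x j) (3 * R j))"
  using assms
proof (induction I rule: finite_psubset_induct)
  case (psubset I)
  show ?case
  proof (cases "I = {}")
    case False
    have "Max (R ` I) \<in> R ` I" using psubset.hyps(1) False by (intro Max_in) auto
    then obtain i0 where i0: "i0 \<in> I" "Max (R ` I) = R i0" by blast
    have max: "R i \<le> R i0" if "i \<in> I" for i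
      unfolding i0(2)[symmetric] using that psubset.hyps(1) by (intro Max_ge) auto
    define I' where "I' = {i \<in> I. cball (x i) (R i) \<inter> cball (x i0) (R i0) = {}}"
    have "x i0 \<in> cball (x i0) (R i0)" using psubset.prems[OF i0(1)] by simp
    then have "i0 \<notin> I'" unfolding I'_def by blast
    then have "I' \<subset> I" using i0(1) unfolding I'_def by blast
    then have "\<exists>J\<subseteq>I'. (\<forall>i\<in>J. \<forall>j\<in>J. i \<noteq> j \<longrightarrow> cball (x i) (R i) \<inter> cball (x j) (R j) = {}) \<and>
        (\<Union>i\<in>I'. cball (x i) (R i)) \<subseteq> (\<Union>j\<in>J. cball (x j) (3 * R j))"
      using psubset.prems by (intro psubset.IH) auto
    then obtain J where J: "J \<subseteq> I'" "\<forall>i\<in>J. \<forall>j\<in>J. i \<noteq> j \<longrightarrow> cball (x i) (R i) \<inter> cball (x j) (R j) = {}"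
      "(\<Union>i\<in>I'. cball (x i) (R i)) \<subseteq> (\<Union>j\<in>J. cball (x j) (3 * R j))"
      by (elim exE conjE)
    have near: "cball (x i) (R i) \<subseteq> cball (x i0) (3 * R i0)" if iI: "i \<in> I" "i \<notin> I'" for i
    proof
      fix y assume y: "y \<in> cball (x i) (R i)"
      obtain z where "z \<in> cball (x i) (R i)" "z \<in> cball (x i0) (R i0)"
        using iI unfolding I'_def by blast
      then show "y \<in> cball (x i0) (3 * R i0)"
        using y max[OF iI(1)] dist_triangle[of "x i0" y "x i"] dist_triangle2[of "x i0" "x i" z] by auto
    qed
    show ?thesis
    proof (intro exI[of _ "insert i0 J"] conjI ballI impI)
      show "insert i0 J \<subseteq> I" using J i0 \<open>I' \<subset> I\<close> by auto
      show "(\<Union>i\<in>I. cball (x i) (R i)) \<subseteq> (\<Union>j\<in>insert i0 J. cball (x j) (3 * R j))"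
      proof (rule UN_least)
        fix i assume "i \<in> I"
        then show "cball (x i) (R i) \<subseteq> (\<Union>j\<in>insert i0 J. cball (x j) (3 * R j))"
          using near[of i] J(3) by (cases "i \<in> I'") auto
      qed
      fix i j assume "i \<in> insert i0 J" "j \<in> insert i0 J" "i \<noteq> j"
      then consider "i \<in> J" "j \<in> J" | "i = i0" "j \<in> I'" | "j = i0" "i \<in> I'" using J(1) by blast
      then show "cball (x i) (R i) \<inter> cball (x j) (R j) = {}"
        using J(2) \<open>i \<noteq> j\<close> by cases (simp_all add: I'_def Int_commute)
    qed
  qed simp
qed

text \<open>The enlarged balls and the sets \<open>E i\<close> may overlap without any bound; selecting a disjoint
  subfamily of the \<open>K\<close>-fold balls replaces the usual maximal function argument.\<close>

lemma sum_emeasure_cball_le_nn_integral: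
  fixes \<mu> \<nu> :: "'a::metric_space measure" and x :: "'i \<Rightarrow> 'a"
  assumes fin: "finite I" and sets: "sets \<mu> = sets borel" "sets \<nu> = sets borel"
    and disj: "\<And>i j. i \<in> I \<Longrightarrow> j \<in> I \<Longrightarrow> i \<noteq> j \<Longrightarrow> cball (x i) (r i) \<inter> cball (x j) (r j) = {}"
    and r: "\<And>i. i \<in> I \<Longrightarrow> 0 < r i" and K: "1 \<le> K"
    and E: "\<And>i. i \<in> I \<Longrightarrow> E i \<in> sets borel" "\<And>i. i \<in> I \<Longrightarrow> E i \<subseteq> cball (x i) (K * r i)"
    and mass: "\<And>i. i \<in> I \<Longrightarrow> emeasure \<mu> (cball (x i) (3 * (K * r i))) \<le> C * emeasure \<nu> (E i)"
    and le: "\<And>i y. i \<in> I \<Longrightarrow> y \<in> E i \<Longrightarrow> a i \<le> g y"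
  shows "(\<Sum>i\<in>I. a i * emeasure \<mu> (cball (x i) (r i))) \<le> C * (\<integral>\<^sup>+y. g y \<partial>\<nu>)"
proof -
  have cb: "cball z s \<in> sets \<mu>" for z s using sets by simp
  have sub: "(\<Sum>i\<in>J. emeasure \<mu> (cball (x i) (r i))) \<le> C * emeasure \<nu> (\<Union>i\<in>J. E i)" if J: "J \<subseteq> I" for J
  proof -
    have finJ: "finite J" using J fin by (rule finite_subset)
    have Kr: "r i \<le> K * r i" "0 \<le> K * r i" if "i \<in> J" for i
    proof -
      have "0 < r i" using that J r by blast
      then show "r i \<le> K * r i" "0 \<le> K * r i" using K mult_right_mono[of 1 K "r i"] by simp_all
    qed
    \<comment> \<open>The selection is made among the \<open>K\<close>-fold balls, which contain the
      sets \<open>E i\<close>: the selected sets are therefore disjoint and their masses add up,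
      while \<open>mass\<close> absorbs the enlargement by 3.\<close>
    have "\<exists>L\<subseteq>J. (\<forall>i\<in>L. \<forall>j\<in>L. i \<noteq> j \<longrightarrow> cball (x i) (K * r i) \<inter> cball (x j) (K * r j) = {}) \<and>
        (\<Union>i\<in>J. cball (x i) (K * r i)) \<subseteq> (\<Union>j\<in>L. cball (x j) (3 * (K * r j)))"
      by (rule finite_vitali_cballs[OF finJ Kr(2)])
    then obtain L where L: "L \<subseteq> J"
      "\<forall>i\<in>L. \<forall>j\<in>L. i \<noteq> j \<longrightarrow> cball (x i) (K * r i) \<inter> cball (x j) (K * r j) = {}"
      "(\<Union>i\<in>J. cball (x i) (K * r i)) \<subseteq> (\<Union>j\<in>L. cball (x j) (3 * (K * r j)))"
      by (elim exE conjE)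
    have finL: "finite L" using L(1) finJ by (rule finite_subset)
    have "(\<Sum>i\<in>J. emeasure \<mu> (cball (x i) (r i))) = emeasure \<mu> (\<Union>i\<in>J. cball (x i) (r i))"
    proof (rule sum_emeasure)
      show "disjoint_family_on (\<lambda>i. cball (x i) (r i)) J"
        unfolding disjoint_family_on_def using disj J by (meson subsetD)
    qed (use finJ cb in auto)
    also have "\<dots> \<le> emeasure \<mu> (\<Union>j\<in>L. cball (x j) (3 * (K * r j)))"
    proof (intro emeasure_mono)
      have "(\<Union>i\<in>J. cball (x i) (r i)) \<subseteq> (\<Union>i\<in>J. cball (x i) (K * r i))"
        using Kr(1) by (intro UN_mono subset_cball) simp_all
      then show "(\<Union>i\<in>J. cball (x i) (r i)) \<subseteq> (\<Union>j\<in>L. cball (x j) (3 * (K * r j)))" using L(3) by blast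
    qed (use finL cb in auto)
    also have "\<dots> \<le> (\<Sum>j\<in>L. emeasure \<mu> (cball (x j) (3 * (K * r j))))"
      using finL cb by (intro emeasure_subadditive_finite) auto
    also have "\<dots> \<le> (\<Sum>j\<in>L. C * emeasure \<nu> (E j))" using L J by (intro sum_mono mass) auto
    also have "\<dots> = C * emeasure \<nu> (\<Union>j\<in>L. E j)"
    proof -
      have "disjoint_family_on E L"
        unfolding disjoint_family_on_def
      proof (intro ballI impI)
        fix i j assume "i \<in> L" "j \<in> L" "i \<noteq> j"
        then have "cball (x i) (K * r i) \<inter> cball (x j) (K * r j) = {}" "i \<in> I" "j \<in> I"
          using L(1,2) J by auto
        then show "E i \<inter> E j = {}" using E(2)[of i] E(2)[of j] by blast
      qed
      then have "(\<Sum>j\<in>L. emeasure \<nu> (E j)) = emeasure \<nu> (\<Union>j\<in>L. E j)"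
        using L(1) J E(1) sets finL by (intro sum_emeasure) auto
      then show ?thesis by (simp add: sum_distrib_left[symmetric])
    qed
    also have "\<dots> \<le> C * emeasure \<nu> (\<Union>i\<in>J. E i)"
    proof (intro mult_left_mono emeasure_mono)
      show "(\<Union>i\<in>J. E i) \<in> sets \<nu>" using J E(1) sets finJ by (intro sets.finite_UN) auto
    qed (use L(1) in auto)
    finally show ?thesis .
  qed
  \<comment> \<open>No measurability of \<open>g\<close> is assumed. The layer-cake lemma is applied
    to the smallest function that dominates \<open>a i\<close> on each \<open>E i\<close>, a finite
    maximum of step functions; the nonnegative integral is monotone for arbitrary integrands, which
    gives the passage to \<open>g\<close>.\<close>
  define h where "h y = (SUP i\<in>I. a i * indicator (E i) y)" for y
  have "(\<Sum>i\<in>I. a i * emeasure \<mu> (cball (x i) (r i))) \<le> C * (\<integral>\<^sup>+y. h y \<partial>\<nu>)"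
  proof (rule sum_le_nn_integral_of_subsets[OF fin _ _ _ sub])
    show "h \<in> borel_measurable \<nu>"
      unfolding h_def using fin E(1) sets
      by (intro borel_measurable_SUP countable_finite) auto
    show "a i \<le> h y" if "i \<in> I" "y \<in> E i" for i y
      unfolding h_def using that by (intro SUP_upper2[of i]) auto
  qed (use E sets in auto)
  also have "\<dots> \<le> C * (\<integral>\<^sup>+y. g y \<partial>\<nu>)"
    unfolding h_def
  proof (intro mult_left_mono nn_integral_mono SUP_least)
    show "a i * indicator (E i) y \<le> g y" if "i \<in> I" for i y
      using le[OF that, of y] by (simp split: split_indicator)
  qed simp
  finally show ?thesis .
qed

section \<open>Doubling measures\<close>

locale doubling_measure =
  fixes \<mu> :: "'a::metric_space measure"
  assumes sets_mu [simp, measurable_cong]: "sets \<mu> = sets borel"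
    and ball_finite: "\<And>x r. emeasure \<mu> (cball x r) < top"
    and ball_pos: "\<And>x r. 0 < r \<Longrightarrow> 0 < emeasure \<mu> (cball x r)"
    and doubling: "unif_loc_doubling \<mu>"
begin

text \<open>The condition on \<open>dist x w + a\<close> forces \<open>cball x a\<close> into the
  2^n-fold ball about \<open>w\<close>, so n doublings compare two balls of bounded relative size
  and distance. In this form one constant serves balls with different centres.\<close>

lemma doubling_iterate:
  "\<exists>D\<ge>1. \<forall>x w r a. 0 < r \<and> r \<le> 1 \<and> dist x w + a \<le> 2 ^ n * r \<longrightarrow>
    emeasure \<mu> (cball x a) \<le> ennreal D * emeasure \<mu> (cball w r)"
proof -
  have "(0::real) < 2 ^ n" by simp
  then obtain C :: real where C': "\<forall>r\<in>{0<..2 ^ n}. \<forall>x.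
      emeasure \<mu> (cball x (2 * r)) \<le> ennreal C * emeasure \<mu> (cball x r)"
    using doubling unfolding unif_loc_doubling_def by blast
  have C: "emeasure \<mu> (cball x (2 * r)) \<le> ennreal C * emeasure \<mu> (cball x r)"
    if "0 < r" "r \<le> 2 ^ n" for r x
    using C' that by simp
  define D where "D = max 1 C"
  have iter: "emeasure \<mu> (cball w (2 ^ j * r)) \<le> ennreal (D ^ j) * emeasure \<mu> (cball w r)"
    if "0 < r" "r \<le> 1" "j \<le> n" for j w r
    using that(3)
  proof (induction j)
    case (Suc j)
    have "2 ^ j * r \<le> (2::real) ^ n * 1"
      using Suc.prems that by (intro mult_mono power_increasing) auto
    then have "emeasure \<mu> (cball w (2 * (2 ^ j * r))) \<le> ennreal C * emeasure \<mu> (cball w (2 ^ j * r))"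
      using that by (intro C) auto
    also have "\<dots> \<le> ennreal D * (ennreal (D ^ j) * emeasure \<mu> (cball w r))"
      using Suc by (intro mult_mono) (auto simp: D_def intro: ennreal_leI)
    also have "\<dots> = ennreal (D ^ Suc j) * emeasure \<mu> (cball w r)"
      by (simp add: D_def ennreal_mult mult.assoc)
    finally show ?case by (simp add: mult.assoc)
  qed simp
  have "emeasure \<mu> (cball x a) \<le> ennreal (D ^ n) * emeasure \<mu> (cball w r)"
    if "0 < r" "r \<le> 1" "dist x w + a \<le> 2 ^ n * r" for x w r a
  proof -
    have "cball x a \<subseteq> cball w (2 ^ n * r)"
    proof
      fix y assume "y \<in> cball x a"
      then show "y \<in> cball w (2 ^ n * r)"
        using that(3) dist_triangle[of w y x] by (simp add: dist_commute)
    qed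
    then have "emeasure \<mu> (cball x a) \<le> emeasure \<mu> (cball w (2 ^ n * r))" by (intro emeasure_mono) auto
    also have "\<dots> \<le> ennreal (D ^ n) * emeasure \<mu> (cball w r)" using that by (intro iter) auto
    finally show ?thesis .
  qed
  moreover have "1 \<le> D ^ n" by (simp add: D_def)
  ultimately show ?thesis by (intro exI[of _ "D ^ n"]) simp
qed

text \<open>Volume counting: the disjoint balls each carry at least the fraction 1/D of the mass of
  the ball containing them. It yields both the finite nets and the bounded overlap of large
  balls.\<close>

lemma card_disjoint_balls_le:
  assumes "finite N" "0 < s" "0 \<le> D"
    and disj: "disjoint_family_on (\<lambda>i. cball (x i) (r i)) N"
    and sub: "\<And>i. i \<in> N \<Longrightarrow> cball (x i) (r i) \<subseteq> cball y s"
    and large: "\<And>i. i \<in> N \<Longrightarrow> emeasure \<mu> (cball y s) \<le> ennreal D * emeasure \<mu> (cball (x i) (r i))"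
  shows "real (card N) \<le> D"
proof -
  obtain V where V: "0 < V" "emeasure \<mu> (cball y s) = ennreal V"
    using ball_pos[OF \<open>0 < s\<close>, of y] ball_finite[of y s] by (cases "emeasure \<mu> (cball y s)") auto
  have "ennreal (real (card N) * V) = (\<Sum>i\<in>N. emeasure \<mu> (cball y s))"
    using V by (simp add: ennreal_mult ennreal_of_nat_eq_real_of_nat)
  also have "\<dots> \<le> (\<Sum>i\<in>N. ennreal D * emeasure \<mu> (cball (x i) (r i)))" by (intro sum_mono large)
  also have "\<dots> = ennreal D * emeasure \<mu> (\<Union>i\<in>N. cball (x i) (r i))"
    using disj \<open>finite N\<close> by (subst sum_emeasure[symmetric]) (auto simp: sum_distrib_left)
  also have "\<dots> \<le> ennreal D * emeasure \<mu> (cball y s)"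
    using sub by (intro mult_left_mono emeasure_mono UN_least) auto
  also have "\<dots> = ennreal (D * V)" using V \<open>0 \<le> D\<close> by (simp add: ennreal_mult)
  finally have "real (card N) * V \<le> D * V" using V \<open>0 \<le> D\<close> by (simp add: ennreal_le_iff)
  then show ?thesis using V by simp
qed

text \<open>Volume counting bounds the size of separated subsets, so one of maximal cardinality
  exists, and maximality makes it a net.\<close>

lemma finite_net:
  fixes E :: "'a set"
  assumes "0 < \<epsilon>" "\<epsilon> \<le> 1" "bounded E"
  shows "\<exists>N. finite N \<and> N \<subseteq> E \<and> (\<forall>x\<in>N. \<forall>y\<in>N. x \<noteq> y \<longrightarrow> \<epsilon> < dist x y) \<and> (\<forall>x\<in>E. \<exists>y\<in>N. dist y x \<le> \<epsilon>)"
proof -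
  define P where "P N \<longleftrightarrow> finite N \<and> N \<subseteq> E \<and> (\<forall>x\<in>N. \<forall>y\<in>N. x \<noteq> y \<longrightarrow> \<epsilon> < dist x y)" for N
  obtain e R where R: "\<And>x. x \<in> E \<Longrightarrow> dist e x \<le> R" using \<open>bounded E\<close> unfolding bounded_def by blast
  define R' where "R' = \<bar>R\<bar> + 1"
  \<comment> \<open>With this \<open>n\<close>, the ball \<open>cball e (R' + 1)\<close> lies in the
    2^n-fold enlargement of the ball of radius \<epsilon>/2 about any point within R' of
    \<open>e\<close>.\<close>
  obtain n where n: "(2 * R' + 1) / (\<epsilon> / 2) < 2 ^ n" using real_arch_pow[of 2] by auto
  obtain D where D: "1 \<le> D" "\<And>x w r a. 0 < r \<Longrightarrow> r \<le> 1 \<Longrightarrow> dist x w + a \<le> 2 ^ n * r \<Longrightarrow>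
      emeasure \<mu> (cball x a) \<le> ennreal D * emeasure \<mu> (cball w r)"
    using doubling_iterate[of n] by auto
  have bound: "card N < Suc (nat \<lceil>D\<rceil>)" if "P N" for N
  proof -
    have "real (card N) \<le> D"
    proof (rule card_disjoint_balls_le[where x = "\<lambda>x. x" and r = "\<lambda>_. \<epsilon> / 2" and y = e and s = "R' + 1"])
      show "disjoint_family_on (\<lambda>i. cball i (\<epsilon> / 2)) N"
        unfolding disjoint_family_on_def
      proof (intro ballI impI)
        fix i j assume "i \<in> N" "j \<in> N" "i \<noteq> j"
        then have "\<epsilon> < dist i j" using \<open>P N\<close> by (simp add: P_def)
        then have "\<not> (dist i z \<le> \<epsilon> / 2 \<and> dist j z \<le> \<epsilon> / 2)" for z using dist_triangle2[of i j z] by linarith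
        then show "cball i (\<epsilon> / 2) \<inter> cball j (\<epsilon> / 2) = {}" by auto
      qed
      fix i assume "i \<in> N"
      then have i: "dist e i \<le> R'" using R[of i] \<open>P N\<close> by (auto simp: P_def R'_def)
      show "cball i (\<epsilon> / 2) \<subseteq> cball e (R' + 1)"
      proof
        fix z assume "z \<in> cball i (\<epsilon> / 2)"
        then show "z \<in> cball e (R' + 1)" using i assms dist_triangle[of e z i] by simp
      qed
      show "emeasure \<mu> (cball e (R' + 1)) \<le> ennreal D * emeasure \<mu> (cball i (\<epsilon> / 2))"
        using n i assms by (intro D(2)) (auto simp: field_simps)
    qed (use \<open>P N\<close> D in \<open>auto simp: P_def R'_def\<close>)
    then show ?thesis by linarith
  qed
  have "P {}" by (simp add: P_def)
  then obtain N where N: "P N" "\<And>M. P M \<Longrightarrow> card M \<le> card N"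
    using ex_has_greatest_nat[of P "{}" card "Suc (nat \<lceil>D\<rceil>)"] bound less_imp_le by metis
  have "\<exists>y\<in>N. dist y x \<le> \<epsilon>" if "x \<in> E" for x
  proof (rule ccontr)
    assume "\<not> ?thesis"
    then have far: "\<epsilon> < dist y x" if "y \<in> N" for y using that by (auto simp: not_le)
    then have "x \<notin> N" using assms by force
    have "P (insert x N)" using N(1) far \<open>x \<in> E\<close> by (auto simp: P_def dist_commute)
    then have "card (insert x N) \<le> card N" by (rule N(2))
    then show False using \<open>x \<notin> N\<close> N(1) by (simp add: P_def)
  qed
  then show ?thesis using N(1) unfolding P_def by (intro exI[of _ N]) simp
qed

section \<open>Comparison of the codimension-zero Hausdorff measure with
  \<open>\<mu>\<close>\<close>

lemma emeasure_le_Hcod_zero: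
  assumes "E \<in> sets borel"
  shows "emeasure \<mu> E \<le> Hcod \<mu> 0 E"
proof -
  have "emeasure \<mu> E \<le> Hcont \<mu> 0 1 E"
  proof (rule Hcont_greatest)
    fix I :: "nat set" and x :: "nat \<Rightarrow> 'a" and r
    assume cov: "E \<subseteq> (\<Union>i\<in>I. cball (x i) (r i))" and r: "\<And>i. i \<in> I \<Longrightarrow> 0 < r i \<and> r i < 1"
    define B where "B i = (if i \<in> I then cball (x i) (r i) else {})" for i
    have "E \<subseteq> (\<Union>i. B i)"
    proof
      fix y assume "y \<in> E"
      then obtain i where "i \<in> I" "y \<in> cball (x i) (r i)" using cov by blast
      then show "y \<in> (\<Union>i. B i)" by (intro UN_I[of i]) (simp_all add: B_def)
    qed
    then have "emeasure \<mu> E \<le> emeasure \<mu> (\<Union>i. B i)" by (intro emeasure_mono) (auto simp: B_def)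
    also have "\<dots> \<le> (\<Sum>i. emeasure \<mu> (B i))" by (intro emeasure_subadditive_countably) (auto simp: B_def)
    also have "\<dots> = (\<Sum>i. if i \<in> I then emeasure \<mu> (cball (x i) (r i)) * ennreal (r i powr - 0) else 0)"
    proof (rule suminf_cong)
      show "emeasure \<mu> (B i) = (if i \<in> I then emeasure \<mu> (cball (x i) (r i)) * ennreal (r i powr - 0) else 0)" for i
        using r[of i] by (cases "i \<in> I") (auto simp: B_def)
    qed
    finally show "emeasure \<mu> E \<le> (\<Sum>i. if i \<in> I then emeasure \<mu> (cball (x i) (r i)) * ennreal (r i powr - 0) else 0)" .
  qed
  also have "\<dots> \<le> Hcod \<mu> 0 E" by (rule Hcont_le_Hcod) simp
  finally show ?thesis .
qed

text \<open>A net of spacing \<epsilon> gives an admissible cover by \<epsilon>-balls at scale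
  \<delta>. The balls of half that radius are disjoint and stay in the \<epsilon>-neighbourhood, and
  one doubling returns to the full radius.\<close>

lemma Hcont_zero_le_neighbourhood:
  assumes D: "\<And>x r. 0 < r \<Longrightarrow> r \<le> 1 \<Longrightarrow> emeasure \<mu> (cball x (2 * r)) \<le> ennreal D * emeasure \<mu> (cball x r)"
    and \<epsilon>: "0 < \<epsilon>" "\<epsilon> \<le> 1" "\<epsilon> < \<delta>" and "bounded E"
  shows "Hcont \<mu> 0 \<delta> E \<le> ennreal D * emeasure \<mu> {y. infdist y E \<le> \<epsilon>}"
proof -
  obtain N where N: "finite N" "N \<subseteq> E" "\<forall>x\<in>N. \<forall>y\<in>N. x \<noteq> y \<longrightarrow> \<epsilon> < dist x y"
    "\<forall>x\<in>E. \<exists>y\<in>N. dist y x \<le> \<epsilon>"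
    using finite_net[OF \<epsilon>(1,2) \<open>bounded E\<close>] by (elim exE conjE)
  obtain h where h: "bij_betw h {..<card N} N"
    using ex_bij_betw_nat_finite[OF N(1)] by (auto simp: atLeast0LessThan)
  have "E \<subseteq> (\<Union>i\<in>{..<card N}. cball (h i) \<epsilon>)"
  proof
    fix x assume "x \<in> E"
    then obtain y where "y \<in> N" "dist y x \<le> \<epsilon>" using N(4) by blast
    moreover then obtain i where "i < card N" "h i = y"
      using h by (metis bij_betw_iff_bijections lessThan_iff)
    ultimately show "x \<in> (\<Union>i\<in>{..<card N}. cball (h i) \<epsilon>)" by (intro UN_I[of i]) simp_all
  qed
  then have "Hcont \<mu> 0 \<delta> E \<le> (\<Sum>i. if i \<in> {..<card N} then emeasure \<mu> (cball (h i) \<epsilon>) * ennreal (\<epsilon> powr - 0) else 0)"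
    using \<epsilon> by (intro Hcont_le) auto
  also have "\<dots> = (\<Sum>i<card N. emeasure \<mu> (cball (h i) \<epsilon>))"
    using \<epsilon> by (subst suminf_finite[of "{..<card N}"]) auto
  also have "\<dots> = (\<Sum>y\<in>N. emeasure \<mu> (cball y \<epsilon>))" by (rule sum.reindex_bij_betw[OF h])
  also have "\<dots> \<le> (\<Sum>y\<in>N. ennreal D * emeasure \<mu> (cball y (\<epsilon> / 2)))"
    using D[of "\<epsilon> / 2"] \<epsilon> by (intro sum_mono) simp
  also have "\<dots> = ennreal D * emeasure \<mu> (\<Union>y\<in>N. cball y (\<epsilon> / 2))"
  proof -
    have "disjoint_family_on (\<lambda>y. cball y (\<epsilon> / 2)) N"
      unfolding disjoint_family_on_def
    proof (intro ballI impI)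
      fix i j assume "i \<in> N" "j \<in> N" "i \<noteq> j"
      then have "\<epsilon> < dist i j" using N(3) by simp
      then have "\<not> (dist i z \<le> \<epsilon> / 2 \<and> dist j z \<le> \<epsilon> / 2)" for z using dist_triangle2[of i j z] by linarith
      then show "cball i (\<epsilon> / 2) \<inter> cball j (\<epsilon> / 2) = {}" by auto
    qed
    then show ?thesis
      using N(1) by (subst sum_emeasure[symmetric]) (auto simp: sum_distrib_left)
  qed
  also have "\<dots> \<le> ennreal D * emeasure \<mu> {y. infdist y E \<le> \<epsilon>}"
  proof (intro mult_left_mono emeasure_mono UN_least)
    show "{y. infdist y E \<le> \<epsilon>} \<in> sets \<mu>" by (simp add: borel_closed closed_Collect_le continuous_on_infdist)
    fix y assume "y \<in> N"
    then show "cball y (\<epsilon> / 2) \<subseteq> {y. infdist y E \<le> \<epsilon>}"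
      using N(2) \<epsilon> by (auto simp: dist_commute intro!: infdist_le2[of y])
  qed simp
  finally show ?thesis .
qed

text \<open>For fixed \<delta> the neighbourhoods in the previous bound shrink to the closed set E
  as \<epsilon> tends to 0; being bounded, they have finite measure, so continuity from above
  applies. The constant does not depend on \<delta>, which allows the supremum.\<close>

lemma Hcod_zero_le:
  "\<exists>D\<ge>1. \<forall>E. closed E \<and> bounded E \<longrightarrow> Hcod \<mu> 0 E \<le> ennreal D * emeasure \<mu> E"
proof -
  obtain D where D: "1 \<le> D" "\<And>x w r a. 0 < r \<Longrightarrow> r \<le> 1 \<Longrightarrow> dist x w + a \<le> 2 ^ 1 * r \<Longrightarrow>
      emeasure \<mu> (cball x a) \<le> ennreal D * emeasure \<mu> (cball w r)"
    using doubling_iterate[of 1] by auto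
  have "Hcod \<mu> 0 E \<le> ennreal D * emeasure \<mu> E" if E: "closed E" "bounded E" for E
  proof (cases "E = {}")
    case False
    obtain e R where R: "\<And>x. x \<in> E \<Longrightarrow> dist e x \<le> R" using \<open>bounded E\<close> unfolding bounded_def by blast
    show ?thesis
      unfolding Hcod_def
    proof (rule SUP_least)
      fix \<delta> :: real assume "\<delta> \<in> {0<..}"
      then have \<delta>: "0 < \<delta>" by simp
      \<comment> \<open>The minimum keeps every radius at most 1, where doubling is used, and
        strictly below \<delta>, as covers at scale \<delta> require.\<close>
      define \<epsilon> where "\<epsilon> n = min 1 (\<delta> / 2) / real (Suc n)" for n
      define A where "A n = {y. infdist y E \<le> \<epsilon> n}" for n
      have \<epsilon>: "0 < \<epsilon> n" "\<epsilon> n \<le> 1" "\<epsilon> n < \<delta>" for n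
        using \<delta> by (auto simp: \<epsilon>_def field_simps min_def) (smt (verit) mult_nonneg_nonneg of_nat_0_le_iff)+
      have \<epsilon>_lim: "\<epsilon> \<longlonglongrightarrow> 0"
        unfolding \<epsilon>_def using LIMSEQ_Suc[OF lim_const_over_n[of "min 1 (\<delta> / 2)"]] by simp
      have le: "Hcont \<mu> 0 \<delta> E \<le> ennreal D * emeasure \<mu> (A n)" for n
        unfolding A_def using D(2) \<epsilon> E by (intro Hcont_zero_le_neighbourhood) auto
      have "(\<lambda>n. emeasure \<mu> (A n)) \<longlonglongrightarrow> emeasure \<mu> (\<Inter>n. A n)"
      proof (rule Lim_emeasure_decseq)
        show "range A \<subseteq> sets \<mu>"
          by (auto simp: A_def intro!: borel_closed closed_Collect_le continuous_intros)
        have "\<epsilon> n \<le> \<epsilon> m" if "m \<le> n" for m n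
          unfolding \<epsilon>_def using that \<delta> by (intro divide_left_mono) auto
        then show "decseq A" by (force simp: decseq_def A_def)
        fix n
        have "A n \<subseteq> cball e (R + 2)"
        proof
          fix y assume "y \<in> A n"
          then have "infdist y E < 2" using \<epsilon>[of n] by (simp add: A_def)
          then obtain a where "a \<in> E" "dist y a < 2"
            using False by (auto simp: infdist_notempty cINF_less_iff)
          then show "y \<in> cball e (R + 2)" using R[of a] dist_triangle[of e y a] by (simp add: dist_commute)
        qed
        then have "emeasure \<mu> (A n) \<le> emeasure \<mu> (cball e (R + 2))" by (intro emeasure_mono) auto
        then show "emeasure \<mu> (A n) \<noteq> \<infinity>" using ball_finite[of e "R + 2"] by (auto simp: top_unique)
      qed
      moreover have "(\<Inter>n. A n) = E"
      proof (intro equalityI subsetI)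
        fix y assume "y \<in> (\<Inter>n. A n)"
        then have "infdist y E \<le> 0"
          by (intro LIMSEQ_le_const[OF \<epsilon>_lim]) (auto simp: A_def)
        then show "y \<in> E"
          using False E(1) infdist_nonneg[of y E] in_closed_iff_infdist_zero by fastforce
      next
        fix y assume "y \<in> E"
        then show "y \<in> (\<Inter>n. A n)" using \<epsilon> by (auto simp: A_def less_imp_le)
      qed
      ultimately have "(\<lambda>n. ennreal D * emeasure \<mu> (A n)) \<longlonglongrightarrow> ennreal D * emeasure \<mu> E"
        by (intro ennreal_tendsto_cmult) auto
      then show "Hcont \<mu> 0 \<delta> E \<le> ennreal D * emeasure \<mu> E"
        using le by (intro LIMSEQ_le_const) auto
    qed
  qed simp
  then show ?thesis using D(1) by (intro exI[of _ D]) simp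
qed

text \<open>The lower bound is solved for the mass of the ball, the form in which it is applied, and
  both bounds share one constant.\<close>

lemma ADR_bounds:
  assumes "ADR \<mu> \<theta> S"
  shows "\<exists>\<kappa>>0. \<forall>x\<in>S. \<forall>r. 0 < r \<and> r \<le> 1 \<longrightarrow>
    emeasure \<mu> (cball x r) \<le> ennreal (\<kappa> * r powr \<theta>) * Hcod \<mu> \<theta> (cball x r \<inter> S) \<and>
    Hcod \<mu> \<theta> (cball x r \<inter> S) \<le> ennreal (\<kappa> * r powr (-\<theta>)) * emeasure \<mu> (cball x r)"
proof -
  obtain \<kappa>1 \<kappa>2 where \<kappa>: "0 < \<kappa>1" "0 < \<kappa>2"
    and bd: "\<forall>x\<in>S. \<forall>r\<in>{0<..1}.
        ennreal \<kappa>1 * emeasure \<mu> (cball x r) * ennreal (r powr (-\<theta>)) \<le> Hcod \<mu> \<theta> (cball x r \<inter> S) \<and>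
        Hcod \<mu> \<theta> (cball x r \<inter> S) \<le> ennreal \<kappa>2 * emeasure \<mu> (cball x r) * ennreal (r powr (-\<theta>))"
    using assms unfolding ADR_def by (elim exE conjE)
  define \<kappa> where "\<kappa> = max (1 / \<kappa>1) \<kappa>2"
  have \<kappa>_pos: "0 < \<kappa>" using \<kappa> by (simp add: \<kappa>_def less_max_iff_disj)
  show ?thesis
  proof (intro exI[of _ \<kappa>] conjI ballI allI impI \<kappa>_pos)
    fix x and r :: real assume "x \<in> S" "0 < r \<and> r \<le> 1"
    then have r: "0 < r" and lo: "ennreal \<kappa>1 * emeasure \<mu> (cball x r) * ennreal (r powr (-\<theta>)) \<le> Hcod \<mu> \<theta> (cball x r \<inter> S)"
      and hi: "Hcod \<mu> \<theta> (cball x r \<inter> S) \<le> ennreal \<kappa>2 * emeasure \<mu> (cball x r) * ennreal (r powr (-\<theta>))"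
      using bd by auto
    have one: "1 / \<kappa>1 * r powr \<theta> * (\<kappa>1 * r powr (-\<theta>)) = 1"
      using \<kappa> r by (simp flip: powr_add)
    have "emeasure \<mu> (cball x r) =
        ennreal (1 / \<kappa>1 * r powr \<theta> * (\<kappa>1 * r powr (-\<theta>))) * emeasure \<mu> (cball x r)"
      unfolding one by simp
    also have "\<dots> = ennreal (1 / \<kappa>1 * r powr \<theta>) * (ennreal \<kappa>1 * emeasure \<mu> (cball x r) * ennreal (r powr (-\<theta>)))"
      using \<kappa> by (simp only: ennreal_mult ennreal_mult' powr_ge_zero mult_nonneg_nonneg divide_nonneg_pos zero_le_one less_imp_le mult_ac)
    also have "\<dots> \<le> ennreal (\<kappa> * r powr \<theta>) * Hcod \<mu> \<theta> (cball x r \<inter> S)"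
      by (intro mult_mono lo ennreal_leI mult_right_mono) (auto simp: \<kappa>_def)
    finally show "emeasure \<mu> (cball x r) \<le> ennreal (\<kappa> * r powr \<theta>) * Hcod \<mu> \<theta> (cball x r \<inter> S)" .
    have "ennreal \<kappa>2 * emeasure \<mu> (cball x r) * ennreal (r powr (-\<theta>)) =
        ennreal (\<kappa>2 * r powr (-\<theta>)) * emeasure \<mu> (cball x r)"
      using \<kappa> by (simp add: ennreal_mult mult_ac)
    also have "\<dots> \<le> ennreal (\<kappa> * r powr (-\<theta>)) * emeasure \<mu> (cball x r)"
      by (intro mult_right_mono ennreal_leI) (auto simp: \<kappa>_def)
    finally show "Hcod \<mu> \<theta> (cball x r \<inter> S) \<le> ennreal (\<kappa> * r powr (-\<theta>)) * emeasure \<mu> (cball x r)"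
      using hi by simp
  qed
qed

text \<open>The regularity of S is expressed by \<open>Hcod \<mu> 0\<close>, while
  \<open>mseq\<close> and \<open>sharp\<close> see S1 through \<open>\<mu>\<close>. The trace of a
  ball on S is closed and bounded, so the net estimate converts the lower bound.\<close>

lemma ADR_zero_emeasure:
  assumes "ADR \<mu> 0 S"
  shows "\<exists>\<kappa>>0. \<forall>x\<in>S. \<forall>r. 0 < r \<and> r \<le> 1 \<longrightarrow>
    emeasure \<mu> (cball x r) \<le> ennreal \<kappa> * emeasure \<mu> (cball x r \<inter> S)"
proof -
  obtain \<kappa> where \<kappa>: "0 < \<kappa>" "\<forall>x\<in>S. \<forall>r. 0 < r \<and> r \<le> 1 \<longrightarrow>
    emeasure \<mu> (cball x r) \<le> ennreal (\<kappa> * r powr 0) * Hcod \<mu> 0 (cball x r \<inter> S) \<and>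
    Hcod \<mu> 0 (cball x r \<inter> S) \<le> ennreal (\<kappa> * r powr (-0)) * emeasure \<mu> (cball x r)"
    using ADR_bounds[OF assms] by (elim exE conjE)
  obtain D where D: "1 \<le> D" "\<forall>E. closed E \<and> bounded E \<longrightarrow> Hcod \<mu> 0 E \<le> ennreal D * emeasure \<mu> E"
    using Hcod_zero_le by (elim exE conjE)
  show ?thesis
  proof (intro exI[of _ "\<kappa> * D"] conjI ballI allI impI)
    fix x and r :: real assume x: "x \<in> S" "0 < r \<and> r \<le> 1"
    have "closed (cball x r \<inter> S)" using assms by (auto simp: ADR_def)
    moreover have "bounded (cball x r \<inter> S)" by (simp add: bounded_Int)
    ultimately have "Hcod \<mu> 0 (cball x r \<inter> S) \<le> ennreal D * emeasure \<mu> (cball x r \<inter> S)" using D(2) by simp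
    then have "ennreal \<kappa> * Hcod \<mu> 0 (cball x r \<inter> S) \<le> ennreal \<kappa> * (ennreal D * emeasure \<mu> (cball x r \<inter> S))"
      by (intro mult_left_mono) auto
    moreover have "emeasure \<mu> (cball x r) \<le> ennreal \<kappa> * Hcod \<mu> 0 (cball x r \<inter> S)"
      using \<kappa>(2) x by auto
    ultimately show "emeasure \<mu> (cball x r) \<le> ennreal (\<kappa> * D) * emeasure \<mu> (cball x r \<inter> S)"
      using \<kappa>(1) D(1) by (simp add: ennreal_mult mult.assoc)
  qed (use \<kappa>(1) D(1) in simp)
qed

end

section \<open>Oscillation over a pair of regular sets\<close>

lemma kidx_bounds:
  assumes "0 < r" "r \<le> 1"
  shows "r \<le> 2 powr (- real (kidx r))" "2 powr (- real (kidx r)) \<le> 2 * r"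
proof -
  define t where "t = - log 2 r"
  have t0: "0 \<le> t" using assms unfolding t_def by (simp add: log_le_zero_cancel_iff)
  have tr: "2 powr (- t) = r" using assms unfolding t_def by (simp add: powr_log_cancel)
  have k: "real (kidx r) = of_int \<lfloor>t\<rfloor>" using t0 unfolding kidx_def t_def[symmetric] by (simp add: of_nat_nat)
  have "2 powr (- t) \<le> 2 powr (- of_int \<lfloor>t\<rfloor>)" by (rule powr_mono) auto
  then show "r \<le> 2 powr (- real (kidx r))" unfolding k tr .
  have "- of_int \<lfloor>t\<rfloor> \<le> 1 + (- t)" by linarith
  then have "2 powr (- of_int \<lfloor>t\<rfloor>) \<le> 2 powr (1 + (- t))" by (intro powr_mono) auto
  then show "2 powr (- real (kidx r)) \<le> 2 * r" unfolding powr_add k tr by simp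
qed

lemma ennreal_inverse_mult_le_iff:
  assumes "0 < K"
  shows "ennreal (1 / K) * a \<le> b \<longleftrightarrow> a \<le> ennreal K * b"
proof -
  have "ennreal K * (ennreal (1 / K) * a) = ennreal (K * (1 / K)) * a"
    using assms by (simp only: ennreal_mult less_imp_le zero_le_divide_1_iff mult.assoc)
  then have "ennreal K * (ennreal (1 / K) * a) = a" using assms by simp
  then show ?thesis
    using ennreal_mult_le_mult_iff[of "ennreal K" "ennreal (1 / K) * a" b] assms by (simp add: ennreal_eq_0_iff)
qed

text \<open>Once \<open>K\<close> is moved to the other side, the infimum in \<open>Osc\<close> is a
  plain greatest lower bound, so an estimate against every constant passes to it.\<close>

lemma le_Osc_iff:
  assumes "0 < K"
  shows "a \<le> ennreal K * Osc m f G \<longleftrightarrow> (\<forall>c. a \<le> ennreal K * Av m G (\<lambda>y. ennreal \<bar>f y - c\<bar>))"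
  unfolding ennreal_inverse_mult_le_iff[OF assms, symmetric] Osc_def le_INF_iff by simp

lemma sum_le_suminf_by_level:
  fixes t :: "'i \<Rightarrow> ennreal" and l :: "'i \<Rightarrow> nat"
  assumes "finite I" "\<And>k. (\<Sum>i\<in>{i \<in> I. l i = k}. t i) \<le> u k"
  shows "(\<Sum>i\<in>I. t i) \<le> (\<Sum>k. u k)"
proof -
  have "(\<Sum>i\<in>I. t i) = (\<Sum>k\<in>l ` I. \<Sum>i\<in>{i \<in> I. l i = k}. t i)"
    using assms(1) by (rule sum.image_gen)
  also have "\<dots> \<le> (\<Sum>k\<in>l ` I. u k)" by (intro sum_mono assms)
  also have "\<dots> \<le> (\<Sum>k. u k)" using assms(1) by (intro sum_le_suminf) auto
  finally show ?thesis .
qed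

lemma sum_overlap_le:
  assumes fin: "finite I" and ov: "\<And>w. real (card {i \<in> I. w \<in> G i}) \<le> D"
    and [measurable]: "\<And>i. i \<in> I \<Longrightarrow> G i \<in> sets m" "h \<in> borel_measurable m"
  shows "(\<Sum>i\<in>I. \<integral>\<^sup>+w\<in>G i. h w \<partial>m) \<le> ennreal D * (\<integral>\<^sup>+w. h w \<partial>m)"
proof -
  have "(\<Sum>i\<in>I. \<integral>\<^sup>+w\<in>G i. h w \<partial>m) = (\<integral>\<^sup>+w. (\<Sum>i\<in>I. h w * indicator (G i) w) \<partial>m)"
    by (subst nn_integral_sum) auto
  also have "\<dots> \<le> (\<integral>\<^sup>+w. ennreal D * h w \<partial>m)"
  proof (rule nn_integral_mono)
    fix w
    have "(\<Sum>i\<in>I. h w * indicator (G i) w) = h w * (\<Sum>i\<in>I. indicator (G i) w)" by (simp only: sum_distrib_left)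
    also have "(\<Sum>i\<in>I. indicator (G i) w) = (ennreal (real (card {i \<in> I. w \<in> G i})))"
      using fin by (simp add: indicator_def sum.If_cases Int_def ennreal_of_nat_eq_real_of_nat)
    also have "h w * ennreal (real (card {i \<in> I. w \<in> G i})) \<le> h w * ennreal D"
      using ov by (intro mult_left_mono ennreal_leI) auto
    finally show "(\<Sum>i\<in>I. h w * indicator (G i) w) \<le> ennreal D * h w" by (simp add: mult.commute)
  qed
  also have "\<dots> = ennreal D * (\<integral>\<^sup>+w. h w \<partial>m)" by (simp add: nn_integral_cmult)
  finally show ?thesis .
qed

text \<open>The constants are parameters so that all estimates share them: \<open>D\<close> compares balls at
  bounded relative distance and scale, \<open>\<kappa>\<close> collects the regularity constants of both sets.\<close>

locale regular_pair = doubling_measure \<mu> for \<mu> :: "'a::metric_space measure" +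
  fixes S1 S2 :: "'a set" and \<theta>2 c \<kappa> D :: real and s :: nat
  assumes closed_S1: "closed S1" and closed_S2: "closed S2"
    and c: "1 \<le> c" and s: "4 * c + 2 \<le> 2 ^ s" and D: "1 \<le> D" and \<kappa>: "1 \<le> \<kappa>" and \<theta>2: "0 < \<theta>2"
    and dbl: "\<And>x w r a. 0 < r \<Longrightarrow> r \<le> 1 \<Longrightarrow> dist x w + a \<le> 2 ^ (2 * s + 3) * r \<Longrightarrow>
      emeasure \<mu> (cball x a) \<le> ennreal D * emeasure \<mu> (cball w r)"
    and S1_lower: "\<And>y r. y \<in> S1 \<Longrightarrow> 0 < r \<Longrightarrow> r \<le> 1 \<Longrightarrow>
      emeasure \<mu> (cball y r) \<le> ennreal \<kappa> * emeasure \<mu> (cball y r \<inter> S1)"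
    and S1_upper: "\<And>y r. y \<in> S1 \<Longrightarrow> 0 < r \<Longrightarrow> r \<le> 1 \<Longrightarrow>
      Hcod \<mu> 0 (cball y r \<inter> S1) \<le> ennreal \<kappa> * emeasure \<mu> (cball y r)"
    and S2_lower: "\<And>z r. z \<in> S2 \<Longrightarrow> 0 < r \<Longrightarrow> r \<le> 1 \<Longrightarrow>
      emeasure \<mu> (cball z r) \<le> ennreal (\<kappa> * r powr \<theta>2) * Hcod \<mu> \<theta>2 (cball z r \<inter> S2)"
    and S2_upper: "\<And>z r. z \<in> S2 \<Longrightarrow> 0 < r \<Longrightarrow> r \<le> 1 \<Longrightarrow>
      Hcod \<mu> \<theta>2 (cball z r \<inter> S2) \<le> ennreal (\<kappa> * r powr (-\<theta>2)) * emeasure \<mu> (cball z r)"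
begin

lemma S_borel [measurable, simp]: "S1 \<in> sets borel" "S2 \<in> sets borel"
  using closed_S1 closed_S2 by (auto intro: borel_closed)

text \<open>The distance (2c+1)r is the reach of the sets E: a point of S1 or S2 within 2cr of
  \<open>x\<close>, plus r. The ball about \<open>w\<close> has to contain G, and (4c+2)r bounds the
  distance of two such points, which places the pair in the domain of the gluing integral. The
  radius \<open>\<rho>\<close> is dyadic because the Besov and gluing series contain only dyadic
  radii.\<close>

lemma near_ball:
  assumes r: "0 < r" "r \<le> 1" and w: "dist x w \<le> (2 * c + 1) * r"
  defines "\<rho> \<equiv> 2 powr (real s - real (kidx r))"
  shows "cball x (2 * (c * r)) \<subseteq> cball w \<rho>"
    and "(4 * c + 2) * r \<le> \<rho>" and "\<rho> \<le> 2 ^ (s + 1) * r"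
    and "emeasure \<mu> (cball w \<rho>) \<le> ennreal D * emeasure \<mu> (cball x r)"
    and "emeasure \<mu> (cball x (3 * ((2 * c + 1) * r))) \<le> ennreal D * emeasure \<mu> (cball w r)"
    and "emeasure \<mu> (cball x r) \<le> ennreal D * emeasure \<mu> (cball w r)"
proof -
  have \<rho>: "\<rho> = 2 ^ s * 2 powr (- real (kidx r))"
    unfolding \<rho>_def by (simp add: powr_diff powr_minus powr_realpow divide_inverse)
  have "(4 * c + 2) * r \<le> 2 ^ s * 2 powr (- real (kidx r))"
    using s r kidx_bounds(1)[OF r] by (intro mult_mono) auto
  then show 1: "(4 * c + 2) * r \<le> \<rho>" unfolding \<rho> .
  have "2 ^ s * 2 powr (- real (kidx r)) \<le> 2 ^ s * (2 * r)"
    using kidx_bounds(2)[OF r] by (intro mult_left_mono) auto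
  then show 2: "\<rho> \<le> 2 ^ (s + 1) * r" unfolding \<rho> by simp
  have sr: "(4 * c + 2) * r \<le> 2 ^ s * r" using s r by (intro mult_right_mono) auto
  have "2 ^ (s + 2) * r \<le> 2 ^ (2 * s + 3) * r"
    using r by (intro mult_right_mono power_increasing) auto
  then have big: "4 * (2 ^ s * r) \<le> 2 ^ (2 * s + 3) * r" by (simp add: power_add)
  have cr: "0 < c * r" using c r by simp
  show "cball x (2 * (c * r)) \<subseteq> cball w \<rho>"
  proof
    fix y assume "y \<in> cball x (2 * (c * r))"
    then show "y \<in> cball w \<rho>"
      using w 1 r dist_triangle[of w y x] by (simp add: dist_commute algebra_simps)
  qed
  have w': "dist x w \<le> 2 * (c * r) + r" and sr': "4 * (c * r) + 2 * r \<le> 2 ^ s * r"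
    and rho': "\<rho> \<le> 2 * (2 ^ s * r)"
    using w sr 2 by (simp_all add: algebra_simps)
  show "emeasure \<mu> (cball w \<rho>) \<le> ennreal D * emeasure \<mu> (cball x r)"
  proof (rule dbl[OF r])
    show "dist w x + \<rho> \<le> 2 ^ (2 * s + 3) * r"
      unfolding dist_commute[of w x] using w' sr' rho' big r(1) cr by linarith
  qed
  show "emeasure \<mu> (cball x (3 * ((2 * c + 1) * r))) \<le> ennreal D * emeasure \<mu> (cball w r)"
  proof (rule dbl[OF r])
    have "3 * ((2 * c + 1) * r) = 6 * (c * r) + 3 * r" by (simp add: algebra_simps)
    then show "dist x w + 3 * ((2 * c + 1) * r) \<le> 2 ^ (2 * s + 3) * r"
      using w' sr' big r(1) cr by linarith
  qed
  show "emeasure \<mu> (cball x r) \<le> ennreal D * emeasure \<mu> (cball w r)"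
  proof (rule dbl[OF r])
    show "dist x w + r \<le> 2 ^ (2 * s + 3) * r" using w' sr' big r(1) cr by linarith
  qed
qed

lemma S2_mass:
  assumes r: "0 < r" "r \<le> 1" and z: "z \<in> S2"
  shows "emeasure \<mu> (cball z r) \<le> ennreal (\<kappa> * 2 powr (- real (kidx r) * \<theta>2)) * Hcod \<mu> \<theta>2 (cball z r \<inter> S2)"
proof -
  have "r powr \<theta>2 \<le> (2 powr (- real (kidx r))) powr \<theta>2"
    using kidx_bounds(1)[OF r] r \<theta>2 by (intro powr_mono2) auto
  then have "r powr \<theta>2 \<le> 2 powr (- real (kidx r) * \<theta>2)" by (simp add: powr_powr)
  then have "ennreal (\<kappa> * r powr \<theta>2) \<le> ennreal (\<kappa> * 2 powr (- real (kidx r) * \<theta>2))"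
    using \<kappa> by (intro ennreal_leI mult_left_mono) auto
  then show ?thesis
    using S2_lower[OF z r] by (meson mult_right_mono order_trans zero_le)
qed

text \<open>The \<open>c\<close>-fold ball meets S1 or S2 at some \<open>y\<close>, and since r
  \<le> cr the ball of radius r about \<open>y\<close> lies in G. Lower regularity at
  \<open>y\<close> then bounds the mass of G from below; on S2 the weight 2^(k(\<theta>-\<theta>2))
  matches the power coming from codimension \<theta>2.\<close>

lemma mseq_mass:
  assumes r: "0 < r" "r \<le> 1" and meet: "cball x (c * r) \<inter> (S1 \<union> S2) \<noteq> {}"
  shows "ennreal (2 powr (real (kidx r) * \<theta>)) * emeasure \<mu> (cball x r) \<le>
    ennreal (D * \<kappa>) * emeasure (mseq \<mu> \<theta> \<theta>2 S1 S2 (kidx r)) (cball x (2 * (c * r)))"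
proof -
  define k where "k = kidx r"
  define G where "G = cball x (2 * (c * r))"
  have cr: "r \<le> c * r" using c r by simp
  have em: "emeasure (mseq \<mu> \<theta> \<theta>2 S1 S2 k) G =
      ennreal (2 powr (real k * \<theta>)) * emeasure \<mu> (G \<inter> S1) +
      ennreal (2 powr (real k * (\<theta> - \<theta>2))) * Hcod \<mu> \<theta>2 (G \<inter> S2)"
    by (simp add: emeasure_mseq emeasure_restr emeasure_Hm G_def)
  obtain y where "y \<in> cball x (c * r) \<inter> (S1 \<union> S2)" using meet by blast
  then have y: "y \<in> S1 \<union> S2" "dist x y \<le> c * r" by simp_all
  have sub: "cball y r \<subseteq> G"
  proof
    fix z assume "z \<in> cball y r"
    then show "z \<in> G" unfolding G_def using y cr dist_triangle[of x z y] by simp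
  qed
  have near: "emeasure \<mu> (cball x r) \<le> ennreal D * emeasure \<mu> (cball y r)"
  proof (rule near_ball(6)[OF r])
    have "(2 * c + 1) * r = 2 * (c * r) + r" by (simp add: algebra_simps)
    then show "dist x y \<le> (2 * c + 1) * r" using y(2) r(1) cr by linarith
  qed
  show ?thesis
  proof (cases "y \<in> S1")
    case True
    have "emeasure \<mu> (cball y r) \<le> ennreal \<kappa> * emeasure \<mu> (G \<inter> S1)"
    proof -
      have "emeasure \<mu> (cball y r \<inter> S1) \<le> emeasure \<mu> (G \<inter> S1)"
        using sub by (intro emeasure_mono) (auto simp: G_def)
      then show ?thesis using S1_lower[OF True r] by (meson mult_left_mono order_trans zero_le)
    qed
    then have "emeasure \<mu> (cball x r) \<le> ennreal D * (ennreal \<kappa> * emeasure \<mu> (G \<inter> S1))"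
      using near by (meson mult_left_mono order_trans zero_le)
    then have "ennreal (2 powr (real k * \<theta>)) * emeasure \<mu> (cball x r) \<le>
        ennreal (2 powr (real k * \<theta>)) * (ennreal D * (ennreal \<kappa> * emeasure \<mu> (G \<inter> S1)))"
      by (intro mult_left_mono) auto
    also have "\<dots> = ennreal (D * \<kappa>) * (ennreal (2 powr (real k * \<theta>)) * emeasure \<mu> (G \<inter> S1))"
      using D \<kappa> by (simp add: ennreal_mult mult_ac)
    also have "\<dots> \<le> ennreal (D * \<kappa>) * emeasure (mseq \<mu> \<theta> \<theta>2 S1 S2 k) G"
      unfolding em by (intro mult_left_mono) auto
    finally show ?thesis by (simp add: k_def G_def)
  next
    case False
    then have "y \<in> S2" using y by simp
    have "emeasure \<mu> (cball y r) \<le> ennreal (\<kappa> * 2 powr (- real k * \<theta>2)) * Hcod \<mu> \<theta>2 (G \<inter> S2)"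
    proof -
      have "Hcod \<mu> \<theta>2 (cball y r \<inter> S2) \<le> Hcod \<mu> \<theta>2 (G \<inter> S2)" using sub by (intro Hcod_mono) auto
      then show ?thesis
        using S2_mass[OF r \<open>y \<in> S2\<close>] unfolding k_def by (meson mult_left_mono order_trans zero_le)
    qed
    then have "emeasure \<mu> (cball x r) \<le>
        ennreal D * (ennreal (\<kappa> * 2 powr (- real k * \<theta>2)) * Hcod \<mu> \<theta>2 (G \<inter> S2))"
      using near by (meson mult_left_mono order_trans zero_le)
    then have "ennreal (2 powr (real k * \<theta>)) * emeasure \<mu> (cball x r) \<le>
        ennreal (2 powr (real k * \<theta>)) * (ennreal D * (ennreal (\<kappa> * 2 powr (- real k * \<theta>2)) * Hcod \<mu> \<theta>2 (G \<inter> S2)))"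
      by (intro mult_left_mono) auto
    also have "\<dots> = ennreal (D * \<kappa>) * (ennreal (2 powr (real k * (\<theta> - \<theta>2))) * Hcod \<mu> \<theta>2 (G \<inter> S2))"
    proof -
      have pw: "2 powr (real k * (\<theta> - \<theta>2)) = 2 powr (real k * \<theta>) * 2 powr (- real k * \<theta>2)"
        by (simp add: powr_add[symmetric] algebra_simps)
      show ?thesis unfolding pw using D \<kappa> by (simp add: ennreal_mult mult_ac)
    qed
    also have "\<dots> \<le>
        ennreal (D * \<kappa>) * emeasure (mseq \<mu> \<theta> \<theta>2 S1 S2 k) G"
      unfolding em by (intro mult_left_mono) auto
    finally show ?thesis by (simp add: k_def G_def)
  qed
qed

text \<open>The integral over G against \<open>mseq\<close> at level k after division by
  2^(k\<theta>). This factor cancels in every average, so the constants below do not involve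
  \<theta>.\<close>

definition scaled_integral :: "nat \<Rightarrow> 'a set \<Rightarrow> ('a \<Rightarrow> ennreal) \<Rightarrow> ennreal" where
  "scaled_integral k G g = (\<integral>\<^sup>+y\<in>G. g y \<partial>restr \<mu> S1) +
     ennreal (2 powr (- real k * \<theta>2)) * (\<integral>\<^sup>+y\<in>G. g y \<partial>Hm \<mu> \<theta>2 S2)"

lemma mseq_Av_le:
  assumes r: "0 < r" "r \<le> 1" and meet: "cball x (c * r) \<inter> (S1 \<union> S2) \<noteq> {}"
    and [measurable]: "g \<in> borel_measurable borel"
  shows "emeasure \<mu> (cball x r) * Av (mseq \<mu> \<theta> \<theta>2 S1 S2 (kidx r)) (cball x (2 * (c * r))) g \<le>
    ennreal (D * \<kappa>) * scaled_integral (kidx r) (cball x (2 * (c * r))) g"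
proof -
  define k where "k = kidx r"
  define G where "G = cball x (2 * (c * r))"
  define m where "m = mseq \<mu> \<theta> \<theta>2 S1 S2 k"
  define q where "q = ennreal (2 powr (real k * \<theta>))"
  have [measurable]: "G \<in> sets borel" by (simp add: G_def)
  have sets_m: "sets m = sets borel" by (simp add: m_def sets_mseq)
  have q: "q \<noteq> 0" "q \<noteq> top" by (auto simp: q_def)
  have int: "(\<integral>\<^sup>+y\<in>G. g y \<partial>m) = q * scaled_integral k G g"
  proof -
    have "2 powr (real k * (\<theta> - \<theta>2)) = 2 powr (real k * \<theta>) * 2 powr (- real k * \<theta>2)"
      by (simp add: powr_add[symmetric] algebra_simps)
    then show ?thesis
      unfolding m_def scaled_integral_def q_def
      by (subst nn_integral_mseq) (auto simp: distrib_left ennreal_mult mult.assoc)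
  qed
  have mass: "q * emeasure \<mu> (cball x r) \<le> ennreal (D * \<kappa>) * emeasure m G"
    using mseq_mass[OF r meet, of \<theta>] by (simp add: q_def m_def k_def G_def)
  show ?thesis
  proof (cases "emeasure m G = top")
    case True
    \<comment> \<open>Division by an infinite mass makes the average 0.\<close>
    then show ?thesis by (simp add: Av_def m_def k_def G_def)
  next
    case False
    then have "Av m G g * emeasure m G = q * scaled_integral k G g"
      using int sets_m by (subst set_nn_integral_eq_Av[symmetric]) (auto simp: less_top)
    have "q * (emeasure \<mu> (cball x r) * Av m G g) = q * emeasure \<mu> (cball x r) * Av m G g"
      by (simp add: mult.assoc)
    also have "\<dots> \<le> ennreal (D * \<kappa>) * emeasure m G * Av m G g"
      using mass by (rule mult_right_mono) simp
    also have "\<dots> = ennreal (D * \<kappa>) * (Av m G g * emeasure m G)" by (simp add: mult_ac)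
    also have "\<dots> = q * (ennreal (D * \<kappa>) * scaled_integral k G g)"
      unfolding \<open>Av m G g * emeasure m G = q * scaled_integral k G g\<close> by (simp add: mult_ac)
    finally have "emeasure \<mu> (cball x r) * Av m G g \<le> ennreal (D * \<kappa>) * scaled_integral k G g"
      using q by (simp add: ennreal_mult_le_mult_iff)
    then show ?thesis by (simp add: m_def k_def G_def)
  qed
qed

text \<open>Every \<open>b\<close> competes in the oscillation, so each case below only has to bound
  the scaled integral, for a suitable constant, by the mass of B times the wanted quantity.
  Cancelling that mass uses that it is positive and finite.\<close>

lemma mseq_Osc_le:
  assumes r: "0 < r" "r \<le> 1" and meet: "cball x (c * r) \<inter> (S1 \<union> S2) \<noteq> {}"
    and [measurable]: "f \<in> borel_measurable borel" and K: "0 \<le> K"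
    and le: "scaled_integral (kidx r) (cball x (2 * (c * r))) (\<lambda>y. ennreal \<bar>f y - b\<bar>) \<le>
      ennreal K * emeasure \<mu> (cball x r) * a"
  shows "Osc (mseq \<mu> \<theta> \<theta>2 S1 S2 (kidx r)) f (cball x (2 * (c * r))) \<le> ennreal (D * \<kappa> * K) * a"
proof -
  let ?m = "mseq \<mu> \<theta> \<theta>2 S1 S2 (kidx r)" and ?G = "cball x (2 * (c * r))"
  have "emeasure \<mu> (cball x r) * Osc ?m f ?G \<le>
      emeasure \<mu> (cball x r) * Av ?m ?G (\<lambda>y. ennreal \<bar>f y - b\<bar>)"
    unfolding Osc_def by (intro mult_left_mono INF_lower) auto
  also have "\<dots> \<le> ennreal (D * \<kappa>) * scaled_integral (kidx r) ?G (\<lambda>y. ennreal \<bar>f y - b\<bar>)"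
    by (intro mseq_Av_le r meet) measurable
  also have "\<dots> \<le> ennreal (D * \<kappa>) * (ennreal K * emeasure \<mu> (cball x r) * a)"
    by (intro mult_left_mono le) simp
  also have "\<dots> = emeasure \<mu> (cball x r) * (ennreal (D * \<kappa> * K) * a)"
    using D \<kappa> K by (simp add: ennreal_mult mult_ac)
  finally show ?thesis
    using ball_pos[OF r(1), of x] ball_finite[of x r] by (subst (asm) ennreal_mult_le_mult_iff) auto
qed

section \<open>Oscillation at small radii: near one set and near both\<close>

lemma small_scale:
  assumes "s < kidx r"
  shows "2 powr (real s - real (kidx r)) \<le> 1" "0 < 2 powr (real s - real (kidx r))"
proof -
  have "2 powr (real s - real (kidx r)) \<le> 2 powr (0::real)" using assms by (intro powr_mono) auto
  then show "2 powr (real s - real (kidx r)) \<le> 1" by simp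
qed simp

lemma S2_upper_near:
  assumes r: "0 < r" "r \<le> 1" "s < kidx r" and z: "z \<in> S2" "dist x z \<le> (2 * c + 1) * r"
  shows "ennreal (2 powr (- real (kidx r) * \<theta>2)) * Hcod \<mu> \<theta>2 (cball z (2 powr (real s - real (kidx r))) \<inter> S2)
    \<le> ennreal (\<kappa> * D) * emeasure \<mu> (cball x r)"
proof -
  define \<rho> where "\<rho> = 2 powr (real s - real (kidx r))"
  \<comment> \<open>At radius 2^(s-k) the codimension power \<rho>^(-\<theta>2) and the weight
    2^(-k\<theta>2) cancel up to 2^(-s\<theta>2), which is at most 1.\<close>
  have pw: "2 powr (- real (kidx r) * \<theta>2) * \<rho> powr (-\<theta>2) \<le> 1"
  proof -
    have "2 powr (- real (kidx r) * \<theta>2) * \<rho> powr (-\<theta>2) = 2 powr (- real s * \<theta>2)"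
      unfolding \<rho>_def by (simp add: powr_powr powr_add[symmetric] algebra_simps)
    also have "\<dots> \<le> 2 powr 0" using \<theta>2 by (intro powr_mono) auto
    finally show ?thesis by simp
  qed
  have "ennreal (2 powr (- real (kidx r) * \<theta>2)) * Hcod \<mu> \<theta>2 (cball z \<rho> \<inter> S2) \<le>
      ennreal (2 powr (- real (kidx r) * \<theta>2)) * (ennreal (\<kappa> * \<rho> powr (-\<theta>2)) * emeasure \<mu> (cball z \<rho>))"
    using small_scale[OF r(3)] z(1) by (intro mult_left_mono S2_upper) (auto simp: \<rho>_def)
  also have "\<dots> = ennreal (\<kappa> * (2 powr (- real (kidx r) * \<theta>2) * \<rho> powr (-\<theta>2))) * emeasure \<mu> (cball z \<rho>)"
    using \<kappa> by (simp add: ennreal_mult mult_ac)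
  also have "\<dots> \<le> ennreal (\<kappa> * 1) * (ennreal D * emeasure \<mu> (cball x r))"
    using near_ball(4)[OF r(1,2) z(2)] \<kappa> pw by (intro mult_mono ennreal_leI mult_left_mono) (auto simp: \<rho>_def)
  also have "\<dots> = ennreal (\<kappa> * D) * emeasure \<mu> (cball x r)"
    using \<kappa> D by (simp add: ennreal_mult mult_ac)
  finally show ?thesis by (simp add: \<rho>_def)
qed

text \<open>G misses S2, so only the integral over S1 is left, and it grows when G is replaced by
  the ball about \<open>y\<close>. That ball has mass at most D times that of B. The bound holds for
  every \<open>y\<close> within reach of B, which makes the right-hand side a majorant on all of
  E.\<close>

lemma Osc_le_S1:
  assumes r: "0 < r" "r \<le> 1" and meet: "cball x (c * r) \<inter> (S1 \<union> S2) \<noteq> {}"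
    and miss: "cball x (2 * (c * r)) \<inter> S2 = {}"
    and [measurable]: "f \<in> borel_measurable borel"
    and y: "dist x y \<le> (2 * c + 1) * r"
  shows "Osc (mseq \<mu> \<theta> \<theta>2 S1 S2 (kidx r)) f (cball x (2 * (c * r))) \<le>
    ennreal (D * \<kappa> * D) * Osc (restr \<mu> S1) f (cball y (2 powr (real s - real (kidx r))))"
proof -
  define \<rho> where "\<rho> = 2 powr (real s - real (kidx r))"
  let ?G = "cball x (2 * (c * r))"
  have pos: "0 < D * \<kappa> * D" using D \<kappa> by simp
  have "Osc (mseq \<mu> \<theta> \<theta>2 S1 S2 (kidx r)) f ?G \<le>
      ennreal (D * \<kappa> * D) * Av (restr \<mu> S1) (cball y \<rho>) (\<lambda>w. ennreal \<bar>f w - b\<bar>)" for b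
  proof (rule mseq_Osc_le[OF r meet])
    let ?g = "\<lambda>w. ennreal \<bar>f w - b\<bar>"
    have "?G \<in> null_sets (Hm \<mu> \<theta>2 S2)" using miss by (auto simp: null_sets_def emeasure_Hm)
    then have zero: "(\<integral>\<^sup>+w\<in>?G. ?g w \<partial>Hm \<mu> \<theta>2 S2) = 0" by (rule nn_integral_null_set)
    have le: "emeasure (restr \<mu> S1) (cball y \<rho>) \<le> ennreal D * emeasure \<mu> (cball x r)"
    proof -
      have "emeasure (restr \<mu> S1) (cball y \<rho>) \<le> emeasure \<mu> (cball y \<rho>)"
        by (subst emeasure_restr) (auto intro: emeasure_mono)
      then show ?thesis using near_ball(4)[OF r y] unfolding \<rho>_def by (rule order_trans)
    qed
    then have fin: "emeasure (restr \<mu> S1) (cball y \<rho>) < top"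
      using ball_finite[of x r] by (auto intro: le_less_trans simp: ennreal_mult_less_top)
    have "(\<integral>\<^sup>+w\<in>?G. ?g w \<partial>restr \<mu> S1) \<le> (\<integral>\<^sup>+w\<in>cball y \<rho>. ?g w \<partial>restr \<mu> S1)"
      using near_ball(1)[OF r y] unfolding \<rho>_def by (intro nn_integral_mono) (auto split: split_indicator)
    also have "\<dots> = Av (restr \<mu> S1) (cball y \<rho>) ?g * emeasure (restr \<mu> S1) (cball y \<rho>)"
      using fin by (intro set_nn_integral_eq_Av) auto
    also have "\<dots> \<le> Av (restr \<mu> S1) (cball y \<rho>) ?g * (ennreal D * emeasure \<mu> (cball x r))"
      by (intro mult_left_mono le) simp
    finally show "scaled_integral (kidx r) ?G ?g \<le>
        ennreal D * emeasure \<mu> (cball x r) * Av (restr \<mu> S1) (cball y \<rho>) ?g"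
      unfolding scaled_integral_def zero by (simp add: mult_ac)
  qed (use D in auto)
  then show ?thesis unfolding le_Osc_iff[OF pos] \<rho>_def by blast
qed

text \<open>The radius \<rho> is admissible in \<open>sharp\<close> and at most 2^(s+1) r, so the
  factor \<rho> gained from \<open>sharp\<close> cancels the negative power of r in the
  functional.\<close>

lemma sharp_term_le:
  assumes r: "0 < r" "r \<le> 1" "s < kidx r" and meet: "cball x (c * r) \<inter> (S1 \<union> S2) \<noteq> {}"
    and miss: "cball x (2 * (c * r)) \<inter> S2 = {}" and p: "0 < p"
    and f: "f \<in> borel_measurable borel"
    and y: "dist x y \<le> (2 * c + 1) * r"
  shows "ennreal (r powr (-p)) * enn_rpow (Osc (mseq \<mu> \<theta> \<theta>2 S1 S2 (kidx r)) f (cball x (2 * (c * r)))) p \<le>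
    ennreal ((D * \<kappa> * D * 2 ^ (s + 1)) powr p) * enn_rpow (sharp \<mu> S1 f y) p"
proof -
  define \<rho> where "\<rho> = 2 powr (real s - real (kidx r))"
  define O' where "O' = Osc (mseq \<mu> \<theta> \<theta>2 S1 S2 (kidx r)) f (cball x (2 * (c * r)))"
  define K where "K = D * \<kappa> * D * 2 ^ (s + 1)"
  have \<rho>: "0 < \<rho>" "\<rho> \<le> 2" using small_scale[OF r(3)] by (auto simp: \<rho>_def)
  have K: "0 < K" using D \<kappa> by (simp add: K_def)
  have "ennreal (1 / \<rho>) * Osc (restr \<mu> S1) f (cball y \<rho>) \<le> sharp \<mu> S1 f y"
    unfolding sharp_def by (rule SUP_upper) (use \<rho> in auto)
  then have sh: "Osc (restr \<mu> S1) f (cball y \<rho>) \<le> ennreal \<rho> * sharp \<mu> S1 f y"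
    by (simp only: ennreal_inverse_mult_le_iff[OF \<rho>(1)])
  have "O' \<le> ennreal (D * \<kappa> * D) * Osc (restr \<mu> S1) f (cball y \<rho>)"
    unfolding O'_def \<rho>_def by (rule Osc_le_S1[OF r(1,2) meet miss f y])
  also have "\<dots> \<le> ennreal (D * \<kappa> * D) * (ennreal \<rho> * sharp \<mu> S1 f y)"
    by (intro mult_left_mono sh) simp
  also have "\<dots> \<le> ennreal (D * \<kappa> * D) * (ennreal (2 ^ (s + 1) * r) * sharp \<mu> S1 f y)"
    using near_ball(3)[OF r(1,2) y] unfolding \<rho>_def by (intro mult_left_mono mult_right_mono ennreal_leI) auto
  also have "\<dots> = ennreal (K * r) * sharp \<mu> S1 f y"
    unfolding K_def using D \<kappa> r by (simp add: ennreal_mult mult_ac)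
  finally have "enn_rpow O' p \<le> enn_rpow (ennreal (K * r) * sharp \<mu> S1 f y) p"
    using p by (intro enn_rpow_mono) auto
  also have "\<dots> = ennreal (K powr p * r powr p) * enn_rpow (sharp \<mu> S1 f y) p"
    using p K r by (simp add: enn_rpow_mult powr_mult)
  finally have "ennreal (r powr (-p)) * enn_rpow O' p \<le>
      ennreal (r powr (-p)) * (ennreal (K powr p * r powr p) * enn_rpow (sharp \<mu> S1 f y) p)"
    by (intro mult_left_mono) auto
  also have "\<dots> = ennreal (r powr (-p) * (K powr p * r powr p)) * enn_rpow (sharp \<mu> S1 f y) p"
    by (simp add: ennreal_mult mult.assoc)
  also have "\<dots> = ennreal (K powr p) * enn_rpow (sharp \<mu> S1 f y) p"
  proof -
    have "r powr (-p) * (K powr p * r powr p) = K powr p" using r by (simp add: powr_minus)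
    then show ?thesis by (simp only:)
  qed
  finally show ?thesis by (simp only: O'_def K_def)
qed

text \<open>As on S1, but the point must lie in S2: upper regularity controls the Hausdorff mass of
  balls centred there, and it also supplies the finiteness that balls have under
  \<open>\<mu>\<close>.\<close>

lemma Osc_le_S2:
  assumes r: "0 < r" "r \<le> 1" "s < kidx r" and meet: "cball x (c * r) \<inter> (S1 \<union> S2) \<noteq> {}"
    and miss: "cball x (2 * (c * r)) \<inter> S1 = {}"
    and [measurable]: "f \<in> borel_measurable borel"
    and z: "z \<in> S2" "dist x z \<le> (2 * c + 1) * r"
  shows "Osc (mseq \<mu> \<theta> \<theta>2 S1 S2 (kidx r)) f (cball x (2 * (c * r))) \<le>
    ennreal (D * \<kappa> * (\<kappa> * D)) * Osc (Hm \<mu> \<theta>2 S2) f (cball z (2 powr (real s - real (kidx r))))"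
proof -
  define \<rho> where "\<rho> = 2 powr (real s - real (kidx r))"
  define q where "q = ennreal (2 powr (- real (kidx r) * \<theta>2))"
  let ?G = "cball x (2 * (c * r))"
  have pos: "0 < D * \<kappa> * (\<kappa> * D)" using D \<kappa> by simp
  have upper: "q * emeasure (Hm \<mu> \<theta>2 S2) (cball z \<rho>) \<le> ennreal (\<kappa> * D) * emeasure \<mu> (cball x r)"
    using S2_upper_near[OF r z] by (simp add: emeasure_Hm q_def \<rho>_def)
  have fin: "emeasure (Hm \<mu> \<theta>2 S2) (cball z \<rho>) < top"
  proof -
    have "Hcod \<mu> \<theta>2 (cball z \<rho> \<inter> S2) \<le> ennreal (\<kappa> * \<rho> powr (-\<theta>2)) * emeasure \<mu> (cball z \<rho>)"
      using small_scale[OF r(3)] z(1) by (intro S2_upper) (auto simp: \<rho>_def)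
    also have "\<dots> < top" using ball_finite[of z \<rho>] by (simp add: ennreal_mult_less_top)
    finally show ?thesis by (simp add: emeasure_Hm)
  qed
  have "Osc (mseq \<mu> \<theta> \<theta>2 S1 S2 (kidx r)) f ?G \<le>
      ennreal (D * \<kappa> * (\<kappa> * D)) * Av (Hm \<mu> \<theta>2 S2) (cball z \<rho>) (\<lambda>w. ennreal \<bar>f w - b\<bar>)" for b
  proof (rule mseq_Osc_le[OF r(1,2) meet])
    let ?g = "\<lambda>w. ennreal \<bar>f w - b\<bar>"
    have "?G \<in> null_sets (restr \<mu> S1)" using miss by (auto simp: null_sets_def emeasure_restr)
    then have zero: "(\<integral>\<^sup>+w\<in>?G. ?g w \<partial>restr \<mu> S1) = 0" by (rule nn_integral_null_set)
    have "(\<integral>\<^sup>+w\<in>?G. ?g w \<partial>Hm \<mu> \<theta>2 S2) \<le> (\<integral>\<^sup>+w\<in>cball z \<rho>. ?g w \<partial>Hm \<mu> \<theta>2 S2)"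
      using near_ball(1)[OF r(1,2) z(2)] unfolding \<rho>_def by (intro nn_integral_mono) (auto split: split_indicator)
    also have "\<dots> = Av (Hm \<mu> \<theta>2 S2) (cball z \<rho>) ?g * emeasure (Hm \<mu> \<theta>2 S2) (cball z \<rho>)"
      using fin by (intro set_nn_integral_eq_Av) auto
    finally have "q * (\<integral>\<^sup>+w\<in>?G. ?g w \<partial>Hm \<mu> \<theta>2 S2) \<le>
        q * (Av (Hm \<mu> \<theta>2 S2) (cball z \<rho>) ?g * emeasure (Hm \<mu> \<theta>2 S2) (cball z \<rho>))"
      by (intro mult_left_mono) auto
    also have "\<dots> = Av (Hm \<mu> \<theta>2 S2) (cball z \<rho>) ?g * (q * emeasure (Hm \<mu> \<theta>2 S2) (cball z \<rho>))"
      by (simp only: mult_ac)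
    also have "\<dots> \<le> Av (Hm \<mu> \<theta>2 S2) (cball z \<rho>) ?g * (ennreal (\<kappa> * D) * emeasure \<mu> (cball x r))"
      by (intro mult_left_mono upper) simp
    finally show "scaled_integral (kidx r) ?G ?g \<le>
        ennreal (\<kappa> * D) * emeasure \<mu> (cball x r) * Av (Hm \<mu> \<theta>2 S2) (cball z \<rho>) ?g"
      unfolding scaled_integral_def zero q_def by (simp add: mult_ac)
  qed (use D \<kappa> in auto)
  then show ?thesis unfolding le_Osc_iff[OF pos] \<rho>_def by blast
qed

text \<open>The average A_k(f)(y,z) of the gluing functional for the pair (S1, S2), with \<rho> in
  place of 2^(-k).\<close>

definition gluing_average :: "('a \<Rightarrow> real) \<Rightarrow> real \<Rightarrow> 'a \<Rightarrow> 'a \<Rightarrow> ennreal" where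
  "gluing_average f \<rho> y z = Av (Hm \<mu> 0 UNIV) (cball y \<rho> \<inter> S1)
     (\<lambda>y'. Av (Hm \<mu> \<theta>2 UNIV) (cball z \<rho> \<inter> S2) (\<lambda>z'. ennreal \<bar>f y' - f z'\<bar>))"

text \<open>On both sets the weighted integral of |f - b| is at most the average times a mass of
  order that of B. The common constant costs twice the gluing average on S1 and once on S2, whence
  the factor 3.\<close>

lemma Osc_le_gluing_average:
  assumes r: "0 < r" "r \<le> 1" "s < kidx r" and meet: "cball x (c * r) \<inter> (S1 \<union> S2) \<noteq> {}"
    and [measurable]: "f \<in> borel_measurable borel"
    and y: "y \<in> S1" "dist x y \<le> (2 * c + 1) * r"
    and z: "z \<in> S2" "dist x z \<le> (2 * c + 1) * r"
  shows "Osc (mseq \<mu> \<theta> \<theta>2 S1 S2 (kidx r)) f (cball x (2 * (c * r))) \<le>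
    ennreal (D * \<kappa> * (3 * (\<kappa> * D))) * gluing_average f (2 powr (real s - real (kidx r))) y z"
proof -
  define \<rho> where "\<rho> = 2 powr (real s - real (kidx r))"
  define q where "q = ennreal (2 powr (- real (kidx r) * \<theta>2))"
  define G where "G = cball x (2 * (c * r))"
  define G1 where "G1 = cball y \<rho> \<inter> S1"
  define G2 where "G2 = cball z \<rho> \<inter> S2"
  define O' where "O' = Osc (mseq \<mu> \<theta> \<theta>2 S1 S2 (kidx r)) f G"
  define v where "v = ennreal (\<kappa> * D) * emeasure \<mu> (cball x r)"
  have [measurable]: "G \<in> sets borel" "G1 \<in> sets borel" "G2 \<in> sets borel" by (auto simp: G_def G1_def G2_def)
  have \<rho>: "0 < \<rho>" "\<rho> \<le> 1" using small_scale[OF r(3)] by (auto simp: \<rho>_def)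
  have sub: "G \<inter> S1 \<subseteq> G1" "G \<inter> S2 \<subseteq> G2"
    using near_ball(1)[OF r(1,2) y(2)] near_ball(1)[OF r(1,2) z(2)]
    by (auto simp: G_def G1_def G2_def \<rho>_def)
  have em: "emeasure (Hm \<mu> 0 UNIV) G1 = Hcod \<mu> 0 G1" "emeasure (Hm \<mu> \<theta>2 UNIV) G2 = Hcod \<mu> \<theta>2 G2"
    by (auto simp: emeasure_Hm)
  have H1_le: "Hcod \<mu> 0 G1 \<le> v"
  proof -
    have "Hcod \<mu> 0 G1 \<le> ennreal \<kappa> * emeasure \<mu> (cball y \<rho>)" unfolding G1_def using y(1) \<rho> by (rule S1_upper)
    also have "\<dots> \<le> ennreal \<kappa> * (ennreal D * emeasure \<mu> (cball x r))"
      using near_ball(4)[OF r(1,2) y(2)] unfolding \<rho>_def by (intro mult_left_mono) auto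
    finally show ?thesis using \<kappa> D by (simp add: v_def ennreal_mult mult.assoc)
  qed
  have H2_le: "q * Hcod \<mu> \<theta>2 G2 \<le> v"
    using S2_upper_near[OF r z] by (simp add: q_def G2_def \<rho>_def v_def)
  have H1: "0 < emeasure (Hm \<mu> 0 UNIV) G1" "emeasure (Hm \<mu> 0 UNIV) G1 < top"
  proof -
    have "0 < emeasure \<mu> (cball y \<rho>)" using ball_pos \<rho> by blast
    also have "\<dots> \<le> ennreal \<kappa> * emeasure \<mu> G1" unfolding G1_def using y(1) \<rho> by (rule S1_lower)
    finally have "0 < emeasure \<mu> G1" by (auto simp: ennreal_zero_less_mult_iff)
    also have "\<dots> \<le> Hcod \<mu> 0 G1" by (rule emeasure_le_Hcod_zero) simp
    finally show "0 < emeasure (Hm \<mu> 0 UNIV) G1" unfolding em .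
    have "v < top" using ball_finite[of x r] by (simp add: v_def ennreal_mult_less_top)
    then show "emeasure (Hm \<mu> 0 UNIV) G1 < top" unfolding em using H1_le by (rule le_less_trans[rotated])
  qed
  have H2: "0 < emeasure (Hm \<mu> \<theta>2 UNIV) G2" "emeasure (Hm \<mu> \<theta>2 UNIV) G2 < top"
  proof -
    have "0 < emeasure \<mu> (cball z \<rho>)" using ball_pos \<rho> by blast
    also have "\<dots> \<le> ennreal (\<kappa> * \<rho> powr \<theta>2) * Hcod \<mu> \<theta>2 G2" unfolding G2_def using z(1) \<rho> by (rule S2_lower)
    finally show "0 < emeasure (Hm \<mu> \<theta>2 UNIV) G2" unfolding em by (auto simp: ennreal_zero_less_mult_iff)
    have "Hcod \<mu> \<theta>2 G2 \<le> ennreal (\<kappa> * \<rho> powr (-\<theta>2)) * emeasure \<mu> (cball z \<rho>)"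
      unfolding G2_def using z(1) \<rho> by (rule S2_upper)
    also have "\<dots> < top" using ball_finite[of z \<rho>] by (simp add: ennreal_mult_less_top)
    finally show "emeasure (Hm \<mu> \<theta>2 UNIV) G2 < top" unfolding em .
  qed
  have K: "0 < D * \<kappa> * (3 * (\<kappa> * D))" using D \<kappa> by simp
  \<comment> \<open>The choice of \<open>b\<close> requires a strict majorant of the gluing average;
    the value itself is recovered at the end by letting the excess tend to 0.\<close>
  have main: "O' \<le> ennreal (D * \<kappa> * (3 * (\<kappa> * D))) * a" if a: "gluing_average f \<rho> y z < a" for a
  proof -
    have fm: "f \<in> borel_measurable (Hm \<mu> 0 UNIV)" "f \<in> borel_measurable (Hm \<mu> \<theta>2 UNIV)" by measurable
    have Gm: "G1 \<in> sets (Hm \<mu> 0 UNIV)" "G2 \<in> sets (Hm \<mu> \<theta>2 UNIV)" by auto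
    obtain b where b1: "Av (Hm \<mu> 0 UNIV) G1 (\<lambda>w. ennreal \<bar>f w - b\<bar>) \<le> a + a"
      and b2: "Av (Hm \<mu> \<theta>2 UNIV) G2 (\<lambda>w. ennreal \<bar>f w - b\<bar>) \<le> a"
      by (rule Av_double_common_constant[OF Gm fm H1 H2 a[unfolded gluing_average_def, folded G1_def G2_def]])
    let ?g = "\<lambda>w. ennreal \<bar>f w - b\<bar>"
    have "(\<integral>\<^sup>+w\<in>G. ?g w \<partial>restr \<mu> S1) = (\<integral>\<^sup>+w\<in>S1. (?g w * indicator G w) \<partial>\<mu>)"
      by (intro nn_integral_restr) auto
    also have "\<dots> \<le> (\<integral>\<^sup>+w\<in>G1. ?g w \<partial>\<mu>)"
      using sub(1) by (intro nn_integral_mono) (auto split: split_indicator)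
    \<comment> \<open>\<open>mseq\<close> integrates against \<open>\<mu>\<close> over S1, the
      gluing average against the codimension-zero Hausdorff measure; \<open>\<mu>\<close> is the
      smaller of the two, as coverings show.\<close>
    also have "\<dots> \<le> (\<integral>\<^sup>+w\<in>G1. ?g w \<partial>Hm \<mu> 0 UNIV)"
    proof (rule nn_integral_mono_measure)
      have "emeasure \<mu> E \<le> emeasure (Hm \<mu> 0 UNIV) E" for E
      proof (cases "E \<in> sets borel")
        case True
        then show ?thesis using emeasure_le_Hcod_zero[OF True] by (simp add: emeasure_Hm)
      qed (simp add: emeasure_notin_sets)
      then show "\<mu> \<le> Hm \<mu> 0 UNIV"
        using sets_eq_imp_space_eq[OF sets_mu] by (simp add: le_measure_iff le_fun_def)
    qed simp
    also have "\<dots> = Av (Hm \<mu> 0 UNIV) G1 ?g * Hcod \<mu> 0 G1"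
      using H1 unfolding em(1)[symmetric] by (intro set_nn_integral_eq_Av) auto
    also have "\<dots> \<le> (a + a) * v" using b1 H1_le by (intro mult_mono) auto
    finally have 1: "(\<integral>\<^sup>+w\<in>G. ?g w \<partial>restr \<mu> S1) \<le> (a + a) * v" .
    have "(\<integral>\<^sup>+w\<in>G. ?g w \<partial>Hm \<mu> \<theta>2 S2) = (\<integral>\<^sup>+w\<in>S2. (?g w * indicator G w) \<partial>Hm \<mu> \<theta>2 UNIV)"
      by (intro nn_integral_Hm) auto
    also have "\<dots> \<le> (\<integral>\<^sup>+w\<in>G2. ?g w \<partial>Hm \<mu> \<theta>2 UNIV)"
      using sub(2) by (intro nn_integral_mono) (auto split: split_indicator)
    also have "\<dots> = Av (Hm \<mu> \<theta>2 UNIV) G2 ?g * Hcod \<mu> \<theta>2 G2"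
      using H2 unfolding em(2)[symmetric] by (intro set_nn_integral_eq_Av) auto
    also have "\<dots> \<le> a * Hcod \<mu> \<theta>2 G2" by (intro mult_right_mono b2) simp
    finally have "q * (\<integral>\<^sup>+w\<in>G. ?g w \<partial>Hm \<mu> \<theta>2 S2) \<le> q * (a * Hcod \<mu> \<theta>2 G2)" by (rule mult_left_mono) simp
    also have "\<dots> = a * (q * Hcod \<mu> \<theta>2 G2)" by (simp only: mult_ac)
    also have "\<dots> \<le> a * v" by (intro mult_left_mono H2_le) simp
    finally have 2: "q * (\<integral>\<^sup>+w\<in>G. ?g w \<partial>Hm \<mu> \<theta>2 S2) \<le> a * v" .
    show ?thesis
      unfolding O'_def G_def
    proof (rule mseq_Osc_le[OF r(1,2) meet])
      have "scaled_integral (kidx r) G ?g \<le> (a + a) * v + a * v"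
        unfolding scaled_integral_def using 1 2 unfolding q_def by (rule add_mono)
      also have "\<dots> = 3 * (v * a)" 
      proof -
        have "(3::ennreal) = 1 + 1 + 1" by simp
        then show ?thesis by (simp only: distrib_right mult_1_left mult.commute[of a v])
      qed
      also have "\<dots> = ennreal (3 * (\<kappa> * D)) * emeasure \<mu> (cball x r) * a"
        using \<kappa> D by (simp add: v_def ennreal_mult mult_ac)
      finally show "scaled_integral (kidx r) (cball x (2 * (c * r))) ?g \<le>
          ennreal (3 * (\<kappa> * D)) * emeasure \<mu> (cball x r) * a" unfolding G_def .
    qed (use D \<kappa> in auto)
  qed
  have "ennreal (1 / (D * \<kappa> * (3 * (\<kappa> * D)))) * O' \<le> gluing_average f \<rho> y z"
  proof (rule ennreal_le_epsilon)
    fix e :: real assume "0 < e" "gluing_average f \<rho> y z < top"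
    then have "gluing_average f \<rho> y z < gluing_average f \<rho> y z + ennreal e" by simp
    then show "ennreal (1 / (D * \<kappa> * (3 * (\<kappa> * D)))) * O' \<le> gluing_average f \<rho> y z + ennreal e"
      unfolding ennreal_inverse_mult_le_iff[OF K] by (rule main)
  qed
  then show ?thesis unfolding ennreal_inverse_mult_le_iff[OF K] by (simp only: O'_def G_def \<rho>_def)
qed

text \<open>The inner integral of \<open>GLterm\<close> at a fixed point z of S2. As a function of z
  alone it can take the place that the oscillation has in the Besov series.\<close>

definition gluing_integral :: "real \<Rightarrow> ('a \<Rightarrow> real) \<Rightarrow> real \<Rightarrow> 'a \<Rightarrow> ennreal" where
  "gluing_integral p f \<rho> z = (\<integral>\<^sup>+y. indicator {(y,z). y \<in> S1 \<and> z \<in> S2 \<and> dist y z \<le> \<rho>} (y,z) *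
     ennreal (1 / sqrt (measure \<mu> (cball y \<rho>) * measure \<mu> (cball z \<rho>))) *
     enn_rpow (gluing_average f \<rho> y z) p \<partial>Hm \<mu> 0 S1)"

text \<open>The pointwise bound holds for all \<open>y\<close> in the part of S1 within r of
  \<open>y0\<close>. With V the mass of B, that part has codimension-zero mass at least V /
  (D\<kappa>), while the weight under the integral is at least 1 / (DV); so integrating over it
  loses only a constant.\<close>

lemma Osc_le_gluing_integral:
  assumes r: "0 < r" "r \<le> 1" "s < kidx r" and meet: "cball x (c * r) \<inter> (S1 \<union> S2) \<noteq> {}"
    and f: "f \<in> borel_measurable borel" and p: "0 < p"
    and y0: "y0 \<in> S1" "dist x y0 \<le> 2 * c * r"
    and z: "z \<in> S2" "dist x z \<le> (2 * c + 1) * r"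
  shows "enn_rpow (Osc (mseq \<mu> \<theta> \<theta>2 S1 S2 (kidx r)) f (cball x (2 * (c * r)))) p \<le>
    ennreal ((D * \<kappa> * (3 * (\<kappa> * D))) powr p * D * (D * \<kappa>)) *
    gluing_integral p f (2 powr (real s - real (kidx r))) z"
proof -
  define \<rho> where "\<rho> = 2 powr (real s - real (kidx r))"
  define P where "P = enn_rpow (Osc (mseq \<mu> \<theta> \<theta>2 S1 S2 (kidx r)) f (cball x (2 * (c * r)))) p"
  define K where "K = (D * \<kappa> * (3 * (\<kappa> * D))) powr p"
  define v where "v = measure \<mu> (cball x r)"
  define F where "F = cball y0 r \<inter> S1"
  have [measurable]: "F \<in> sets borel" by (auto simp: F_def)
  have K: "0 < K" using D \<kappa> by (simp add: K_def)
  have meas: "emeasure \<mu> (cball w t) = ennreal (measure \<mu> (cball w t))" for w t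
    using ball_finite[of w t] by (intro emeasure_eq_ennreal_measure) auto
  have v: "0 < v" "emeasure \<mu> (cball x r) = ennreal v"
    using ball_pos[OF r(1), of x] meas[of x r] by (auto simp: v_def)
  have meas_le: "measure \<mu> (cball w \<rho>) \<le> D * v" if "dist x w \<le> (2 * c + 1) * r" for w
  proof -
    have "ennreal (measure \<mu> (cball w \<rho>)) \<le> ennreal (D * v)"
      using near_ball(4)[OF r(1,2) that] D v by (simp add: meas \<rho>_def ennreal_mult)
    then show ?thesis using D v by (simp add: ennreal_le_iff)
  qed
  have mpos: "0 < measure \<mu> (cball w \<rho>)" for w
    using ball_pos[of \<rho> w] meas[of w \<rho>] by (auto simp: \<rho>_def)
  have pw: "ennreal (1 / (K * (D * v))) * P * indicator F y \<le>
      indicator {(y,z). y \<in> S1 \<and> z \<in> S2 \<and> dist y z \<le> \<rho>} (y,z) *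
      ennreal (1 / sqrt (measure \<mu> (cball y \<rho>) * measure \<mu> (cball z \<rho>))) *
      enn_rpow (gluing_average f \<rho> y z) p" for y
  proof (cases "y \<in> F")
    case True
    then have y: "y \<in> S1" "dist y0 y \<le> r" by (auto simp: F_def)
    have dy: "dist x y \<le> (2 * c + 1) * r"
      using y(2) y0(2) dist_triangle[of x y y0] by (simp add: algebra_simps)
    have "dist y z \<le> (4 * c + 2) * r"
      using dy z(2) dist_triangle2[of y z x] by (simp add: dist_commute algebra_simps)
    then have dyz: "dist y z \<le> \<rho>" using near_ball(2)[OF r(1,2) dy] unfolding \<rho>_def by simp
    have "P \<le> enn_rpow (ennreal (D * \<kappa> * (3 * (\<kappa> * D))) * gluing_average f \<rho> y z) p"
      unfolding P_def \<rho>_def using p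
      by (intro enn_rpow_mono Osc_le_gluing_average r meet f y(1) dy z) auto
    also have "\<dots> = ennreal K * enn_rpow (gluing_average f \<rho> y z) p"
      using p D \<kappa> by (simp add: enn_rpow_mult K_def)
    finally have 1: "ennreal (1 / K) * P \<le> enn_rpow (gluing_average f \<rho> y z) p"
      unfolding ennreal_inverse_mult_le_iff[OF K] .
    have "sqrt (measure \<mu> (cball y \<rho>) * measure \<mu> (cball z \<rho>)) \<le> sqrt ((D * v) * (D * v))"
      using meas_le[OF dy] meas_le[OF z(2)] D v by (intro real_sqrt_le_mono mult_mono) auto
    also have "\<dots> = D * v" using D v by simp
    finally have "1 / (D * v) \<le> 1 / sqrt (measure \<mu> (cball y \<rho>) * measure \<mu> (cball z \<rho>))"
      using mpos D v by (intro divide_left_mono mult_pos_pos) (auto simp: mult_pos_pos)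
    then have "ennreal (1 / (D * v)) * (ennreal (1 / K) * P) \<le>
        ennreal (1 / sqrt (measure \<mu> (cball y \<rho>) * measure \<mu> (cball z \<rho>))) * enn_rpow (gluing_average f \<rho> y z) p"
      using 1 by (intro mult_mono ennreal_leI) auto
    moreover have "ennreal (1 / (K * (D * v))) = ennreal (1 / (D * v)) * ennreal (1 / K)"
      using K D v by (simp flip: ennreal_mult)
    ultimately show ?thesis using True y(1) z(1) dyz by (simp add: mult.assoc)
  qed simp
  have "ennreal (1 / (K * (D * v))) * P * emeasure (Hm \<mu> 0 S1) F =
      (\<integral>\<^sup>+y. ennreal (1 / (K * (D * v))) * P * indicator F y \<partial>Hm \<mu> 0 S1)"
    by (simp add: nn_integral_cmult_indicator)
  also have "\<dots> \<le> gluing_integral p f \<rho> z"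
    unfolding gluing_integral_def by (intro nn_integral_mono pw)
  finally have GI: "ennreal (1 / (K * (D * v))) * P * Hcod \<mu> 0 F \<le> gluing_integral p f \<rho> z"
    by (simp add: emeasure_Hm F_def Int_assoc)
  have mass: "ennreal v \<le> ennreal (D * \<kappa>) * Hcod \<mu> 0 F"
  proof -
    have "dist x y0 \<le> (2 * c + 1) * r" using y0(2) r by (simp add: algebra_simps)
    then have "emeasure \<mu> (cball x r) \<le> ennreal D * emeasure \<mu> (cball y0 r)" by (rule near_ball(6)[OF r(1,2)])
    also have "\<dots> \<le> ennreal D * (ennreal \<kappa> * emeasure \<mu> F)"
      unfolding F_def by (intro mult_left_mono S1_lower y0 r) simp
    also have "\<dots> \<le> ennreal D * (ennreal \<kappa> * Hcod \<mu> 0 F)"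
      by (intro mult_left_mono emeasure_le_Hcod_zero) auto
    finally show ?thesis using D \<kappa> v by (simp add: ennreal_mult mult.assoc)
  qed
  \<comment> \<open>The factor 1 is written out so that one \<open>v\<close> can be replaced by the
    mass of \<open>F\<close>, leaving the quantity bounded in \<open>GI\<close>.\<close>
  have "P = ennreal (K * D * (1 / (K * (D * v)) * v)) * P"
  proof -
    have "K * D * (1 / (K * (D * v)) * v) = 1" using K D v by simp
    then show ?thesis by simp
  qed
  also have "\<dots> = ennreal (K * D) * (ennreal (1 / (K * (D * v))) * P * ennreal v)"
    using K D v by (simp add: ennreal_mult mult_ac del: times_divide_eq_right times_divide_eq_left)
  also have "\<dots> \<le> ennreal (K * D) * (ennreal (1 / (K * (D * v))) * P * (ennreal (D * \<kappa>) * Hcod \<mu> 0 F))"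
    by (intro mult_left_mono mass) auto
  also have "\<dots> = ennreal (K * D) * (ennreal (D * \<kappa>) * (ennreal (1 / (K * (D * v))) * P * Hcod \<mu> 0 F))"
    by (simp only: mult_ac)
  also have "\<dots> \<le> ennreal (K * D) * (ennreal (D * \<kappa>) * gluing_integral p f \<rho> z)"
    by (intro mult_left_mono GI) auto
  also have "\<dots> = ennreal (K * D * (D * \<kappa>)) * gluing_integral p f \<rho> z"
    using K D \<kappa> by (simp add: ennreal_mult mult.assoc)
  finally show ?thesis by (simp only: P_def K_def \<rho>_def)
qed

section \<open>Summation over nice families\<close>

text \<open>All radii are treated at once because \<open>sharp\<close> carries no scale. The point
  where the \<open>c\<close>-fold ball meets the union lies in S1, as G misses S2; the ball of
  radius r about it, cut with S1, is the set \<open>E\<close> for the selection lemma.\<close>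

lemma sharp_sum_le:
  fixes x :: "'i \<Rightarrow> 'a"
  assumes fin: "finite I"
    and disj: "\<And>i j. i \<in> I \<Longrightarrow> j \<in> I \<Longrightarrow> i \<noteq> j \<Longrightarrow> cball (x i) (r i) \<inter> cball (x j) (r j) = {}"
    and r: "\<And>i. i \<in> I \<Longrightarrow> 0 < r i" "\<And>i. i \<in> I \<Longrightarrow> r i \<le> 1" "\<And>i. i \<in> I \<Longrightarrow> s < kidx (r i)"
    and meet: "\<And>i. i \<in> I \<Longrightarrow> cball (x i) (c * r i) \<inter> (S1 \<union> S2) \<noteq> {}"
    and miss: "\<And>i. i \<in> I \<Longrightarrow> cball (x i) (2 * (c * r i)) \<inter> S2 = {}"
    and p: "0 < p" and f: "f \<in> borel_measurable borel"
  shows "(\<Sum>i\<in>I. emeasure \<mu> (cball (x i) (r i)) * ennreal (r i powr (-p)) *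
      enn_rpow (Osc (mseq \<mu> \<theta> \<theta>2 S1 S2 (kidx (r i))) f (cball (x i) (2 * (c * r i)))) p) \<le>
    ennreal ((D * \<kappa> * D * 2 ^ (s + 1)) powr p * (D * \<kappa>)) * (\<integral>\<^sup>+y\<in>S1. enn_rpow (sharp \<mu> S1 f y) p \<partial>\<mu>)"
proof -
  define K where "K = (D * \<kappa> * D * 2 ^ (s + 1)) powr p"
  define b where "b i = ennreal (r i powr (-p)) *
      enn_rpow (Osc (mseq \<mu> \<theta> \<theta>2 S1 S2 (kidx (r i))) f (cball (x i) (2 * (c * r i)))) p" for i
  have K: "0 < K" using D \<kappa> by (simp add: K_def)
  have "\<forall>i\<in>I. \<exists>y. y \<in> S1 \<and> dist (x i) y \<le> c * r i"
  proof
    fix i assume i: "i \<in> I"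
    obtain y where y: "y \<in> cball (x i) (c * r i) \<inter> (S1 \<union> S2)" using meet[OF i] by blast
    have "0 < c * r i" using c r(1)[OF i] by simp
    then have "y \<in> cball (x i) (2 * (c * r i))" using y by simp
    then have "y \<notin> S2" using miss[OF i] by blast
    then show "\<exists>y. y \<in> S1 \<and> dist (x i) y \<le> c * r i" using y by (intro exI[of _ y]) simp
  qed
  then obtain y where y: "\<forall>i\<in>I. y i \<in> S1 \<and> dist (x i) (y i) \<le> c * r i"
    unfolding bchoice_iff by (elim exE)
  have near: "dist (x i) w \<le> (2 * c + 1) * r i" if "i \<in> I" "dist (y i) w \<le> r i" for i w
  proof -
    have "0 < c * r i" using c r(1)[OF that(1)] by simp
    moreover have "(2 * c + 1) * r i = 2 * (c * r i) + r i" by (simp add: algebra_simps)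
    ultimately show ?thesis using y that dist_triangle[of "x i" w "y i"] by fastforce
  qed
  have "(\<Sum>i\<in>I. ennreal (1 / K) * b i * emeasure \<mu> (cball (x i) (r i))) \<le>
      ennreal (D * \<kappa>) * (\<integral>\<^sup>+y. enn_rpow (sharp \<mu> S1 f y) p * indicator S1 y \<partial>\<mu>)"
  proof (rule sum_emeasure_cball_le_nn_integral[where E = "\<lambda>i. cball (y i) (r i) \<inter> S1" and K = "2 * c + 1"])
    show "1 \<le> 2 * c + 1" using c by simp
    fix i assume i: "i \<in> I"
    show "cball (y i) (r i) \<inter> S1 \<subseteq> cball (x i) ((2 * c + 1) * r i)" using near[OF i] by auto
    have "emeasure \<mu> (cball (x i) (3 * ((2 * c + 1) * r i))) \<le> ennreal D * emeasure \<mu> (cball (y i) (r i))"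
      using near[OF i, of "y i"] r(1)[OF i] by (intro near_ball(5) r i) simp
    also have "\<dots> \<le> ennreal D * (ennreal \<kappa> * emeasure \<mu> (cball (y i) (r i) \<inter> S1))"
      using y i by (intro mult_left_mono S1_lower r) auto
    finally show "emeasure \<mu> (cball (x i) (3 * ((2 * c + 1) * r i))) \<le>
        ennreal (D * \<kappa>) * emeasure \<mu> (cball (y i) (r i) \<inter> S1)"
      using D \<kappa> by (simp add: ennreal_mult mult.assoc)
    fix w assume w: "w \<in> cball (y i) (r i) \<inter> S1"
    then have "dist (x i) w \<le> (2 * c + 1) * r i" using near[OF i] by simp
    then have "ennreal (1 / K) * b i \<le> enn_rpow (sharp \<mu> S1 f w) p"
      unfolding ennreal_inverse_mult_le_iff[OF K] unfolding b_def K_def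
      by (intro sharp_term_le r i meet miss p f)
    then show "ennreal (1 / K) * b i \<le> enn_rpow (sharp \<mu> S1 f w) p * indicator S1 w" using w by simp
  qed (use fin disj r in auto)
  then have "ennreal (1 / K) * (\<Sum>i\<in>I. emeasure \<mu> (cball (x i) (r i)) * b i) \<le>
      ennreal (D * \<kappa>) * (\<integral>\<^sup>+y. enn_rpow (sharp \<mu> S1 f y) p * indicator S1 y \<partial>\<mu>)"
    by (simp only: sum_distrib_left mult.assoc mult.commute[of "b i" for i])
  then have "(\<Sum>i\<in>I. emeasure \<mu> (cball (x i) (r i)) * b i) \<le>
      ennreal K * (ennreal (D * \<kappa>) * (\<integral>\<^sup>+y. enn_rpow (sharp \<mu> S1 f y) p * indicator S1 y \<partial>\<mu>))"
    unfolding ennreal_inverse_mult_le_iff[OF K] .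
  then show ?thesis
    unfolding K_def[symmetric] using K D \<kappa> by (subst ennreal_mult) (simp_all add: b_def mult.assoc)
qed

text \<open>The majorant \<open>g\<close> changes with the dyadic level, so the selection lemma is
  applied within each level and the levels are summed. It serves twice, with powers of the
  oscillation on S2 and with the gluing integral as \<open>g\<close>.\<close>

lemma level_sum_le:
  fixes x :: "'i \<Rightarrow> 'a"
  assumes fin: "finite I"
    and disj: "\<And>i j. i \<in> I \<Longrightarrow> j \<in> I \<Longrightarrow> i \<noteq> j \<Longrightarrow> cball (x i) (r i) \<inter> cball (x j) (r j) = {}"
    and r: "\<And>i. i \<in> I \<Longrightarrow> 0 < r i" "\<And>i. i \<in> I \<Longrightarrow> r i \<le> 1" "\<And>i. i \<in> I \<Longrightarrow> s < kidx (r i)"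
    and z: "\<And>i. i \<in> I \<Longrightarrow> z i \<in> S2" "\<And>i. i \<in> I \<Longrightarrow> dist (x i) (z i) \<le> 2 * c * r i"
    and p: "0 < p" and K: "0 < K"
    and le: "\<And>i w. i \<in> I \<Longrightarrow> w \<in> S2 \<Longrightarrow> dist (x i) w \<le> (2 * c + 1) * r i \<Longrightarrow>
      a i \<le> ennreal K * g (kidx (r i) - Suc s) w"
  shows "(\<Sum>i\<in>I. emeasure \<mu> (cball (x i) (r i)) * ennreal (r i powr (-p)) * a i) \<le>
    ennreal (K * (2 powr p * 2 powr (real s * (p - \<theta>2)) * (D * \<kappa>))) *
    (\<Sum>k. ennreal (2 powr (real (Suc k) * (p - \<theta>2))) * (\<integral>\<^sup>+w. g k w \<partial>Hm \<mu> \<theta>2 S2))"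
proof -
  define K' where "K' = K * (2 powr p * 2 powr (real s * (p - \<theta>2)) * (D * \<kappa>))"
  have "(\<Sum>i\<in>{i \<in> I. kidx (r i) - Suc s = k}. emeasure \<mu> (cball (x i) (r i)) * ennreal (r i powr (-p)) * a i) \<le>
      ennreal K' * (ennreal (2 powr (real (Suc k) * (p - \<theta>2))) * (\<integral>\<^sup>+w. g k w \<partial>Hm \<mu> \<theta>2 S2))" for k
  proof -
    \<comment> \<open>Term k of the series has radius 2^(-(k+1)), which equals 2^(s-n) for balls
      with \<open>kidx\<close> equal to n = k + 1 + s.\<close>
    define n where "n = k + Suc s"
    define J where "J = {i \<in> I. kidx (r i) - Suc s = k}"
    have J: "i \<in> I" "kidx (r i) = n" if "i \<in> J" for i
      using that r(3)[of i] by (auto simp: J_def n_def)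
    have sum_le: "(\<Sum>i\<in>J. (ennreal (1 / K) * a i) * emeasure \<mu> (cball (x i) (r i))) \<le>
        ennreal (D * (\<kappa> * 2 powr (- real n * \<theta>2))) * (\<integral>\<^sup>+w. g k w \<partial>Hm \<mu> \<theta>2 S2)"
    proof (rule sum_emeasure_cball_le_nn_integral[where E = "\<lambda>i. cball (z i) (r i) \<inter> S2" and K = "2 * c + 1"])
      show "finite J" using fin by (simp add: J_def)
      show "1 \<le> 2 * c + 1" using c by simp
      show "cball (x i) (r i) \<inter> cball (x j) (r j) = {}" if "i \<in> J" "j \<in> J" "i \<noteq> j" for i j
        using that J by (intro disj) auto
      fix i assume iJ: "i \<in> J"
      note i = J(1)[OF iJ]
      show "0 < r i" using r i by simp
      have near: "dist (x i) w \<le> (2 * c + 1) * r i" if "dist (z i) w \<le> r i" for w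
        using z(2)[OF i] that dist_triangle[of "x i" w "z i"] by (simp add: algebra_simps)
      then show "cball (z i) (r i) \<inter> S2 \<subseteq> cball (x i) ((2 * c + 1) * r i)" by auto
      have "emeasure \<mu> (cball (x i) (3 * ((2 * c + 1) * r i))) \<le> ennreal D * emeasure \<mu> (cball (z i) (r i))"
        using near[of "z i"] r(1)[OF i] by (intro near_ball(5) r i) simp
      also have "\<dots> \<le> ennreal D * (ennreal (\<kappa> * 2 powr (- real n * \<theta>2)) * Hcod \<mu> \<theta>2 (cball (z i) (r i) \<inter> S2))"
        unfolding J(2)[OF iJ, symmetric] by (intro mult_left_mono S2_mass r i z) simp
      finally show "emeasure \<mu> (cball (x i) (3 * ((2 * c + 1) * r i))) \<le>
          ennreal (D * (\<kappa> * 2 powr (- real n * \<theta>2))) * emeasure (Hm \<mu> \<theta>2 S2) (cball (z i) (r i) \<inter> S2)"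
        using D \<kappa> by (simp add: ennreal_mult mult.assoc emeasure_Hm Int_assoc)
      fix w assume "w \<in> cball (z i) (r i) \<inter> S2"
      then have "a i \<le> ennreal K * g (kidx (r i) - Suc s) w" using near by (intro le i) auto
      then show "ennreal (1 / K) * a i \<le> g k w"
        unfolding ennreal_inverse_mult_le_iff[OF K] J(2)[OF iJ] by (simp add: n_def)
    qed auto
    have "(\<Sum>i\<in>J. emeasure \<mu> (cball (x i) (r i)) * ennreal (r i powr (-p)) * a i) \<le>
        (\<Sum>i\<in>J. ennreal (K * 2 powr ((real n + 1) * p)) * ((ennreal (1 / K) * a i) * emeasure \<mu> (cball (x i) (r i))))"
    proof (rule sum_mono)
      fix i assume iJ: "i \<in> J"
      note i = J(1)[OF iJ]
      have "2 powr (- (real n + 1)) \<le> r i"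
        using kidx_bounds(2)[OF r(1)[OF i] r(2)[OF i]] unfolding J(2)[OF iJ]
        by (simp add: powr_diff)
      then have "r i powr (-p) \<le> (2 powr (- (real n + 1))) powr (-p)"
        using p by (intro powr_mono2') auto
      then have rp: "r i powr (-p) \<le> 2 powr ((real n + 1) * p)" by (simp add: powr_powr algebra_simps)
      have KK: "ennreal K * (ennreal (1 / K) * a i) = a i"
      proof -
        have "ennreal K * ennreal (1 / K) = 1" using K by (simp flip: ennreal_mult)
        then show ?thesis by (simp only: mult.assoc[symmetric] mult_1_left)
      qed
      have "emeasure \<mu> (cball (x i) (r i)) * ennreal (r i powr (-p)) * a i \<le>
          emeasure \<mu> (cball (x i) (r i)) * ennreal (2 powr ((real n + 1) * p)) * a i"
        using rp by (intro mult_right_mono mult_left_mono ennreal_leI) auto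
      also have "\<dots> = emeasure \<mu> (cball (x i) (r i)) * ennreal (2 powr ((real n + 1) * p)) * (ennreal K * (ennreal (1 / K) * a i))"
        unfolding KK ..
      also have "\<dots> = ennreal (K * 2 powr ((real n + 1) * p)) * ((ennreal (1 / K) * a i) * emeasure \<mu> (cball (x i) (r i)))"
        using K by (subst ennreal_mult) (simp_all add: mult_ac)
      finally show "emeasure \<mu> (cball (x i) (r i)) * ennreal (r i powr (-p)) * a i \<le>
          ennreal (K * 2 powr ((real n + 1) * p)) * ((ennreal (1 / K) * a i) * emeasure \<mu> (cball (x i) (r i)))" .
    qed
    also have "\<dots> = ennreal (K * 2 powr ((real n + 1) * p)) * (\<Sum>i\<in>J. (ennreal (1 / K) * a i) * emeasure \<mu> (cball (x i) (r i)))"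
      by (simp only: sum_distrib_left)
    also have "\<dots> \<le> ennreal (K * 2 powr ((real n + 1) * p)) *
        (ennreal (D * (\<kappa> * 2 powr (- real n * \<theta>2))) * (\<integral>\<^sup>+w. g k w \<partial>Hm \<mu> \<theta>2 S2))"
      by (intro mult_left_mono sum_le) simp
    also have "\<dots> = ennreal (K * 2 powr ((real n + 1) * p) * (D * (\<kappa> * 2 powr (- real n * \<theta>2)))) *
        (\<integral>\<^sup>+w. g k w \<partial>Hm \<mu> \<theta>2 S2)"
      using K D \<kappa> by (subst ennreal_mult) (simp_all add: mult.assoc)
    also have "\<dots> = ennreal (K' * 2 powr (real (Suc k) * (p - \<theta>2))) * (\<integral>\<^sup>+w. g k w \<partial>Hm \<mu> \<theta>2 S2)"
    proof -
      \<comment> \<open>The exponents are (n+1)p from r^(-p) and -n\<theta>2 from the mass of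
        \<open>E\<close>. With n = s + (k+1), the part (k+1)(p-\<theta>2) is the weight of the
        series and the rest is constant.\<close>
      have "2 powr ((real n + 1) * p) * 2 powr (- real n * \<theta>2) =
          2 powr p * 2 powr (real s * (p - \<theta>2)) * 2 powr (real (Suc k) * (p - \<theta>2))"
        unfolding powr_add[symmetric] n_def by (simp add: algebra_simps)
      then have "K * 2 powr ((real n + 1) * p) * (D * (\<kappa> * 2 powr (- real n * \<theta>2))) =
          K' * 2 powr (real (Suc k) * (p - \<theta>2))"
        unfolding K'_def by (simp add: mult_ac)
      then show ?thesis by (simp only:)
    qed
    also have "\<dots> = ennreal K' * (ennreal (2 powr (real (Suc k) * (p - \<theta>2))) * (\<integral>\<^sup>+w. g k w \<partial>Hm \<mu> \<theta>2 S2))"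
      using K D \<kappa> by (subst ennreal_mult) (simp_all add: K'_def mult.assoc)
    finally show ?thesis unfolding J_def .
  qed
  then have "(\<Sum>i\<in>I. emeasure \<mu> (cball (x i) (r i)) * ennreal (r i powr (-p)) * a i) \<le>
      (\<Sum>k. ennreal K' * (ennreal (2 powr (real (Suc k) * (p - \<theta>2))) * (\<integral>\<^sup>+w. g k w \<partial>Hm \<mu> \<theta>2 S2)))"
    by (intro sum_le_suminf_by_level[OF fin, where l = "\<lambda>i. kidx (r i) - Suc s"])
  then show ?thesis unfolding K'_def[symmetric] by simp
qed

section \<open>Balls of radius comparable to 1\<close>

lemma large_balls_overlap:
  fixes x :: "'i \<Rightarrow> 'a"
  assumes fin: "finite I"
    and disj: "\<And>i j. i \<in> I \<Longrightarrow> j \<in> I \<Longrightarrow> i \<noteq> j \<Longrightarrow> cball (x i) (r i) \<inter> cball (x j) (r j) = {}"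
    and r: "\<And>i. i \<in> I \<Longrightarrow> 0 < r i" "\<And>i. i \<in> I \<Longrightarrow> r i \<le> 1" "\<And>i. i \<in> I \<Longrightarrow> 2 powr (- (real s + 1)) \<le> r i"
  shows "real (card {i \<in> I. w \<in> cball (x i) (2 * (c * r i))}) \<le> D"
proof (rule card_disjoint_balls_le[where x = x and r = r and y = w and s = "2 * c + 1"])
  show "disjoint_family_on (\<lambda>i. cball (x i) (r i)) {i \<in> I. w \<in> cball (x i) (2 * (c * r i))}"
    using disj by (auto simp: disjoint_family_on_def)
  fix i assume "i \<in> {i \<in> I. w \<in> cball (x i) (2 * (c * r i))}"
  then have i: "i \<in> I" and wi: "dist (x i) w \<le> 2 * (c * r i)" by auto
  have "c * r i \<le> c * 1" using c r(2)[OF i] by (intro mult_left_mono) auto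
  then have wi': "dist (x i) w \<le> 2 * c" using wi by simp
  show "cball (x i) (r i) \<subseteq> cball w (2 * c + 1)"
  proof
    fix u assume "u \<in> cball (x i) (r i)"
    then show "u \<in> cball w (2 * c + 1)"
      using wi' r(2)[OF i] dist_triangle[of w u "x i"] by (simp add: dist_commute)
  qed
  show "emeasure \<mu> (cball w (2 * c + 1)) \<le> ennreal D * emeasure \<mu> (cball (x i) (r i))"
  proof (rule dbl[OF r(1)[OF i] r(2)[OF i]])
    \<comment> \<open>The 2s in the exponent 2s + 3 comes from here: radii may be as small as
      2^(-(s+1)), and 2^(2s+3) r must still reach 2^s, which exceeds 4c + 1.\<close>
    have "(2::real) ^ s = 2 powr (real s)" by (simp add: powr_realpow)
    also have "\<dots> \<le> 2 powr (real (2 * s + 3) + (- (real s + 1)))" by (intro powr_mono) auto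
    also have "\<dots> = 2 ^ (2 * s + 3) * 2 powr (- (real s + 1))"
      unfolding powr_add by (subst powr_realpow) auto
    also have "\<dots> \<le> 2 ^ (2 * s + 3) * r i" by (intro mult_left_mono r i) simp
    finally show "dist w (x i) + (2 * c + 1) \<le> 2 ^ (2 * s + 3) * r i"
      using wi' s by (simp add: dist_commute)
  qed
qed (use fin D c in auto)

text \<open>With b = 0 the oscillation is at most the mean of |f|, and powers of r are bounded by
  constants. Disjoint balls of such size have enlargements G of bounded overlap, so the integrals of
  |f|^p over the G add up to at most D times the p-th powers of the two L_p norms.\<close>

lemma large_sum_le:
  fixes x :: "'i \<Rightarrow> 'a"
  assumes fin: "finite I"
    and disj: "\<And>i j. i \<in> I \<Longrightarrow> j \<in> I \<Longrightarrow> i \<noteq> j \<Longrightarrow> cball (x i) (r i) \<inter> cball (x j) (r j) = {}"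
    and r: "\<And>i. i \<in> I \<Longrightarrow> 0 < r i" "\<And>i. i \<in> I \<Longrightarrow> r i \<le> 1" "\<And>i. i \<in> I \<Longrightarrow> kidx (r i) \<le> s"
    and meet: "\<And>i. i \<in> I \<Longrightarrow> cball (x i) (c * r i) \<inter> (S1 \<union> S2) \<noteq> {}"
    and p: "1 < p" and f [measurable]: "f \<in> borel_measurable borel"
  shows "(\<Sum>i\<in>I. emeasure \<mu> (cball (x i) (r i)) * ennreal (r i powr (-p)) *
      enn_rpow (Osc (mseq \<mu> \<theta> \<theta>2 S1 S2 (kidx (r i))) f (cball (x i) (2 * (c * r i)))) p) \<le>
    ennreal (2 powr ((real s + 1) * p) * 2 powr p * (D * \<kappa>) * D) *
    ((\<integral>\<^sup>+w. enn_rpow (ennreal \<bar>f w\<bar>) p \<partial>restr \<mu> S1) + (\<integral>\<^sup>+w. enn_rpow (ennreal \<bar>f w\<bar>) p \<partial>Hm \<mu> \<theta>2 S2))"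
proof -
  define h where "h w = enn_rpow (ennreal \<bar>f w\<bar>) p" for w
  define G where "G i = cball (x i) (2 * (c * r i))" for i
  define K where "K = 2 powr ((real s + 1) * p) * 2 powr p * (D * \<kappa>)"
  have [measurable]: "h \<in> borel_measurable borel" unfolding h_def by measurable
  have r_lower: "2 powr (- (real s + 1)) \<le> r i" if "i \<in> I" for i
  proof -
    have "2 powr (- (real s + 1)) \<le> 2 powr (- real (kidx (r i)) + (- 1))"
      using r(3)[OF that] by (intro powr_mono) auto
    also have "\<dots> = 2 powr (- real (kidx (r i))) / 2" unfolding powr_add by (simp add: powr_minus_divide)
    also have "\<dots> \<le> r i" using kidx_bounds(2)[OF r(1)[OF that] r(2)[OF that]] by simp
    finally show ?thesis .
  qed
  have ball_term: "emeasure \<mu> (cball (x i) (r i)) * ennreal (r i powr (-p)) *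
      enn_rpow (Osc (mseq \<mu> \<theta> \<theta>2 S1 S2 (kidx (r i))) f (G i)) p \<le>
      ennreal K * ((\<integral>\<^sup>+w\<in>G i. h w \<partial>restr \<mu> S1) + (\<integral>\<^sup>+w\<in>G i. h w \<partial>Hm \<mu> \<theta>2 S2))" if i: "i \<in> I" for i
  proof -
    let ?m = "mseq \<mu> \<theta> \<theta>2 S1 S2 (kidx (r i))"
    let ?e = "emeasure \<mu> (cball (x i) (r i))"
    have "r i powr (-p) \<le> (2 powr (- (real s + 1))) powr (-p)"
      using p r_lower[OF i] by (intro powr_mono2') auto
    then have rp: "r i powr (-p) \<le> 2 powr ((real s + 1) * p)" by (simp add: powr_powr algebra_simps)
    have sets_m: "sets ?m = sets borel" by (simp add: sets_mseq)
    have "Osc ?m f (G i) \<le> Av ?m (G i) (\<lambda>w. ennreal \<bar>f w\<bar>)"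
      unfolding Osc_def by (rule INF_lower2[of 0]) auto
    then have "enn_rpow (Osc ?m f (G i)) p \<le> enn_rpow (Av ?m (G i) (\<lambda>w. ennreal \<bar>f w\<bar>)) p"
      using p by (intro enn_rpow_mono) auto
    also have "\<dots> \<le> ennreal (2 powr p) * Av ?m (G i) h"
      unfolding h_def using p f sets_m
      by (intro enn_rpow_Av_le) (auto simp: G_def cong: measurable_cong_sets)
    finally have "?e * ennreal (r i powr (-p)) * enn_rpow (Osc ?m f (G i)) p \<le>
        ?e * ennreal (2 powr ((real s + 1) * p)) * (ennreal (2 powr p) * Av ?m (G i) h)"
      using rp by (intro mult_mono ennreal_leI) auto
    also have "\<dots> = ennreal (2 powr ((real s + 1) * p) * 2 powr p) * (?e * Av ?m (G i) h)"
      by (subst ennreal_mult) (simp_all add: mult_ac)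
    also have "\<dots> \<le> ennreal (2 powr ((real s + 1) * p) * 2 powr p) * (ennreal (D * \<kappa>) * scaled_integral (kidx (r i)) (G i) h)"
      unfolding G_def by (intro mult_left_mono mseq_Av_le r i meet) auto
    also have "\<dots> = ennreal K * scaled_integral (kidx (r i)) (G i) h"
      unfolding K_def using D \<kappa> by (subst (2) ennreal_mult) (simp_all add: mult.assoc)
    also have "\<dots> \<le> ennreal K * ((\<integral>\<^sup>+w\<in>G i. h w \<partial>restr \<mu> S1) + 1 * (\<integral>\<^sup>+w\<in>G i. h w \<partial>Hm \<mu> \<theta>2 S2))"
    proof -
      have "2 powr (- real (kidx (r i)) * \<theta>2) \<le> 2 powr 0" using \<theta>2 by (intro powr_mono) auto
      then have "ennreal (2 powr (- real (kidx (r i)) * \<theta>2)) \<le> 1" by (simp add: ennreal_le_1)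
      then show ?thesis unfolding scaled_integral_def by (intro mult_left_mono add_left_mono mult_right_mono) auto
    qed
    finally show ?thesis by simp
  qed
  have ov: "real (card {i \<in> I. w \<in> G i}) \<le> D" for w
    unfolding G_def using fin disj r(1,2) r_lower by (rule large_balls_overlap)
  have "(\<Sum>i\<in>I. emeasure \<mu> (cball (x i) (r i)) * ennreal (r i powr (-p)) *
      enn_rpow (Osc (mseq \<mu> \<theta> \<theta>2 S1 S2 (kidx (r i))) f (G i)) p) \<le>
      (\<Sum>i\<in>I. ennreal K * ((\<integral>\<^sup>+w\<in>G i. h w \<partial>restr \<mu> S1) + (\<integral>\<^sup>+w\<in>G i. h w \<partial>Hm \<mu> \<theta>2 S2)))"
    by (intro sum_mono ball_term)
  also have "\<dots> = ennreal K * ((\<Sum>i\<in>I. \<integral>\<^sup>+w\<in>G i. h w \<partial>restr \<mu> S1) + (\<Sum>i\<in>I. \<integral>\<^sup>+w\<in>G i. h w \<partial>Hm \<mu> \<theta>2 S2))"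
    by (simp only: sum_distrib_left[symmetric] sum.distrib)
  also have "\<dots> \<le> ennreal K * (ennreal D * (\<integral>\<^sup>+w. h w \<partial>restr \<mu> S1) + ennreal D * (\<integral>\<^sup>+w. h w \<partial>Hm \<mu> \<theta>2 S2))"
    by (intro mult_left_mono add_mono sum_overlap_le fin ov) (auto simp: G_def)
  also have "\<dots> = ennreal (K * D) * ((\<integral>\<^sup>+w. h w \<partial>restr \<mu> S1) + (\<integral>\<^sup>+w. h w \<partial>Hm \<mu> \<theta>2 S2))"
    using D \<kappa> by (subst ennreal_mult) (simp_all add: K_def distrib_left mult.assoc)
  finally show ?thesis by (simp only: G_def h_def K_def)
qed

section \<open>The four groups of balls and the final norm\<close>

lemma nice_family_sum_le:
  assumes p: "1 < p"
  shows "\<exists>K>0. \<forall>f M x r. f \<in> borel_measurable borel \<and> nice_family (S1 \<union> S2) c M x r \<longrightarrow>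
    (\<Sum>i<M. emeasure \<mu> (cball (x i) (r i)) * ennreal (r i powr (-p)) *
      enn_rpow (Osc_tilde (mseq \<mu> \<theta> \<theta>2 S1 S2 (kidx (r i))) (S1 \<union> S2) f (x i) (c * r i)) p) \<le>
    ennreal K * ((\<integral>\<^sup>+y\<in>S1. enn_rpow (sharp \<mu> S1 f y) p \<partial>\<mu>) +
      ((\<integral>\<^sup>+w. enn_rpow (ennreal \<bar>f w\<bar>) p \<partial>restr \<mu> S1) + (\<integral>\<^sup>+w. enn_rpow (ennreal \<bar>f w\<bar>) p \<partial>Hm \<mu> \<theta>2 S2)) +
      (\<Sum>k. ennreal (2 powr (real (Suc k) * (p - \<theta>2))) *
        (\<integral>\<^sup>+w. enn_rpow (Osc (Hm \<mu> \<theta>2 S2) f (cball w (2 powr (- real (Suc k))))) p \<partial>Hm \<mu> \<theta>2 S2)) +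
      GLterm \<mu> p S1 0 S2 \<theta>2 f)"
proof -
  define K1 where "K1 = (D * \<kappa> * D * 2 ^ (s + 1)) powr p * (D * \<kappa>)"
  define K2 where "K2 = 2 powr ((real s + 1) * p) * 2 powr p * (D * \<kappa>) * D"
  define K' where "K' = 2 powr p * 2 powr (real s * (p - \<theta>2)) * (D * \<kappa>)"
  define K3 where "K3 = (D * \<kappa> * (\<kappa> * D)) powr p"
  define K4 where "K4 = (D * \<kappa> * (3 * (\<kappa> * D))) powr p * D * (D * \<kappa>)"
  define K where "K = K1 + K2 + K3 * K' + K4 * K'"
  have pos: "0 < K1" "0 < K2" "0 < K'" "0 < K3" "0 < K4"
    using D \<kappa> by (auto simp: K1_def K2_def K'_def K3_def K4_def intro!: mult_pos_pos)
  have "0 < K3 * K'" "0 < K4 * K'" using pos by auto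
  then have Kpos: "0 < K" and K_ge: "K1 \<le> K" "K2 \<le> K" "K3 * K' \<le> K" "K4 * K' \<le> K"
    using pos unfolding K_def by linarith+
  show ?thesis
  proof (intro exI[of _ K] conjI allI impI Kpos)
    fix f :: "'a \<Rightarrow> real" and M :: nat and x :: "nat \<Rightarrow> 'a" and r :: "nat \<Rightarrow> real"
    assume "f \<in> borel_measurable borel \<and> nice_family (S1 \<union> S2) c M x r"
    then have f: "f \<in> borel_measurable borel"
      and disj: "\<And>i j. i < M \<Longrightarrow> j < M \<Longrightarrow> i \<noteq> j \<Longrightarrow> cball (x i) (r i) \<inter> cball (x j) (r j) = {}"
      and r: "\<And>i. i < M \<Longrightarrow> 0 < r i" "\<And>i. i < M \<Longrightarrow> r i \<le> 1"
      and meet: "\<And>i. i < M \<Longrightarrow> cball (x i) (c * r i) \<inter> (S1 \<union> S2) \<noteq> {}"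
      unfolding nice_family_def by simp_all
    define G where "G i = cball (x i) (2 * (c * r i))" for i
    define O' where "O' i = Osc (mseq \<mu> \<theta> \<theta>2 S1 S2 (kidx (r i))) f (G i)" for i
    define t where "t i = emeasure \<mu> (cball (x i) (r i)) * ennreal (r i powr (-p)) * enn_rpow (O' i) p" for i
    define R1 where "R1 = (\<integral>\<^sup>+y\<in>S1. enn_rpow (sharp \<mu> S1 f y) p \<partial>\<mu>)"
    define R2 where "R2 = (\<integral>\<^sup>+w. enn_rpow (ennreal \<bar>f w\<bar>) p \<partial>restr \<mu> S1) + (\<integral>\<^sup>+w. enn_rpow (ennreal \<bar>f w\<bar>) p \<partial>Hm \<mu> \<theta>2 S2)"
    define R3 where "R3 = (\<Sum>k. ennreal (2 powr (real (Suc k) * (p - \<theta>2))) *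
        (\<integral>\<^sup>+w. enn_rpow (Osc (Hm \<mu> \<theta>2 S2) f (cball w (2 powr (- real (Suc k))))) p \<partial>Hm \<mu> \<theta>2 S2))"
    define R4 where "R4 = GLterm \<mu> p S1 0 S2 \<theta>2 f"
    \<comment> \<open>Since S1 has codimension 0, the gluing weights have exponent p - \<theta>2
      like the Besov weights, so \<open>level_sum_le\<close> fits both series.\<close>
    have R4: "R4 = (\<Sum>k. ennreal (2 powr (real (Suc k) * (p - \<theta>2))) *
        (\<integral>\<^sup>+w. gluing_integral p f (2 powr (- real (Suc k))) w \<partial>Hm \<mu> \<theta>2 S2))"
      unfolding R4_def GLterm_def gluing_integral_def gluing_average_def Let_def by simp
    define I where "I = {..<M}"
    \<comment> \<open>Successive intersections and differences give a partition, so the sum splits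
      exactly. In \<open>A1\<close> the enlargement misses S2 and hence, by \<open>meet\<close>,
      reaches S1.\<close>
    define L where "L = I \<inter> {i. kidx (r i) \<le> s}"
    define A1 where "A1 = (I - {i. kidx (r i) \<le> s}) \<inter> {i. G i \<inter> S2 = {}}"
    define A2 where "A2 = ((I - {i. kidx (r i) \<le> s}) - {i. G i \<inter> S2 = {}}) \<inter> {i. G i \<inter> S1 = {}}"
    define A3 where "A3 = ((I - {i. kidx (r i) \<le> s}) - {i. G i \<inter> S2 = {}}) - {i. G i \<inter> S1 = {}}"
    have fin: "finite L" "finite A1" "finite A2" "finite A3"
      by (auto simp: I_def L_def A1_def A2_def A3_def)
    have sub: "L \<subseteq> I" "A1 \<subseteq> I" "A2 \<subseteq> I" "A3 \<subseteq> I" unfolding L_def A1_def A2_def A3_def by blast+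
    have lt: "i < M" if "i \<in> A" "A \<subseteq> I" for i A using that by (auto simp: I_def)
    have split: "(\<Sum>i\<in>I. t i) = (\<Sum>i\<in>L. t i) + ((\<Sum>i\<in>A1. t i) + ((\<Sum>i\<in>A2. t i) + (\<Sum>i\<in>A3. t i)))"
      unfolding L_def A1_def A2_def A3_def
      by (subst sum.Int_Diff[of I t "{i. kidx (r i) \<le> s}"], simp add: I_def,
          subst sum.Int_Diff[of "I - {i. kidx (r i) \<le> s}" t "{i. G i \<inter> S2 = {}}"], simp add: I_def,
          subst sum.Int_Diff[of "(I - {i. kidx (r i) \<le> s}) - {i. G i \<inter> S2 = {}}" t "{i. G i \<inter> S1 = {}}"], simp add: I_def)
        (rule refl)
    have small: "s < kidx (r i)" if "i \<in> A1 \<or> i \<in> A2 \<or> i \<in> A3" for i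
      using that by (auto simp: A1_def A2_def A3_def not_le)
    \<comment> \<open>The radius 2^(s - \<open>kidx\<close>) belongs to term \<open>kidx\<close> - s
      - 1 of a series that starts at radius 1/2; truncated subtraction is harmless since s <
      \<open>kidx\<close>.\<close>
    have scale: "2 powr (real s - real (kidx (r i))) = 2 powr (- real (Suc (kidx (r i) - Suc s)))"
      if "s < kidx (r i)" for i using that by (simp add: of_nat_diff)
    have "(\<Sum>i\<in>L. t i) \<le> ennreal K2 * R2"
      unfolding t_def O'_def G_def K2_def R2_def
      using lt[OF _ sub(1)] by (intro large_sum_le fin disj r meet p f) (auto simp: L_def)
    also have "\<dots> \<le> ennreal K * R2" by (intro mult_right_mono ennreal_leI K_ge) simp
    finally have B2: "(\<Sum>i\<in>L. t i) \<le> ennreal K * R2" .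
    have "(\<Sum>i\<in>A1. t i) \<le> ennreal K1 * R1"
      unfolding t_def O'_def G_def K1_def R1_def
      using lt[OF _ sub(2)] small p by (intro sharp_sum_le fin disj r meet f) (auto simp: A1_def G_def)
    also have "\<dots> \<le> ennreal K * R1" by (intro mult_right_mono ennreal_leI K_ge) simp
    finally have B1: "(\<Sum>i\<in>A1. t i) \<le> ennreal K * R1" .
    have "\<forall>i\<in>A2 \<union> A3. \<exists>z. z \<in> S2 \<and> dist (x i) z \<le> 2 * c * r i"
    proof
      fix i assume "i \<in> A2 \<union> A3"
      then have "G i \<inter> S2 \<noteq> {}" unfolding A2_def A3_def by blast
      then obtain z where "z \<in> G i" "z \<in> S2" by blast
      then show "\<exists>z. z \<in> S2 \<and> dist (x i) z \<le> 2 * c * r i" by (intro exI[of _ z]) (simp add: G_def)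
    qed
    then obtain z where z: "\<forall>i\<in>A2 \<union> A3. z i \<in> S2 \<and> dist (x i) (z i) \<le> 2 * c * r i"
      unfolding bchoice_iff by (elim exE)
    have "(\<Sum>i\<in>A2. t i) \<le> ennreal (K3 * K') * R3"
      unfolding t_def K'_def R3_def
    proof (rule level_sum_le[where z = z])
      fix i w assume i: "i \<in> A2" and w: "w \<in> S2" "dist (x i) w \<le> (2 * c + 1) * r i"
      note iM = lt[OF i sub(3)]
      have sm: "s < kidx (r i)" using small i by blast
      have "G i \<inter> S1 = {}" using i unfolding A2_def by blast
      then have "O' i \<le> ennreal (D * \<kappa> * (\<kappa> * D)) * Osc (Hm \<mu> \<theta>2 S2) f (cball w (2 powr (- real (Suc (kidx (r i) - Suc s)))))"
        unfolding O'_def G_def scale[OF sm, symmetric] by (intro Osc_le_S2 r iM sm meet f w)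
      then have "enn_rpow (O' i) p \<le> enn_rpow (ennreal (D * \<kappa> * (\<kappa> * D)) *
          Osc (Hm \<mu> \<theta>2 S2) f (cball w (2 powr (- real (Suc (kidx (r i) - Suc s)))))) p"
        using p by (intro enn_rpow_mono) auto
      then show "enn_rpow (O' i) p \<le> ennreal K3 *
          enn_rpow (Osc (Hm \<mu> \<theta>2 S2) f (cball w (2 powr (- real (Suc (kidx (r i) - Suc s)))))) p"
        using p D \<kappa> by (simp add: enn_rpow_mult K3_def)
    qed (use fin disj r z pos p small lt[OF _ sub(3)] in auto)
    also have "\<dots> \<le> ennreal K * R3" by (intro mult_right_mono ennreal_leI K_ge) simp
    finally have B3: "(\<Sum>i\<in>A2. t i) \<le> ennreal K * R3" .
    have "(\<Sum>i\<in>A3. t i) \<le> ennreal (K4 * K') * R4"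
      unfolding t_def K'_def R4
    proof (rule level_sum_le[where z = z])
      fix i w assume i: "i \<in> A3" and w: "w \<in> S2" "dist (x i) w \<le> (2 * c + 1) * r i"
      note iM = lt[OF i sub(4)]
      have sm: "s < kidx (r i)" using small i by blast
      have "G i \<inter> S1 \<noteq> {}" using i unfolding A3_def by blast
      then obtain y where "y \<in> G i" "y \<in> S1" by blast
      then have y: "y \<in> S1" "dist (x i) y \<le> 2 * c * r i" by (simp_all add: G_def)
      have "0 < p" using p by simp
      then show "enn_rpow (O' i) p \<le> ennreal K4 *
          gluing_integral p f (2 powr (- real (Suc (kidx (r i) - Suc s)))) w"
        unfolding O'_def G_def K4_def scale[OF sm, symmetric]
        by (intro Osc_le_gluing_integral[where ?y0.0 = y] r iM sm meet f w y)
    qed (use fin disj r z pos p small lt[OF _ sub(4)] in auto)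
    also have "\<dots> \<le> ennreal K * R4" by (intro mult_right_mono ennreal_leI K_ge) simp
    finally have B4: "(\<Sum>i\<in>A3. t i) \<le> ennreal K * R4" .
    have "(\<Sum>i\<in>I. t i) \<le> ennreal K * R2 + (ennreal K * R1 + (ennreal K * R3 + ennreal K * R4))"
      unfolding split by (intro add_mono B1 B2 B3 B4)
    also have "\<dots> = ennreal K * (R1 + R2 + R3 + R4)" by (simp only: distrib_left add_ac)
    finally have "(\<Sum>i<M. t i) \<le> ennreal K * (R1 + R2 + R3 + R4)" unfolding I_def .
    moreover have "t i = emeasure \<mu> (cball (x i) (r i)) * ennreal (r i powr (-p)) *
      enn_rpow (Osc_tilde (mseq \<mu> \<theta> \<theta>2 S1 S2 (kidx (r i))) (S1 \<union> S2) f (x i) (c * r i)) p" if "i < M" for i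
      using meet[OF that] unfolding t_def O'_def G_def Osc_tilde_def by simp
    ultimately show "(\<Sum>i<M. emeasure \<mu> (cball (x i) (r i)) * ennreal (r i powr (-p)) *
      enn_rpow (Osc_tilde (mseq \<mu> \<theta> \<theta>2 S1 S2 (kidx (r i))) (S1 \<union> S2) f (x i) (c * r i)) p) \<le>
    ennreal K * ((\<integral>\<^sup>+y\<in>S1. enn_rpow (sharp \<mu> S1 f y) p \<partial>\<mu>) +
      ((\<integral>\<^sup>+w. enn_rpow (ennreal \<bar>f w\<bar>) p \<partial>restr \<mu> S1) + (\<integral>\<^sup>+w. enn_rpow (ennreal \<bar>f w\<bar>) p \<partial>Hm \<mu> \<theta>2 S2)) +
      (\<Sum>k. ennreal (2 powr (real (Suc k) * (p - \<theta>2))) *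
        (\<integral>\<^sup>+w. enn_rpow (Osc (Hm \<mu> \<theta>2 S2) f (cball w (2 powr (- real (Suc k))))) p \<partial>Hm \<mu> \<theta>2 S2)) +
      GLterm \<mu> p S1 0 S2 \<theta>2 f)"
      unfolding R1_def R2_def R3_def R4_def by simp
  qed
qed

lemma BSN_le:
  assumes p: "1 < p"
  shows "\<exists>C>0. \<forall>f. f \<in> borel_measurable borel \<longrightarrow>
    BSN \<mu> p (mseq \<mu> \<theta> \<theta>2 S1 S2) (S1 \<union> S2) c f
      \<le> ennreal C * (enn_rpow (\<integral>\<^sup>+x\<in>S1. enn_rpow (sharp \<mu> S1 f x) p \<partial>\<mu>) (1/p)
                     + Lpnorm (restr \<mu> S1) p f
                     + besov_norm \<mu> \<theta>2 (1 - \<theta>2/p) p S2 f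
                     + GL3 \<mu> p S1 S2 \<theta>2 f)"
proof -
  obtain K where K: "0 < K" and bound: "\<forall>f M x r. f \<in> borel_measurable borel \<and> nice_family (S1 \<union> S2) c M x r \<longrightarrow>
    (\<Sum>i<M. emeasure \<mu> (cball (x i) (r i)) * ennreal (r i powr (-p)) *
      enn_rpow (Osc_tilde (mseq \<mu> \<theta> \<theta>2 S1 S2 (kidx (r i))) (S1 \<union> S2) f (x i) (c * r i)) p) \<le>
    ennreal K * ((\<integral>\<^sup>+y\<in>S1. enn_rpow (sharp \<mu> S1 f y) p \<partial>\<mu>) +
      ((\<integral>\<^sup>+w. enn_rpow (ennreal \<bar>f w\<bar>) p \<partial>restr \<mu> S1) + (\<integral>\<^sup>+w. enn_rpow (ennreal \<bar>f w\<bar>) p \<partial>Hm \<mu> \<theta>2 S2)) +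
      (\<Sum>k. ennreal (2 powr (real (Suc k) * (p - \<theta>2))) *
        (\<integral>\<^sup>+w. enn_rpow (Osc (Hm \<mu> \<theta>2 S2) f (cball w (2 powr (- real (Suc k))))) p \<partial>Hm \<mu> \<theta>2 S2)) +
      GLterm \<mu> p S1 0 S2 \<theta>2 f)"
    using nice_family_sum_le[OF p, of \<theta>] by (elim exE conjE)
  have p0: "0 < p" "0 \<le> p" "0 < 1 / p" "0 \<le> 1 / p" using p by auto
  have root: "enn_rpow (enn_rpow a (1 / p)) p = a" "enn_rpow (enn_rpow a p) (1 / p) = a" for a
    using p0 by (simp_all add: enn_rpow_rpow)
  show ?thesis
  proof (intro exI[of _ "(K * 5) powr (1 / p)"] conjI allI impI)
    show "0 < (K * 5) powr (1 / p)" using K by simp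
    fix f :: "'a \<Rightarrow> real" assume f: "f \<in> borel_measurable borel"
    define R1 where "R1 = (\<integral>\<^sup>+y\<in>S1. enn_rpow (sharp \<mu> S1 f y) p \<partial>\<mu>)"
    define R2 where "R2 = (\<integral>\<^sup>+w. enn_rpow (ennreal \<bar>f w\<bar>) p \<partial>restr \<mu> S1)"
    define R2' where "R2' = (\<integral>\<^sup>+w. enn_rpow (ennreal \<bar>f w\<bar>) p \<partial>Hm \<mu> \<theta>2 S2)"
    define R3 where "R3 = (\<Sum>k. ennreal (2 powr (real (Suc k) * (p - \<theta>2))) *
        (\<integral>\<^sup>+w. enn_rpow (Osc (Hm \<mu> \<theta>2 S2) f (cball w (2 powr (- real (Suc k))))) p \<partial>Hm \<mu> \<theta>2 S2))"
    define R4 where "R4 = GLterm \<mu> p S1 0 S2 \<theta>2 f"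
    define N where "N = enn_rpow R1 (1/p) + Lpnorm (restr \<mu> S1) p f + besov_norm \<mu> \<theta>2 (1 - \<theta>2/p) p S2 f
        + GL3 \<mu> p S1 S2 \<theta>2 f"
    \<comment> \<open>Each of the five p-th powers is compared with N^p separately, which is the
      origin of the factor 5.\<close>
    have le_N: "R \<le> enn_rpow N p" if "enn_rpow R (1/p) \<le> N" for R
      using enn_rpow_mono[OF p0(2) that] by (simp only: root)
    have besov: "besov_norm \<mu> \<theta>2 (1 - \<theta>2/p) p S2 f = enn_rpow R2' (1/p) + enn_rpow R3 (1/p)"
    proof -
      \<comment> \<open>The smoothness 1 - \<theta>2/p turns the Besov weight into the weight
        2^(k(p-\<theta>2)) of the level sums.\<close>
      have "real (Suc k) * (1 - \<theta>2 / p) * p = real (Suc k) * (p - \<theta>2)" for k using p0 by (simp add: field_simps)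
      then show ?thesis unfolding besov_norm_def Lpnorm_def R2'_def R3_def by (simp only:)
    qed
    have "enn_rpow R1 (1/p) \<le> N" "enn_rpow R2 (1/p) \<le> N"
      unfolding N_def Lpnorm_def R2_def by (auto intro: order_trans[OF _ add_increasing2] add_increasing add_increasing2)
    moreover have "enn_rpow R2' (1/p) \<le> N" "enn_rpow R3 (1/p) \<le> N"
      unfolding N_def besov by (auto intro: add_increasing add_increasing2)
    moreover have "enn_rpow R4 (1/p) \<le> N"
    proof -
      have "enn_rpow R4 (1/p) \<le> GL3 \<mu> p S1 S2 \<theta>2 f"
        unfolding GL3_def R4_def using p0 by (intro enn_rpow_mono) auto
      then show ?thesis unfolding N_def by (intro add_increasing) auto
    qed
    ultimately have Rs: "R1 \<le> enn_rpow N p" "R2 \<le> enn_rpow N p" "R2' \<le> enn_rpow N p"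
      "R3 \<le> enn_rpow N p" "R4 \<le> enn_rpow N p"
      by (auto intro: le_N)
    have "BSN \<mu> p (mseq \<mu> \<theta> \<theta>2 S1 S2) (S1 \<union> S2) c f \<le> ennreal ((K * 5) powr (1 / p)) * N"
      unfolding BSN_def
    proof (rule SUP_least, clarify)
      fix M and x :: "nat \<Rightarrow> 'a" and r :: "nat \<Rightarrow> real"
      assume nice: "nice_family (S1 \<union> S2) c M x r"
      let ?T = "\<Sum>i<M. emeasure \<mu> (cball (x i) (r i)) * ennreal (r i powr (-p)) *
        enn_rpow (Osc_tilde (mseq \<mu> \<theta> \<theta>2 S1 S2 (kidx (r i))) (S1 \<union> S2) f (x i) (c * r i)) p"
      have "?T \<le> ennreal K * (R1 + (R2 + R2') + R3 + R4)"
        using bound f nice unfolding R1_def R2_def R2'_def R3_def R4_def by blast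
      also have "\<dots> \<le> ennreal K * (enn_rpow N p + (enn_rpow N p + enn_rpow N p) + enn_rpow N p + enn_rpow N p)"
        by (intro mult_left_mono add_mono Rs) simp
      also have "\<dots> = ennreal (K * 5) * enn_rpow N p"
      proof -
        have "ennreal (K * 5) = ennreal K * (1 + (1 + 1) + 1 + 1)" using K by (simp add: ennreal_mult)
        then show ?thesis by (simp only: distrib_right mult_1_left mult.assoc)
      qed
      finally have "enn_rpow ?T (1/p) \<le> enn_rpow (ennreal (K * 5) * enn_rpow N p) (1/p)"
        using p0 by (intro enn_rpow_mono)
      also have "\<dots> = ennreal ((K * 5) powr (1 / p)) * N"
        using p0 K by (simp add: enn_rpow_mult root)
      finally show "enn_rpow ?T (1/p) \<le> ennreal ((K * 5) powr (1 / p)) * N" .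
    qed
    then show "BSN \<mu> p (mseq \<mu> \<theta> \<theta>2 S1 S2) (S1 \<union> S2) c f \<le> ennreal ((K * 5) powr (1 / p)) *
        (enn_rpow (\<integral>\<^sup>+x\<in>S1. enn_rpow (sharp \<mu> S1 f x) p \<partial>\<mu>) (1/p)
                     + Lpnorm (restr \<mu> S1) p f
                     + besov_norm \<mu> \<theta>2 (1 - \<theta>2/p) p S2 f
                     + GL3 \<mu> p S1 S2 \<theta>2 f)"
      unfolding N_def R1_def .
  qed
qed

end

theorem theorem3p19:
  fixes \<mu> :: "'a::polish_space measure"
    and p \<theta> \<theta>2 :: real
    and S1 S2 :: "'a set"
  assumes borel_sets: "sets \<mu> = sets borel"
    and loc_finite: "\<And>x r. emeasure \<mu> (cball x r) < top"
    and full_supp: "\<And>x r. r > 0 \<Longrightarrow> emeasure \<mu> (cball x r) > 0"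
    and doubling: "unif_loc_doubling \<mu>"
    and p_gt1: "1 < p"
    and poincare: "weak_local_poincare \<mu> p"
    and th2_pos: "0 < \<theta>2" and th2_lt_p: "\<theta>2 < p" and th2_lt_Q: "ereal \<theta>2 < Qlow \<mu>"
    and th_ge: "\<theta>2 \<le> \<theta>" and th_lt: "\<theta> < p"
    and S1_ADR: "ADR \<mu> 0 S1" and S2_ADR: "ADR \<mu> \<theta>2 S2"
    and S1_closed: "closed S1" and S2_closed: "closed S2"
  shows "\<forall>c\<ge>1. \<exists>C>0. \<forall>f::'a \<Rightarrow> real.
      f \<in> borel_measurable borel \<and>
      Lpnorm (Hm \<mu> 0 S1) p f < top \<and> Lpnorm (Hm \<mu> \<theta>2 S2) p f < top \<longrightarrow>
      BSN \<mu> p (mseq \<mu> \<theta> \<theta>2 S1 S2) (S1 \<union> S2) c f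
        \<le> ennreal C * ( enn_rpow (\<integral>\<^sup>+x\<in>S1. enn_rpow (sharp \<mu> S1 f x) p \<partial>\<mu>) (1/p)
                       + Lpnorm (restr \<mu> S1) p f
                       + besov_norm \<mu> \<theta>2 (1 - \<theta>2/p) p S2 f
                       + GL3 \<mu> p S1 S2 \<theta>2 f)"
proof (intro allI impI)
  fix c :: real assume c: "1 \<le> c"
  interpret doubling_measure \<mu>
    using borel_sets loc_finite full_supp doubling by unfold_locales
  \<comment> \<open>The order of choice matters: \<open>s\<close> depends only on \<open>c\<close>,
    and the range 2^(2s+3) covered by the comparison constant \<open>D\<close> depends on
    \<open>s\<close>.\<close>
  obtain s where s: "4 * c + 2 < (2::real) ^ s" using real_arch_pow[of 2 "4 * c + 2"] by auto
  obtain D where D: "1 \<le> D" and dbl: "\<forall>x w r a. 0 < r \<and> r \<le> 1 \<and> dist x w + a \<le> 2 ^ (2 * s + 3) * r \<longrightarrow>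
      emeasure \<mu> (cball x a) \<le> ennreal D * emeasure \<mu> (cball w r)"
    using doubling_iterate[of "2 * s + 3"] by (elim exE conjE)
  obtain \<kappa>1 where \<kappa>1: "0 < \<kappa>1" "\<forall>y\<in>S1. \<forall>r. 0 < r \<and> r \<le> 1 \<longrightarrow>
      emeasure \<mu> (cball y r) \<le> ennreal (\<kappa>1 * r powr 0) * Hcod \<mu> 0 (cball y r \<inter> S1) \<and>
      Hcod \<mu> 0 (cball y r \<inter> S1) \<le> ennreal (\<kappa>1 * r powr (-0)) * emeasure \<mu> (cball y r)"
    using ADR_bounds[OF S1_ADR] by (elim exE conjE)
  obtain \<kappa>2 where \<kappa>2: "0 < \<kappa>2" "\<forall>z\<in>S2. \<forall>r. 0 < r \<and> r \<le> 1 \<longrightarrow>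
      emeasure \<mu> (cball z r) \<le> ennreal (\<kappa>2 * r powr \<theta>2) * Hcod \<mu> \<theta>2 (cball z r \<inter> S2) \<and>
      Hcod \<mu> \<theta>2 (cball z r \<inter> S2) \<le> ennreal (\<kappa>2 * r powr (-\<theta>2)) * emeasure \<mu> (cball z r)"
    using ADR_bounds[OF S2_ADR] by (elim exE conjE)
  obtain \<kappa>3 where \<kappa>3: "0 < \<kappa>3" "\<forall>y\<in>S1. \<forall>r. 0 < r \<and> r \<le> 1 \<longrightarrow>
      emeasure \<mu> (cball y r) \<le> ennreal \<kappa>3 * emeasure \<mu> (cball y r \<inter> S1)"
    using ADR_zero_emeasure[OF S1_ADR] by (elim exE conjE)
  \<comment> \<open>The sum dominates all three regularity constants, and the summand 1 gives 1
    \<le> \<kappa>.\<close>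
  define \<kappa> where "\<kappa> = 1 + \<kappa>1 + \<kappa>2 + \<kappa>3"
  have \<kappa>: "1 \<le> \<kappa>" "\<kappa>1 \<le> \<kappa>" "\<kappa>2 \<le> \<kappa>" "\<kappa>3 \<le> \<kappa>" using \<kappa>1(1) \<kappa>2(1) \<kappa>3(1) by (auto simp: \<kappa>_def)
  have enlarge: "a \<le> ennreal (\<kappa> * q) * b" if "a \<le> ennreal (k * q) * b" "k \<le> \<kappa>" "0 \<le> q" for a b k q
    using that by (meson ennreal_leI mult_right_mono order_trans zero_le)
  interpret regular_pair \<mu> S1 S2 \<theta>2 c \<kappa> D s
  proof unfold_locales
    fix y and r :: real assume y: "y \<in> S1" "0 < r" "r \<le> 1"
    show "emeasure \<mu> (cball y r) \<le> ennreal \<kappa> * emeasure \<mu> (cball y r \<inter> S1)"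
      using \<kappa>3(2) y enlarge[OF _ \<kappa>(4), of _ 1] by simp
    show "Hcod \<mu> 0 (cball y r \<inter> S1) \<le> ennreal \<kappa> * emeasure \<mu> (cball y r)"
      using \<kappa>1(2) y enlarge[OF _ \<kappa>(2), of _ 1] by simp
  next
    fix z and r :: real assume z: "z \<in> S2" "0 < r" "r \<le> 1"
    show "emeasure \<mu> (cball z r) \<le> ennreal (\<kappa> * r powr \<theta>2) * Hcod \<mu> \<theta>2 (cball z r \<inter> S2)"
      using \<kappa>2(2) z by (intro enlarge[OF _ \<kappa>(3)]) auto
    show "Hcod \<mu> \<theta>2 (cball z r \<inter> S2) \<le> ennreal (\<kappa> * r powr (-\<theta>2)) * emeasure \<mu> (cball z r)"
      using \<kappa>2(2) z by (intro enlarge[OF _ \<kappa>(3)]) auto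
  qed (use c s D dbl \<kappa>(1) th2_pos S1_closed S2_closed in auto)
  show "\<exists>C>0. \<forall>f::'a \<Rightarrow> real.
      f \<in> borel_measurable borel \<and>
      Lpnorm (Hm \<mu> 0 S1) p f < top \<and> Lpnorm (Hm \<mu> \<theta>2 S2) p f < top \<longrightarrow>
      BSN \<mu> p (mseq \<mu> \<theta> \<theta>2 S1 S2) (S1 \<union> S2) c f
        \<le> ennreal C * ( enn_rpow (\<integral>\<^sup>+x\<in>S1. enn_rpow (sharp \<mu> S1 f x) p \<partial>\<mu>) (1/p)
                       + Lpnorm (restr \<mu> S1) p f
                       + besov_norm \<mu> \<theta>2 (1 - \<theta>2/p) p S2 f
                       + GL3 \<mu> p S1 S2 \<theta>2 f)"
    using BSN_le[OF p_gt1, of \<theta>] by blast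
qed

end
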